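(* Let $1\le d<D$ and $k\ge 3$ be integers, let $\tau_{min}=0$, let $L_\perp>0$, let $x\in\mathbb{R}^D$, and write $\mathcal{P}^k_{(x)}$ for the set of distributions in $\mathcal{P}^k_{0,\mathbf{L},f_{min},f_{max}}$, $\mathbf{L}=(L_\perp,L_3,\dots,L_k)$, whose support contains $x$. (1) If $D\ge d+3$, then, provided that $L_3/L_\perp^2,\ldots,L_k/L_\perp^{k-1},\ L_\perp^d/f_{min}$ and $f_{max}/L_\perp^d$ are large enough (depending only on $d$ and $k$), for all $n\ge 1$, $$\inf_{\hat T}\ \sup_{P\in\mathcal{P}^k_{(x)}}\ \mathbb{E}_{P^{\otimes n}}\angle\bigl(T_xM,\hat T\bigr)\ \ge\ \frac12>0,$$ where the infimum is taken over all estimators $\hat T=\hat T(X_1,\dots,X_n)$. (2) For any $D\ge d+1$, provided that $L_3/L_\perp^2,\ldots,L_k/L_\perp^{k-1},\ L_\perp^d/f_{min}$ and $f_{max}/L_\perp^d$ are large enough (depending only on $d$ and $k$), for all $n\ge1$, $$\inf_{\widehat{II}}\ \sup_{P\in\mathcal{P}^k_{(x)}}\ \mathbb{E}_{P^{\otimes n}}\bigl\|II_x^M\circ\pi_{T_xM}-\widehat{II}\bigr\|_{op}\ \ge\ \frac{L_\perp}{4}>0,$$ where the infimum is taken over all estimators $\widehat{II}=\widehat{II}(X_1,\dots,X_n)$. In both statements $M$ denotes the support of $P$.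
   Context: All submanifolds $M\subset\mathbb{R}^D$ are $d$-dimensional, compact, without boundary and at least $\mathcal{C}^2$. $T_pM$ is the tangent space of $M$ at $p$ and $II_p^M:T_pM\times T_pM\to T_pM^\perp$ is the second fundamental form. $\mathcal{B}(p,r)$ is the closed Euclidean ball and $\mathcal{B}_T(p,r)=\mathcal{B}(p,r)\cap T$. $\|\cdot\|_{op}$ is the operator norm of linear or multilinear maps. $\pi_T$ is the orthogonal projection onto the linear subspace $T$, and for subspaces $U,V$ of the same dimension $\angle(U,V)=\|\pi_U-\pi_V\|_{op}$. $II_x^M\circ\pi_{T_xM}$ is the bilinear map $(u,v)\mapsto II_x^M(\pi_{T_xM}u,\pi_{T_xM}v)$ on $\mathbb{R}^D$. Reach: $Med(M)=\{z\in\mathbb{R}^D:\exists p\ne q\in M,\ \|z-p\|=\|z-q\|=d(z,M)\}$ and $\tau_M=\inf_{p\in M}d(p,Med(M))$. Class $\mathcal{C}^k_{\tau_{min},\mathbf{L}}$ ($k\ge3$): the set of $d$-dimensional compact connected submanifolds $M$ of $\mathbb{R}^D$ with $\tau_M\ge\tau_{min}$ (for $\tau_{min}=0$ this condition is void) such that for all $p\in M$ there is a local one-to-one parametrization $\Psi_p:\mathcal{B}_{T_pM}(0,r)\to M$, $\Psi_p(v)=p+v+\mathbf{N}_p(v)$, for some $r\ge\frac1{4L_\perp}$, with $\mathbf{N}_p\in\mathcal{C}^k(\mathcal{B}_{T_pM}(0,r),\mathbb{R}^D)$, $\mathbf{N}_p(0)=0$, $d_0\mathbf{N}_p=0$, and,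 for all $\|v\|\le\frac1{4L_\perp}$, $\|d_v^2\mathbf{N}_p\|_{op}\le L_\perp$ and $\|d_v^i\mathbf{N}_p\|_{op}\le L_i$ for $3\le i\le k$. Model: for $0<f_{min}\le f_{max}<\infty$, $\mathcal{P}^k_{\tau_{min},\mathbf{L},f_{min},f_{max}}$ is the set of probability distributions with support some $M\in\mathcal{C}^k_{\tau_{min},\mathbf{L}}$ having a density $f$ with respect to the volume measure on $M$ (the restriction of the $d$-dimensional Hausdorff measure) with $f_{min}\le f(y)\le f_{max}$ for all $y\in M$. $(X_1,\dots,X_n)$ is an i.i.d. sample with law $P^{\otimes n}$. Estimators are measurable functions of the sample; $\hat T$ takes values in $d$-dimensional linear subspaces of $\mathbb{R}^D$, and $\widehat{II}$ in bilinear maps $\mathbb{R}^D\times\mathbb{R}^D\to\mathbb{R}^D$. *)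

theory Defs
  imports "HOL-Analysis.Analysis" "HOL-Probability.Probability"
begin

text \<open>
  The thresholds in the theorem depend on \<open>d\<close> and \<open>k\<close> but not on the ambient dimension \<open>D\<close>,
  so \<open>D\<close> has to be quantified inside the statement. Hence \<open>\<real>\<^sup>D\<close> is not a type
  \<open>real ^ 'n\<close>, but the subspace \<open>Rn D\<close> of the finitely supported real sequences, with the
  Euclidean inner product, norm and topology.
\<close>

typedef rvec = "{f :: nat \<Rightarrow> real. finite {i. f i \<noteq> 0}}"
  morphisms coord Abs_rvec
  by (rule exI[of _ "\<lambda>_. 0"]) simp

setup_lifting type_definition_rvec

lemma finite_coord [simp]: "finite {i. coord x i \<noteq> 0}"
  using coord[of x] by simp

instantiation rvec :: real_vector
begin

lift_definition zero_rvec :: rvec is "\<lambda>_. 0" by simp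

lift_definition plus_rvec :: "rvec \<Rightarrow> rvec \<Rightarrow> rvec" is "\<lambda>f g i. f i + g i"
  subgoal for f g by (rule finite_subset[of _ "{i. f i \<noteq> 0} \<union> {i. g i \<noteq> 0}"]) auto
  done

lift_definition minus_rvec :: "rvec \<Rightarrow> rvec \<Rightarrow> rvec" is "\<lambda>f g i. f i - g i"
  subgoal for f g by (rule finite_subset[of _ "{i. f i \<noteq> 0} \<union> {i. g i \<noteq> 0}"]) auto
  done

lift_definition uminus_rvec :: "rvec \<Rightarrow> rvec" is "\<lambda>f i. - f i" by simp

lift_definition scaleR_rvec :: "real \<Rightarrow> rvec \<Rightarrow> rvec" is "\<lambda>c f i. c * f i"
  subgoal for c f by (rule finite_subset[of _ "{i. f i \<noteq> 0}"]) auto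
  done

instance
  by standard (transfer; auto simp: algebra_simps)+

end

lemma coord_simps [simp]:
  "coord 0 i = 0" "coord (x + y) i = coord x i + coord y i"
  "coord (x - y) i = coord x i - coord y i" "coord (- x) i = - coord x i"
  "coord (c *\<^sub>R x) i = c * coord x i"
  by (transfer; simp)+

instantiation rvec :: real_inner
begin

definition inner_rvec :: "rvec \<Rightarrow> rvec \<Rightarrow> real" where
  "inner_rvec x y = (\<Sum>i | coord x i \<noteq> 0. coord x i * coord y i)"

definition norm_rvec :: "rvec \<Rightarrow> real" where
  "norm_rvec x = sqrt (x \<bullet> x)"

definition sgn_rvec :: "rvec \<Rightarrow> rvec" where
  "sgn_rvec x = x /\<^sub>R norm x"

definition dist_rvec :: "rvec \<Rightarrow> rvec \<Rightarrow> real" where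
  "dist_rvec x y = norm (x - y)"

definition uniformity_rvec :: "(rvec \<times> rvec) filter" where
  "uniformity_rvec = (INF e\<in>{0<..}. principal {(x, y). dist x y < e})"

definition open_rvec :: "rvec set \<Rightarrow> bool" where
  "open_rvec U \<longleftrightarrow> (\<forall>x\<in>U. eventually (\<lambda>(x', y). x' = x \<longrightarrow> y \<in> U) uniformity)"

lemma inner_rvec_eq_sum:
  assumes "finite A" "{i. coord x i \<noteq> 0} \<subseteq> A"
  shows "x \<bullet> y = (\<Sum>i\<in>A. coord x i * coord y i)"
  unfolding inner_rvec_def by (rule sum.mono_neutral_left) (use assms in auto)

instance
proof
  fix x y z :: rvec and r :: real
  let ?A = "{i. coord x i \<noteq> 0} \<union> {i. coord y i \<noteq> 0}"
  have fin: "finite ?A" by simp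
  show "sgn x = x /\<^sub>R norm x" by (rule sgn_rvec_def)
  show "dist x y = norm (x - y)" by (rule dist_rvec_def)
  show "(uniformity :: (rvec \<times> rvec) filter) = (INF e\<in>{0<..}. principal {(x, y). dist x y < e})"
    by (rule uniformity_rvec_def)
  show "open U \<longleftrightarrow> (\<forall>x\<in>U. eventually (\<lambda>(x', y). x' = x \<longrightarrow> y \<in> U) uniformity)" for U :: "rvec set"
    by (rule open_rvec_def)
  show "x \<bullet> y = y \<bullet> x"
    using inner_rvec_eq_sum[OF fin, of x y] inner_rvec_eq_sum[OF fin, of y x]
    by (simp add: mult.commute)
  have "{i. coord (x + y) i \<noteq> 0} \<subseteq> ?A" by auto
  then show "(x + y) \<bullet> z = x \<bullet> z + y \<bullet> z"
    using inner_rvec_eq_sum[OF fin, of x z] inner_rvec_eq_sum[OF fin, of y z]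
      inner_rvec_eq_sum[OF fin, of "x + y" z]
    by (simp add: sum.distrib algebra_simps)
  have "{i. coord (r *\<^sub>R x) i \<noteq> 0} \<subseteq> {i. coord x i \<noteq> 0}" by auto
  then show "(r *\<^sub>R x) \<bullet> y = r * (x \<bullet> y)"
    using inner_rvec_eq_sum[of "{i. coord x i \<noteq> 0}" "r *\<^sub>R x" y]
    by (simp add: inner_rvec_def sum_distrib_left algebra_simps)
  show "0 \<le> x \<bullet> x" by (auto simp: inner_rvec_def intro: sum_nonneg)
  have "x = 0 \<longleftrightarrow> (\<forall>i. coord x i = 0)" by transfer auto
  then show "x \<bullet> x = 0 \<longleftrightarrow> x = 0"
    unfolding inner_rvec_def by (subst sum_nonneg_eq_0_iff) auto
  show "norm x = sqrt (x \<bullet> x)" by (rule norm_rvec_def)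
qed

end

definition Rn :: "nat \<Rightarrow> rvec set" where
  "Rn D = {x. \<forall>i\<ge>D. coord x i = 0}"

definition orth_proj :: "'a::real_inner set \<Rightarrow> 'a \<Rightarrow> 'a" where
  "orth_proj T u = (THE y. y \<in> T \<and> (\<forall>z\<in>T. (u - y) \<bullet> z = 0))"

definition angle :: "'a::real_inner set \<Rightarrow> 'a set \<Rightarrow> real" where
  "angle U V = onorm (\<lambda>u. orth_proj U u - orth_proj V u)"

text \<open>
  Operator norm of an \<open>i\<close>-linear map on the subspace \<open>V\<close>; the \<open>i\<close> arguments are passed as a list.
\<close>

definition mult_onorm :: "'a::real_normed_vector set \<Rightarrow> nat \<Rightarrow> ('a list \<Rightarrow> 'b::real_normed_vector) \<Rightarrow> ennreal" where
  "mult_onorm V i F =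
     (SUP us \<in> {us. length us = i \<and> set us \<subseteq> V \<inter> cball 0 1}. ennreal (norm (F us)))"

definition bilinear_map_on :: "'a::real_vector set \<Rightarrow> ('a \<Rightarrow> 'a \<Rightarrow> 'a) \<Rightarrow> bool" where
  "bilinear_map_on E B \<longleftrightarrow>
     (\<forall>u\<in>E. \<forall>v\<in>E. B u v \<in> E) \<and>
     (\<forall>u\<in>E. \<forall>u'\<in>E. \<forall>v\<in>E. \<forall>a b. B (a *\<^sub>R u + b *\<^sub>R u') v = a *\<^sub>R B u v + b *\<^sub>R B u' v) \<and>
     (\<forall>u\<in>E. \<forall>v\<in>E. \<forall>v'\<in>E. \<forall>a b. B u (a *\<^sub>R v + b *\<^sub>R v') = a *\<^sub>R B u v + b *\<^sub>R B u v')"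

text \<open>
  \<open>F i w [u\<^sub>1, \<dots>, u\<^sub>i]\<close> is the \<open>i\<close>-th differential at \<open>w\<close> of the map \<open>f\<close>, defined on \<open>S \<subseteq> V\<close>,
  in the directions \<open>u\<^sub>1, \<dots>, u\<^sub>i \<in> V\<close>. Since \<^const>\<open>has_derivative\<close> speaks of linear maps on the
  whole type, differentials are precomposed with the projection onto \<open>V\<close>. If \<open>S\<close> is relatively
  open in \<open>V\<close>, or a nondegenerate closed ball of \<open>V\<close>, the values \<open>F i w us\<close> with
  \<open>us\<close> in \<open>V\<close> are determined by \<open>f\<close>. As \<open>V\<close> is finite-dimensional, differentiability and
  continuity of \<open>F i\<close> for fixed arguments \<open>us\<close> are the same as for the operator norm.
\<close>

definition Ck_differentials ::
  "nat \<Rightarrow> 'a::real_inner set \<Rightarrow> 'a set \<Rightarrow> ('a \<Rightarrow> 'b::real_normed_vector) \<Rightarrow>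
   (nat \<Rightarrow> 'a \<Rightarrow> 'a list \<Rightarrow> 'b) \<Rightarrow> bool" where
  "Ck_differentials k V S f F \<longleftrightarrow>
     (\<forall>w\<in>S. F 0 w [] = f w) \<and>
     (\<forall>i<k. \<forall>us. length us = i \<and> set us \<subseteq> V \<longrightarrow>
        (\<forall>w\<in>S. ((\<lambda>y. F i y us) has_derivative (\<lambda>u. F (Suc i) w (orth_proj V u # us))) (at w within S))) \<and>
     (\<forall>us. length us = k \<and> set us \<subseteq> V \<longrightarrow> continuous_on S (\<lambda>w. F k w us))"

definition submanifold_C2 :: "nat \<Rightarrow> nat \<Rightarrow> rvec set \<Rightarrow> bool" where
  "submanifold_C2 D d M \<longleftrightarrow> M \<subseteq> Rn D \<and>
     (\<forall>p\<in>M. \<exists>W \<phi> \<psi> F.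
        openin (top_of_set (Rn d)) W \<and> openin (top_of_set M) (\<phi> ` W) \<and> p \<in> \<phi> ` W \<and>
        homeomorphism W (\<phi> ` W) \<phi> \<psi> \<and>
        Ck_differentials 2 (Rn d) W \<phi> F \<and>
        (\<forall>w\<in>W. \<forall>u\<in>Rn d. F 1 w [u] = 0 \<longrightarrow> u = 0))"

text \<open>
  Curves need only be differentiable at \<open>0\<close>; on a \<open>C\<^sup>1\<close> submanifold, which is locally a graph,
  their velocities are still exactly the tangent vectors.
\<close>

definition curve_through :: "'a::real_normed_vector set \<Rightarrow> 'a \<Rightarrow> 'a \<Rightarrow> (real \<Rightarrow> 'a) \<Rightarrow> bool" where
  "curve_through M p u \<gamma> \<longleftrightarrow>
     \<gamma> 0 = p \<and> (\<forall>\<^sub>F t in nhds 0. \<gamma> t \<in> M) \<and> (\<gamma> has_vector_derivative u) (at 0)"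

definition tangent_space :: "'a::real_normed_vector set \<Rightarrow> 'a \<Rightarrow> 'a set" where
  "tangent_space M p = {u. \<exists>\<gamma>. curve_through M p u \<gamma>}"

text \<open>
  \<open>II\<^sub>p(u, v)\<close> is the component normal to \<open>M\<close> of the Euclidean derivative, in the direction \<open>u\<close>, of a
  tangent vector field \<open>Y\<close> with \<open>Y(p) = v\<close> (Gauss formula). The field is only needed along a
  curve with velocity \<open>u\<close> at \<open>p\<close>, and the result does not depend on the choice of curve and field.
\<close>

definition second_fundamental_form :: "'a::real_inner set \<Rightarrow> 'a \<Rightarrow> 'a \<Rightarrow> 'a \<Rightarrow> 'a" where
  "second_fundamental_form M p u v =
     (THE w. \<exists>\<gamma> Y Y'. curve_through M p u \<gamma> \<and>
        Y 0 = v \<and> (\<forall>\<^sub>F t in nhds 0. Y t \<in> tangent_space M (\<gamma> t)) \<and>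
        (Y has_vector_derivative Y') (at 0) \<and>
        w = Y' - orth_proj (tangent_space M p) Y')"

definition medial_axis :: "nat \<Rightarrow> rvec set \<Rightarrow> rvec set" where
  "medial_axis D M =
     {z \<in> Rn D. \<exists>p\<in>M. \<exists>q\<in>M. p \<noteq> q \<and> dist z p = infdist z M \<and> dist z q = infdist z M}"

definition reach :: "nat \<Rightarrow> rvec set \<Rightarrow> ennreal" where
  "reach D M = (INF p\<in>M. INF z\<in>medial_axis D M. ennreal (dist p z))"

text \<open>
  \<open>Lp\<close> and \<open>L i\<close>, for \<open>3 \<le> i \<le> k\<close>, are \<open>L\<^sub>\<bottom>\<close> and \<open>L\<^sub>i\<close>. An injective continuous map of the
  compact ball into \<open>M\<close> is a homeomorphism onto its image, and the image of the open ball is open in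
  \<open>M\<close> by invariance of domain, so neither is required separately.
\<close>

definition local_parametrization ::
  "nat \<Rightarrow> real \<Rightarrow> (nat \<Rightarrow> real) \<Rightarrow> rvec set \<Rightarrow> rvec \<Rightarrow> bool" where
  "local_parametrization k Lp L M p \<longleftrightarrow>
     (let T = tangent_space M p in
      \<exists>r N F. r \<ge> 1 / (4 * Lp) \<and>
        (\<lambda>v. p + v + N v) ` (T \<inter> cball 0 r) \<subseteq> M \<and>
        inj_on (\<lambda>v. p + v + N v) (T \<inter> cball 0 r) \<and>
        Ck_differentials k T (T \<inter> cball 0 r) N F \<and>
        N 0 = 0 \<and> (\<forall>u\<in>T. F 1 0 [u] = 0) \<and>
        (\<forall>v \<in> T \<inter> cball 0 (1 / (4 * Lp)).
           mult_onorm T 2 (F 2 v) \<le> ennreal Lp \<and>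
           (\<forall>i\<in>{3..k}. mult_onorm T i (F i v) \<le> ennreal (L i))))"

definition manifold_class ::
  "nat \<Rightarrow> nat \<Rightarrow> nat \<Rightarrow> real \<Rightarrow> real \<Rightarrow> (nat \<Rightarrow> real) \<Rightarrow> rvec set set" where
  "manifold_class D d k \<tau>min Lp L =
     {M. submanifold_C2 D d M \<and> compact M \<and> connected M \<and> reach D M \<ge> ennreal \<tau>min \<and>
         (\<forall>p\<in>M. local_parametrization k Lp L M p)}"

text \<open>
  The normalising factor makes the \<open>d\<close>-dimensional Hausdorff measure agree with Lebesgue measure on
  \<open>d\<close>-dimensional Euclidean space, hence with the Riemannian volume on \<open>d\<close>-dimensional submanifolds.
  Borel sets are Caratheodory measurable for \<open>hausdorff_outer d\<close> (it is a metric outer measure), so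
  \<open>emeasure (hausdorff_measure d)\<close> coincides with it on them. The empty set is treated apart
  because \<open>0 ^ 0 = 1\<close>.
\<close>

definition hausdorff_pre :: "nat \<Rightarrow> real \<Rightarrow> 'a::metric_space set \<Rightarrow> ennreal" where
  "hausdorff_pre d \<delta> A =
     (INF C \<in> {C :: nat \<Rightarrow> 'a set. A \<subseteq> (\<Union>i. C i) \<and> (\<forall>i. bounded (C i) \<and> diameter (C i) \<le> \<delta>)}.
        \<Sum>i. if C i = {} then 0 else ennreal (unit_ball_vol (real d) * (diameter (C i) / 2) ^ d))"

definition hausdorff_outer :: "nat \<Rightarrow> 'a::metric_space set \<Rightarrow> ennreal" where
  "hausdorff_outer d A = (SUP \<delta>\<in>{0<..}. hausdorff_pre d \<delta> A)"

definition hausdorff_measure :: "nat \<Rightarrow> 'a::metric_space measure" where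
  "hausdorff_measure d = measure_of UNIV (sets borel) (hausdorff_outer d)"

definition borel_Rn :: "nat \<Rightarrow> rvec measure" where
  "borel_Rn D = restrict_space borel (Rn D)"

definition support :: "'a::topological_space measure \<Rightarrow> 'a set" where
  "support P = {x \<in> space P. \<forall>U. open U \<longrightarrow> x \<in> U \<longrightarrow> emeasure P (U \<inter> space P) > 0}"

definition model ::
  "nat \<Rightarrow> nat \<Rightarrow> nat \<Rightarrow> real \<Rightarrow> real \<Rightarrow> (nat \<Rightarrow> real) \<Rightarrow> real \<Rightarrow> real \<Rightarrow> rvec measure set" where
  "model D d k \<tau>min Lp L fmin fmax =
     {P. prob_space P \<and> support P \<in> manifold_class D d k \<tau>min Lp L \<and>
         (\<exists>f \<in> borel_measurable borel.
            (\<forall>y \<in> support P. fmin \<le> f y \<and> f y \<le> fmax) \<and>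
            P = density (restrict_space (hausdorff_measure d) (Rn D))
                  (\<lambda>y. ennreal (f y) * indicator (support P) y))}"

definition model_at ::
  "nat \<Rightarrow> nat \<Rightarrow> nat \<Rightarrow> real \<Rightarrow> real \<Rightarrow> (nat \<Rightarrow> real) \<Rightarrow> real \<Rightarrow> real \<Rightarrow> rvec \<Rightarrow> rvec measure set" where
  "model_at D d k \<tau>min Lp L fmin fmax x = {P \<in> model D d k \<tau>min Lp L fmin fmax. x \<in> support P}"

abbreviation sample_space :: "nat \<Rightarrow> nat \<Rightarrow> (nat \<Rightarrow> rvec) measure" where
  "sample_space D n \<equiv> Pi\<^sub>M {..<n} (\<lambda>_. borel_Rn D)"

abbreviation sample_law :: "rvec measure \<Rightarrow> nat \<Rightarrow> (nat \<Rightarrow> rvec) measure" where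
  "sample_law P n \<equiv> Pi\<^sub>M {..<n} (\<lambda>_. P)"

text \<open>
  The Grassmannian is metrised by \<^const>\<open>angle\<close>, i.e. embedded in the finite-dimensional space of linear
  maps by \<open>T \<mapsto> \<pi>\<^sub>T\<close>; measurability for its Borel \<open>\<sigma>\<close>-algebra is measurability of \<open>\<pi>\<^sub>T u\<close>
  for every \<open>u\<close>. Likewise for bilinear maps.
\<close>

definition tangent_estimators :: "nat \<Rightarrow> nat \<Rightarrow> nat \<Rightarrow> ((nat \<Rightarrow> rvec) \<Rightarrow> rvec set) set" where
  "tangent_estimators D d n =
     {That. (\<forall>\<omega> \<in> space (sample_space D n). subspace (That \<omega>) \<and> That \<omega> \<subseteq> Rn D \<and> dim (That \<omega>) = d) \<and>
            (\<forall>u\<in>Rn D. (\<lambda>\<omega>. orth_proj (That \<omega>) u) \<in> sample_space D n \<rightarrow>\<^sub>M borel)}"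

definition bilinear_estimators :: "nat \<Rightarrow> nat \<Rightarrow> ((nat \<Rightarrow> rvec) \<Rightarrow> rvec \<Rightarrow> rvec \<Rightarrow> rvec) set" where
  "bilinear_estimators D n =
     {B. (\<forall>\<omega> \<in> space (sample_space D n). bilinear_map_on (Rn D) (B \<omega>)) \<and>
         (\<forall>u\<in>Rn D. \<forall>v\<in>Rn D. (\<lambda>\<omega>. B \<omega> u v) \<in> sample_space D n \<rightarrow>\<^sub>M borel)}"

definition tangent_loss :: "rvec \<Rightarrow> rvec set \<Rightarrow> rvec set \<Rightarrow> ennreal" where
  "tangent_loss x M T = ennreal (angle (tangent_space M x) T)"

definition curvature_loss :: "nat \<Rightarrow> rvec \<Rightarrow> rvec set \<Rightarrow> (rvec \<Rightarrow> rvec \<Rightarrow> rvec) \<Rightarrow> ennreal" where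
  "curvature_loss D x M B =
     mult_onorm (Rn D) 2
       (\<lambda>us. second_fundamental_form M x
                (orth_proj (tangent_space M x) (us ! 0)) (orth_proj (tangent_space M x) (us ! 1))
              - B (us ! 0) (us ! 1))"

definition large_parameters ::
  "nat \<Rightarrow> nat \<Rightarrow> real \<Rightarrow> real \<Rightarrow> (nat \<Rightarrow> real) \<Rightarrow> real \<Rightarrow> real \<Rightarrow> bool" where
  "large_parameters d k C Lp L fmin fmax \<longleftrightarrow>
     (\<forall>i\<in>{3..k}. L i / Lp ^ (i - 1) \<ge> C) \<and> Lp ^ d / fmin \<ge> C \<and> fmax / Lp ^ d \<ge> C"

end

theory Submission
  imports Defs
begin

text \<open>
  Both bounds come from a surface that touches itself at \<open>x\<close>. Pushing one of the two sheets at \<open>x\<close>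
  slightly away, inside a small neighbourhood, gives two embedded surfaces through \<open>x\<close>, one for each
  sheet. As the neighbourhood shrinks the two uniform distributions agree up to a vanishing mass, so
  no estimator can tell the sheets apart and Le Cam's two-point bound loses only a factor \<open>2\<close>; the
  bumps keep all derivatives up to order \<open>k\<close> bounded, but make the reach degenerate. For (1) the
  sheets have orthogonal tangent directions (a figure eight, separated in a spare dimension), for (2)
  they are tangent with opposite curvatures (a pinched biconcave disc). Dimension \<open>d\<close> is reached by
  rotating the profile curve around \<open>d - 1\<close> very distant axes in turn, which adds arbitrarily little
  to the second derivatives.

  The surfaces are images of a global periodic immersion \<open>\<Phi>\<close> of \<open>\<real>\<^sup>d\<close> with orthogonal partial
  derivatives of length at least \<open>1\<close>. Since the correction term of a local parametrization need not
  be normal, composing \<open>\<Phi>\<close> with the inverse of its differential at a point is one.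
\<close>


section \<open>Finitely supported vectors and orthogonal projections\<close>

text \<open>The thresholds may depend on \<open>d\<close> and \<open>k\<close> only, and this shapes
  the construction. Each profile is fixed once, with second derivatives below 1, and then shrunk by
  the factor \<open>1 / Lp\<close>; the ratios in \<open>large_parameters\<close> are invariant
  under this scaling, so one number serves all \<open>Lp\<close> and all \<open>D\<close>. The bumps
  have width \<open>1 / (n + 1)\<close>, so every derivative bound has to be uniform in
  \<open>n\<close>. This makes narrow bumps very low, which is harmless: the sheets only have to be
  disjoint. The samples are compared by conditioning. Given that all observations fall into the
  common part of the two supports, both sample laws coincide, and for a fixed sample size the
  probability of that event tends to 1 as the bumps narrow. The final constants are half of a
  separation. A unit vector tangent to one sheet and normal to the other has projections at distance
  1, which gives \<open>1 / 2\<close>; normal curvatures \<open>Lp / 4\<close> and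
  \<open>- Lp / 4\<close> along a common tangent are \<open>Lp / 2\<close> apart, which gives
  \<open>Lp / 4\<close>.\<close>

lemma rvec_eqI: "(\<And>i. coord x i = coord y i) \<Longrightarrow> x = y"
  by (simp add: coord_inject[symmetric] fun_eq_iff)

lift_definition uvec :: "nat \<Rightarrow> rvec" is "\<lambda>i j. if j = i then 1 else 0"
  by simp

lemma coord_uvec [simp]: "coord (uvec i) j = (if j = i then 1 else 0)"
  by transfer simp

lemma inner_uvec [simp]: "x \<bullet> uvec i = coord x i" "uvec i \<bullet> x = coord x i"
proof -
  have "uvec i \<bullet> x = (\<Sum>j\<in>{i}. coord (uvec i) j * coord x j)"
    by (rule inner_rvec_eq_sum) auto
  then show "uvec i \<bullet> x = coord x i" by simp
  then show "x \<bullet> uvec i = coord x i" by (simp add: inner_commute)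
qed

lemma norm_uvec [simp]: "norm (uvec i) = 1"
  by (simp add: norm_eq_sqrt_inner)

lemma bounded_linear_coord: "bounded_linear (\<lambda>x. coord x i)"
  using bounded_linear_inner_left[of "uvec i"] by simp

lemma abs_coord_le_norm: "\<bar>coord x i\<bar> \<le> norm x"
  using Cauchy_Schwarz_ineq2[of x "uvec i"] by simp

lemma coord_sum: "coord (sum f A) i = (\<Sum>a\<in>A. coord (f a) i)"
  by (induction A rule: infinite_finite_induct) auto

lemma continuous_on_coord [continuous_intros]:
  "continuous_on S f \<Longrightarrow> continuous_on S (\<lambda>x. coord (f x) i)"
  by (rule bounded_linear.continuous_on[OF bounded_linear_coord])

lemma subspace_Rn: "subspace (Rn n)"
  by (auto simp: subspace_def Rn_def)

lemma Rn_mono: "m \<le> n \<Longrightarrow> Rn m \<subseteq> Rn n"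
  by (auto simp: Rn_def)

lemma uvec_in_Rn [simp]: "uvec i \<in> Rn n \<longleftrightarrow> i < n"
  by (auto simp: Rn_def)

lemma closed_Rn: "closed (Rn n)"
proof -
  have "Rn n = (\<Inter>i\<in>{n..}. {x. coord x i = 0})" by (auto simp: Rn_def)
  also have "closed \<dots>"
    by (intro closed_INT ballI closed_Collect_eq continuous_intros continuous_on_id)
  finally show ?thesis .
qed

definition rvec_of :: "nat \<Rightarrow> (nat \<Rightarrow> real) \<Rightarrow> rvec" where
  "rvec_of n f = (\<Sum>i<n. f i *\<^sub>R uvec i)"

lemma coord_rvec_of [simp]: "coord (rvec_of n f) i = (if i < n then f i else 0)"
  by (simp add: rvec_of_def coord_sum if_distrib sum.delta' cong: if_cong)

lemma rvec_of_in_Rn [simp]: "rvec_of n f \<in> Rn n"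
  by (simp add: Rn_def)

lemma rvec_of_coord: "x \<in> Rn n \<Longrightarrow> rvec_of n (coord x) = x"
  by (rule rvec_eqI) (auto simp: Rn_def)

lemma inner_Rn: "x \<in> Rn n \<Longrightarrow> x \<bullet> y = (\<Sum>i<n. coord x i * coord y i)"
  by (rule inner_rvec_eq_sum) (auto simp: Rn_def not_le)

lemma norm_rvec_of_le: "norm (rvec_of n f) \<le> (\<Sum>i<n. \<bar>f i\<bar>)"
  unfolding rvec_of_def by (rule order_trans[OF norm_sum]) simp

lemma norm_le_sum_coord: "x \<in> Rn n \<Longrightarrow> norm x \<le> (\<Sum>i<n. \<bar>coord x i\<bar>)"
  using norm_rvec_of_le[of n "coord x"] by (simp add: rvec_of_coord)

lemma has_derivative_rvec_of:
  assumes "\<And>i. i < n \<Longrightarrow> ((\<lambda>w. f w i) has_derivative (\<lambda>u. f' u i)) F"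
  shows "((\<lambda>w. rvec_of n (f w)) has_derivative (\<lambda>u. rvec_of n (f' u))) F"
  unfolding rvec_of_def
  by (intro has_derivative_sum has_derivative_scaleR_left assms) simp

lemma continuous_on_rvec_of:
  assumes "\<And>i. i < n \<Longrightarrow> continuous_on S (\<lambda>w. f w i)"
  shows "continuous_on S (\<lambda>w. rvec_of n (f w))"
  unfolding rvec_of_def by (intro continuous_intros assms) simp

section \<open>Orthogonal projections onto finitely generated subspaces\<close>

lemma orth_proj_eqI:
  assumes "subspace T" "y \<in> T" "\<And>z. z \<in> T \<Longrightarrow> (u - y) \<bullet> z = 0"
  shows "orth_proj T u = y"
  unfolding orth_proj_def
proof (rule the_equality)
  fix y' assume y': "y' \<in> T \<and> (\<forall>z\<in>T. (u - y') \<bullet> z = 0)"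
  have "(u - y) \<bullet> (y' - y) = 0" "(u - y') \<bullet> (y' - y) = 0"
    using y' assms by (auto simp: subspace_diff)
  then have "(y' - y) \<bullet> (y' - y) = 0" by (simp add: inner_diff_left)
  then show "y' = y" by simp
qed (use assms in auto)

lemma orth_proj_id: "subspace T \<Longrightarrow> u \<in> T \<Longrightarrow> orth_proj T u = u"
  by (rule orth_proj_eqI) auto

lemma orth_proj_Rn: "orth_proj (Rn n) u = rvec_of n (coord u)"
proof (rule orth_proj_eqI[OF subspace_Rn])
  fix z assume "z \<in> Rn n"
  then show "(u - rvec_of n (coord u)) \<bullet> z = 0"
    by (subst inner_commute) (auto simp: inner_Rn)
qed simp

text \<open>One Gram-Schmidt step per generator; \<open>rvec\<close> is not complete, so projections
  are built only onto finite spans. The vector \<open>n\<close> is the part of the new generator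
  orthogonal to the old span, and the projection gains the component of \<open>u\<close> along
  \<open>n\<close>.\<close>

lemma orth_proj_span_exists:
  fixes S :: "'a::real_inner set"
  assumes "finite S"
  shows "\<exists>y\<in>span S. \<forall>z\<in>span S. (u - y) \<bullet> z = 0"
  using assms
proof (induction S arbitrary: u)
  case (insert a S)
  obtain a' where a': "a' \<in> span S" "\<And>z. z \<in> span S \<Longrightarrow> (a - a') \<bullet> z = 0"
    using insert.IH[of a] by blast
  obtain y where y: "y \<in> span S" "\<And>z. z \<in> span S \<Longrightarrow> (u - y) \<bullet> z = 0"
    using insert.IH[of u] by blast
  define n where "n = a - a'"
  \<comment> \<open>If \<open>a\<close> already lies in the old span then \<open>n = 0\<close>, and
    division by zero leaves \<open>y\<close> unchanged.\<close>
  define c where "c = (u \<bullet> n) / (n \<bullet> n)"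
  have n: "n \<bullet> z = 0" if "z \<in> span S" for z using a'(2) that by (simp add: n_def)
  have sub: "span S \<subseteq> span (insert a S)" by (rule span_mono) auto
  have "n \<in> span (insert a S)"
    unfolding n_def using a'(1) sub by (intro span_diff) (auto intro: span_base)
  with y(1) sub have "y + c *\<^sub>R n \<in> span (insert a S)"
    by (intro span_add span_scale) auto
  moreover have "(u - (y + c *\<^sub>R n)) \<bullet> z = 0" if z: "z \<in> span (insert a S)" for z
  proof -
    obtain k where k: "z - k *\<^sub>R a \<in> span S" using z unfolding span_insert by blast
    then have s: "z - k *\<^sub>R n \<in> span S"
      using span_add[OF k span_scale[OF a'(1), of k]] by (simp add: n_def algebra_simps)
    have "(u - (y + c *\<^sub>R n)) \<bullet> (z - k *\<^sub>R n) = 0"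
      using y(2)[OF s] n[OF s] by (simp add: inner_diff_left inner_add_left)
    moreover have "(u - (y + c *\<^sub>R n)) \<bullet> n = 0"
      using n[OF y(1)] by (cases "n = 0") (simp_all add: c_def inner_diff_left inner_add_left inner_commute[of y])
    ultimately show ?thesis by (simp add: inner_diff_right)
  qed
  ultimately show ?case by blast
qed auto

lemma
  fixes S :: "'a::real_inner set"
  assumes "finite S"
  shows orth_proj_in_span: "orth_proj (span S) u \<in> span S"
    and orth_proj_orth: "z \<in> span S \<Longrightarrow> (u - orth_proj (span S) u) \<bullet> z = 0"
  using orth_proj_span_exists[OF assms, of u] orth_proj_eqI[OF subspace_span] by metis+

lemma norm_orth_proj_le:
  fixes S :: "'a::real_inner set"
  assumes "finite S"
  shows "norm (orth_proj (span S) u) \<le> norm u"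
proof -
  let ?y = "orth_proj (span S) u"
  have "(u - ?y) \<bullet> ?y = 0" by (intro orth_proj_orth orth_proj_in_span assms)
  then have "norm ?y * norm ?y = u \<bullet> ?y"
    by (simp add: inner_diff_left flip: power2_eq_square power2_norm_eq_inner)
  also have "\<dots> \<le> norm u * norm ?y" by (rule norm_cauchy_schwarz)
  finally show ?thesis by (cases "?y = 0") (auto simp: mult_le_cancel_right)
qed

lemma bounded_linear_orth_proj:
  fixes S :: "'a::real_inner set"
  assumes "finite S"
  shows "bounded_linear (orth_proj (span S))"
proof (rule bounded_linear_intro)
  let ?p = "orth_proj (span S)"
  have *: "?p u \<in> span S" "\<forall>z\<in>span S. (u - ?p u) \<bullet> z = 0" for u
    using orth_proj_in_span[OF assms] orth_proj_orth[OF assms] by auto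
  show "?p (u + v) = ?p u + ?p v" for u v
    using *(1)[of u] *(1)[of v] *(2)[of u] *(2)[of v]
    by (intro orth_proj_eqI subspace_span) (auto intro: span_add simp: inner_diff_left inner_add_left)
  show "?p (c *\<^sub>R u) = c *\<^sub>R ?p u" for c u
    using *(1)[of u] *(2)[of u]
    by (intro orth_proj_eqI subspace_span) (auto intro: span_scale simp: inner_diff_left)
  show "norm (?p u) \<le> norm u * 1" for u using norm_orth_proj_le[OF assms] by simp
qed

text \<open>The dimension is the cardinality of a basis, and infinite sets have cardinality 0, so a
  positive dimension certifies a finite basis. This turns the values of tangent estimators into
  finite spans.\<close>

lemma subspace_dim_pos_span:
  fixes T :: "'a::real_vector set"
  assumes "subspace T" "0 < dim T"
  obtains S where "finite S" "T = span S"
proof -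
  obtain B where B: "B \<subseteq> T" "independent B" "T \<subseteq> span B" "card B = dim T"
    using basis_exists[of T] by metis
  then have "finite B" using assms(2) by (intro card_ge_0_finite) simp
  moreover have "T = span B" using B span_minimal[OF B(1) assms(1)] by auto
  ultimately show thesis by (rule that)
qed

text \<open>Finite generators make both projections bounded linear, as \<open>onorm\<close>
  requires. The lemma reduces the estimation of a subspace to the estimation of the projection of
  one fixed unit vector.\<close>

lemma norm_diff_le_angle:
  fixes U V :: "'a::real_inner set"
  assumes "finite S" "U = span S" "finite S'" "V = span S'" "norm u = 1"
  shows "norm (orth_proj U u - orth_proj V u) \<le> angle U V"
proof -
  have "bounded_linear (\<lambda>u. orth_proj U u - orth_proj V u)"
    unfolding assms by (intro bounded_linear_sub bounded_linear_orth_proj assms)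
  from onorm[OF this, of u] show ?thesis by (simp add: angle_def assms(5))
qed

section \<open>Coordinate boxes and connectedness of \<open>Rn d\<close>\<close>

definition cbox_Rn :: "nat \<Rightarrow> (nat \<Rightarrow> real) \<Rightarrow> (nat \<Rightarrow> real) \<Rightarrow> rvec set" where
  "cbox_Rn d l h = {w \<in> Rn d. \<forall>j<d. l j \<le> coord w j \<and> coord w j \<le> l j + h j}"

text \<open>In the infinite-dimensional type \<open>rvec\<close>, closed and bounded sets need not
  be compact. The box is therefore obtained as a continuous image of a product, one coordinate at a
  time.\<close>

lemma compact_cbox_Rn: "compact (cbox_Rn d l h)"
proof (induction d)
  case 0
  have "cbox_Rn 0 l h = {0}" by (auto simp: cbox_Rn_def Rn_def intro: rvec_eqI)
  then show ?case by simp
next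
  case (Suc d)
  let ?f = "\<lambda>(w, t). w + t *\<^sub>R uvec d"
  have "cbox_Rn (Suc d) l h = ?f ` (cbox_Rn d l h \<times> {l d..l d + h d})"
  proof (intro equalityI subsetI)
    fix w assume w: "w \<in> cbox_Rn (Suc d) l h"
    have "w = ?f (rvec_of d (coord w), coord w d)"
      using w by (intro rvec_eqI) (auto simp: cbox_Rn_def Rn_def)
    moreover have "(rvec_of d (coord w), coord w d) \<in> cbox_Rn d l h \<times> {l d..l d + h d}"
      using w by (auto simp: cbox_Rn_def)
    ultimately show "w \<in> ?f ` (cbox_Rn d l h \<times> {l d..l d + h d})" by (rule image_eqI)
  qed (auto simp: cbox_Rn_def Rn_def less_Suc_eq)
  moreover have "compact \<dots>"
    by (intro compact_continuous_image compact_Times Suc) (auto simp: split_beta intro!: continuous_intros)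
  ultimately show ?case by simp
qed

lemma connected_Rn: "connected (Rn d)"
  by (intro convex_connected subspace_imp_convex subspace_Rn)


section \<open>Hausdorff measure\<close>

abbreviation hausdorff_term :: "nat \<Rightarrow> 'a::metric_space set \<Rightarrow> ennreal" where
  "hausdorff_term d C \<equiv> if C = {} then 0 else ennreal (unit_ball_vol (real d) * (diameter C / 2) ^ d)"

abbreviation covers :: "real \<Rightarrow> 'a::metric_space set \<Rightarrow> (nat \<Rightarrow> 'a set) set" where
  "covers \<delta> A \<equiv> {C. A \<subseteq> (\<Union>i. C i) \<and> (\<forall>i. bounded (C i) \<and> diameter (C i) \<le> \<delta>)}"

lemma hausdorff_pre_leI:
  assumes "A \<subseteq> (\<Union>i. C i)" "\<And>i. bounded (C i)" "\<And>i. diameter (C i) \<le> \<delta>"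
  shows "hausdorff_pre d \<delta> A \<le> (\<Sum>i. hausdorff_term d (C i))"
  unfolding hausdorff_pre_def by (rule INF_lower) (use assms in auto)

lemma hausdorff_pre_mono: "A \<subseteq> B \<Longrightarrow> hausdorff_pre d \<delta> A \<le> hausdorff_pre d \<delta> B"
  unfolding hausdorff_pre_def by (rule INF_superset_mono) auto

lemma hausdorff_pre_antimono: "\<delta> \<le> \<delta>' \<Longrightarrow> hausdorff_pre d \<delta>' A \<le> hausdorff_pre d \<delta> A"
  unfolding hausdorff_pre_def by (rule INF_superset_mono) (auto intro: order_trans)

lemma hausdorff_pre_empty [simp]: "0 \<le> \<delta> \<Longrightarrow> hausdorff_pre d \<delta> {} = 0"
  using hausdorff_pre_leI[of "{}" "\<lambda>_. {}" \<delta> d] by (simp add: diameter_empty)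

lemma hausdorff_pre_le_outer: "0 < \<delta> \<Longrightarrow> hausdorff_pre d \<delta> A \<le> hausdorff_outer d A"
  unfolding hausdorff_outer_def by (rule SUP_upper) simp

lemma hausdorff_outer_mono: "A \<subseteq> B \<Longrightarrow> hausdorff_outer d A \<le> hausdorff_outer d B"
  unfolding hausdorff_outer_def by (rule SUP_mono) (auto intro: hausdorff_pre_mono)

lemma hausdorff_outer_empty [simp]: "hausdorff_outer d {} = 0"
  by (simp add: hausdorff_outer_def)

text \<open>Covers that are optimal up to \<open>e / 2 ^ (i + 1)\<close> are merged into a single
  sequence by a pairing of the naturals.\<close>

lemma hausdorff_pre_UN_le:
  "hausdorff_pre d \<delta> (\<Union>i. A i) \<le> (\<Sum>i::nat. hausdorff_pre d \<delta> (A i))"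
proof (cases "(\<Sum>i. hausdorff_pre d \<delta> (A i)) < \<infinity>")
  case True
  then have fin: "hausdorff_pre d \<delta> (A i) < \<infinity>" for i
    using ennreal_suminf_lessD[of "\<lambda>i. hausdorff_pre d \<delta> (A i)" \<infinity> i] by simp
  show ?thesis
  proof (rule ennreal_le_epsilon)
    fix e :: real assume e: "0 < e"
    define eps where "eps i = e * (1/2) ^ Suc i" for i :: nat
    have epos: "0 < eps i" for i using e by (simp add: eps_def)
    have "\<exists>C\<in>covers \<delta> (A i). (\<Sum>j. hausdorff_term d (C j)) < hausdorff_pre d \<delta> (A i) + ennreal (eps i)" for i
    proof -
      have "hausdorff_pre d \<delta> (A i) < hausdorff_pre d \<delta> (A i) + ennreal (eps i)"
        using fin[of i] epos[of i] ennreal_add_left_cancel_less[of "hausdorff_pre d \<delta> (A i)" 0 "ennreal (eps i)"] by simp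
      then show ?thesis
        unfolding hausdorff_pre_def INF_less_iff by simp
    qed
    then have "\<forall>i. \<exists>C. C \<in> covers \<delta> (A i) \<and>
        (\<Sum>j. hausdorff_term d (C j)) < hausdorff_pre d \<delta> (A i) + ennreal (eps i)"
      by (simp only: Bex_def) simp
    from choice[OF this] obtain C where C: "\<And>i. C i \<in> covers \<delta> (A i)"
      "\<And>i. (\<Sum>j. hausdorff_term d (C i j)) < hausdorff_pre d \<delta> (A i) + ennreal (eps i)"
      by (auto simp only:)
    define E where "E n = (case prod_decode n of (i, j) \<Rightarrow> C i j)" for n
    have "hausdorff_pre d \<delta> (\<Union>i. A i) \<le> (\<Sum>n. hausdorff_term d (E n))"
    proof (rule hausdorff_pre_leI)
      show "(\<Union>i. A i) \<subseteq> (\<Union>n. E n)"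
      proof
        fix x assume "x \<in> (\<Union>i. A i)"
        then obtain i where "x \<in> A i" by blast
        with C(1)[of i] obtain j where "x \<in> C i j" by blast
        then have "x \<in> E (prod_encode (i, j))" by (simp add: E_def)
        then show "x \<in> (\<Union>n. E n)" by blast
      qed
      show "bounded (E n)" "diameter (E n) \<le> \<delta>" for n
        using C(1) by (auto simp: E_def split: prod.split)
    qed
    also have "\<dots> = (\<Sum>i. \<Sum>j. hausdorff_term d (C i j))"
    proof -
      have "(\<Sum>n. (\<lambda>(i, j). hausdorff_term d (C i j)) (prod_decode n)) = (\<Sum>i. \<Sum>j. hausdorff_term d (C i j))"
        by (rule suminf_ennreal_2dimen) simp
      then show ?thesis by (simp add: E_def split_beta cong: if_cong)
    qed
    also have "\<dots> \<le> (\<Sum>i. hausdorff_pre d \<delta> (A i) + ennreal (eps i))"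
      by (intro suminf_le) (auto intro: less_imp_le[OF C(2)])
    also have "\<dots> = (\<Sum>i. hausdorff_pre d \<delta> (A i)) + (\<Sum>i. ennreal (eps i))"
      by (rule suminf_add[symmetric]) auto
    also have "(\<Sum>i. ennreal (eps i)) = ennreal e"
    proof -
      have "eps sums (e * 1)"
        unfolding eps_def using power_half_series by (intro sums_mult)
      then show ?thesis using epos by (intro suminf_ennreal_eq) (auto intro: less_imp_le)
    qed
    finally show "hausdorff_pre d \<delta> (\<Union>i. A i) \<le> (\<Sum>i. hausdorff_pre d \<delta> (A i)) + ennreal e" .
  qed
qed (simp add: not_less top_unique)

lemma hausdorff_outer_UN_le: "hausdorff_outer d (\<Union>i. A i) \<le> (\<Sum>i::nat. hausdorff_outer d (A i))"
  unfolding hausdorff_outer_def[of d "\<Union>i. A i"]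
proof (rule SUP_least)
  fix \<delta> :: real assume "\<delta> \<in> {0<..}"
  then have "(\<Sum>i. hausdorff_pre d \<delta> (A i)) \<le> (\<Sum>i. hausdorff_outer d (A i))"
    by (intro suminf_le hausdorff_pre_le_outer) auto
  with hausdorff_pre_UN_le show "hausdorff_pre d \<delta> (\<Union>i. A i) \<le> (\<Sum>i. hausdorff_outer d (A i))"
    by (rule order_trans)
qed

lemma hausdorff_outer_Un_le: "hausdorff_outer d (A \<union> B) \<le> hausdorff_outer d A + hausdorff_outer d B"
proof -
  define C where "C i = (if i = 0 then A else if i = 1 then B else {})" for i :: nat
  have "hausdorff_outer d (A \<union> B) \<le> hausdorff_outer d (\<Union>i. C i)"
    by (rule hausdorff_outer_mono) (auto simp: C_def split: if_splits)
  also have "\<dots> \<le> (\<Sum>i. hausdorff_outer d (C i))"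
    by (rule hausdorff_outer_UN_le)
  also have "\<dots> = (\<Sum>i\<in>{0, 1}. hausdorff_outer d (C i))"
    by (rule suminf_finite) (auto simp: C_def)
  finally show ?thesis by (simp add: C_def)
qed

section \<open>Borel sets are Caratheodory measurable\<close>

lemma outer_measure_space_hausdorff: "outer_measure_space (Pow UNIV) (hausdorff_outer d)"
  unfolding outer_measure_space_def positive_def increasing_def countably_subadditive_def
  by (auto intro: hausdorff_outer_mono hausdorff_outer_UN_le)

text \<open>A covering set of diameter below \<open>\<eta>\<close> cannot meet both sides, so every
  cover splits into a cover of \<open>A\<close> and a cover of \<open>B\<close> that share no
  nonempty member.\<close>

lemma hausdorff_pre_separated:
  assumes sep: "\<And>a b. a \<in> A \<Longrightarrow> b \<in> B \<Longrightarrow> \<eta> \<le> dist a b" and "\<delta> < \<eta>" "0 \<le> \<delta>"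
  shows "hausdorff_pre d \<delta> A + hausdorff_pre d \<delta> B \<le> hausdorff_pre d \<delta> (A \<union> B)"
  unfolding hausdorff_pre_def[of d \<delta> "A \<union> B"]
proof (rule INF_greatest)
  fix C assume C: "C \<in> covers \<delta> (A \<union> B)"
  define CA where "CA i = (if C i \<inter> A = {} then {} else C i)" for i
  define CB where "CB i = (if C i \<inter> B = {} then {} else C i)" for i
  have le: "hausdorff_term d (CA i) + hausdorff_term d (CB i) \<le> hausdorff_term d (C i)" for i
  proof -
    have "C i \<inter> A = {} \<or> C i \<inter> B = {}"
    proof (rule ccontr)
      assume "\<not> ?thesis"
      then obtain a b where "a \<in> C i" "a \<in> A" "b \<in> C i" "b \<in> B" by blast
      moreover have "bounded (C i)" "diameter (C i) \<le> \<delta>" using C by auto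
      ultimately have "dist a b \<le> \<delta>"
        using diameter_bounded_bound[of "C i" a b] by linarith
      with sep[OF \<open>a \<in> A\<close> \<open>b \<in> B\<close>] \<open>\<delta> < \<eta>\<close> show False by simp
    qed
    then show ?thesis by (auto simp: CA_def CB_def)
  qed
  have "hausdorff_pre d \<delta> A \<le> (\<Sum>i. hausdorff_term d (CA i))"
    using C \<open>0 \<le> \<delta>\<close> by (intro hausdorff_pre_leI) (auto simp: CA_def subset_iff, blast)
  moreover have "hausdorff_pre d \<delta> B \<le> (\<Sum>i. hausdorff_term d (CB i))"
    using C \<open>0 \<le> \<delta>\<close> by (intro hausdorff_pre_leI) (auto simp: CB_def subset_iff, blast)
  ultimately have "hausdorff_pre d \<delta> A + hausdorff_pre d \<delta> B \<le>
      (\<Sum>i. hausdorff_term d (CA i)) + (\<Sum>i. hausdorff_term d (CB i))"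
    by (rule add_mono)
  also have "\<dots> = (\<Sum>i. hausdorff_term d (CA i) + hausdorff_term d (CB i))"
    by (rule suminf_add) auto
  also have "\<dots> \<le> (\<Sum>i. hausdorff_term d (C i))"
    by (intro suminf_le le) auto
  finally show "hausdorff_pre d \<delta> A + hausdorff_pre d \<delta> B \<le> (\<Sum>i. hausdorff_term d (C i))" .
qed

text \<open>This is the metric outer measure property on which Caratheodory's criterion rests. The
  two suprema over scales are taken separately, each pair of scales being dominated by a common one
  below \<open>\<eta>\<close>.\<close>

lemma hausdorff_outer_separated:
  assumes sep: "\<And>a b. a \<in> A \<Longrightarrow> b \<in> B \<Longrightarrow> \<eta> \<le> dist a b" and "0 < \<eta>"
  shows "hausdorff_outer d A + hausdorff_outer d B \<le> hausdorff_outer d (A \<union> B)"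
proof -
  have *: "hausdorff_pre d \<delta> A + hausdorff_pre d \<delta>' B \<le> hausdorff_outer d (A \<union> B)"
    if "0 < \<delta>" "0 < \<delta>'" for \<delta> \<delta>'
  proof -
    define \<delta>0 where "\<delta>0 = min (min \<delta> \<delta>') (\<eta> / 2)"
    have \<delta>0: "0 < \<delta>0" "\<delta>0 \<le> \<delta>" "\<delta>0 \<le> \<delta>'" "\<delta>0 < \<eta>"
      using that \<open>0 < \<eta>\<close> by (auto simp: \<delta>0_def)
    have "hausdorff_pre d \<delta> A + hausdorff_pre d \<delta>' B \<le> hausdorff_pre d \<delta>0 A + hausdorff_pre d \<delta>0 B"
      using \<delta>0 by (intro add_mono hausdorff_pre_antimono)
    also have "\<dots> \<le> hausdorff_pre d \<delta>0 (A \<union> B)"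
      using sep \<delta>0 by (intro hausdorff_pre_separated) auto
    also have "\<dots> \<le> hausdorff_outer d (A \<union> B)"
      by (rule hausdorff_pre_le_outer) (rule \<delta>0)
    finally show ?thesis .
  qed
  have "hausdorff_pre d \<delta> A + hausdorff_outer d B \<le> hausdorff_outer d (A \<union> B)" if "0 < \<delta>" for \<delta>
    unfolding hausdorff_outer_def[of d B]
    using that * by (subst ennreal_SUP_add_right) (auto intro!: SUP_least)
  then show ?thesis
    unfolding hausdorff_outer_def[of d A]
    by (subst ennreal_SUP_add_left[symmetric]) (auto intro!: SUP_least)
qed

text \<open>Caratheodory's criterion: the points of \<open>A - F\<close> are exhausted by the sets at positive
  distance from \<open>F\<close>; the annuli between consecutive ones have summable measure because every
  other annulus is separated.\<close>

lemma closed_in_lambda_system: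
  fixes F :: "'a::metric_space set"
  assumes "closed F"
  shows "F \<in> lambda_system UNIV (Pow UNIV) (hausdorff_outer d)"
proof -
  interpret algebra UNIV "Pow (UNIV :: 'a set)" by (rule algebra_Pow)
  let ?H = "hausdorff_outer d :: 'a set \<Rightarrow> ennreal"
  have ge: "?H (A \<inter> F) + ?H (A - F) \<le> ?H A" for A
  proof (cases "F = {} \<or> ?H A = \<infinity>")
    case False
    then have "F \<noteq> {}" and fin: "?H A < \<infinity>" by (auto simp: less_top)
    define g where "g x = infdist x F" for x
    have g0: "x \<in> F \<Longrightarrow> g x = 0" for x by (simp add: g_def)
    have gpos: "x \<notin> F \<Longrightarrow> 0 < g x" for x
      using in_closed_iff_infdist_zero[OF assms \<open>F \<noteq> {}\<close>, of x] infdist_nonneg[of x F]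
      by (simp add: g_def less_le)
    have glip: "g x \<le> g y + dist x y" for x y
      unfolding g_def by (rule infdist_triangle)
    define r where "r n = 1 / (real n + 1)" for n :: nat
    have r_mono: "r m \<le> r n" if "n \<le> m" for m n
      unfolding r_def using that by (intro divide_left_mono mult_pos_pos) auto
    define An where "An n = {x \<in> A. r n \<le> g x}" for n
    define Bn where "Bn n = {x \<in> A. r (Suc n) \<le> g x \<and> g x < r n}" for n
    have sepA: "?H (A \<inter> F) + ?H (An n) \<le> ?H A" for n
    proof -
      have "?H (A \<inter> F) + ?H (An n) \<le> ?H (A \<inter> F \<union> An n)"
      proof (rule hausdorff_outer_separated)
        show "0 < r n" by (simp add: r_def)
        fix a b assume "a \<in> A \<inter> F" "b \<in> An n"
        then show "r n \<le> dist a b"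
          using glip[of b a] g0[of a] by (auto simp: An_def dist_commute)
      qed
      also have "\<dots> \<le> ?H A" by (rule hausdorff_outer_mono) (auto simp: An_def)
      finally show ?thesis .
    qed
    \<comment> \<open>Used with \<open>c = 0\<close> and \<open>c = 1\<close>: annuli whose indices
      have equal parity are kept apart by the annulus between them.\<close>
    have sepB: "(\<Sum>i<n. ?H (Bn (2 * i + c))) \<le> ?H (\<Union>i<n. Bn (2 * i + c))" for n c
    proof (induction n)
      case (Suc n)
      have "(\<Sum>i<Suc n. ?H (Bn (2 * i + c))) \<le> ?H (\<Union>i<n. Bn (2 * i + c)) + ?H (Bn (2 * n + c))"
        using Suc by (auto intro: add_mono)
      also have "\<dots> \<le> ?H ((\<Union>i<n. Bn (2 * i + c)) \<union> Bn (2 * n + c))"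
      proof (cases "n = 0")
        case False
        show ?thesis
        proof (rule hausdorff_outer_separated)
          show "0 < r (2 * n + c - 1) - r (2 * n + c)"
            using False by (simp add: r_def of_nat_diff) (intro divide_strict_left_mono mult_pos_pos; simp)
          fix a b assume "a \<in> (\<Union>i<n. Bn (2 * i + c))" "b \<in> Bn (2 * n + c)"
          then obtain i where i: "i < n" "r (Suc (2 * i + c)) \<le> g a" and b: "g b < r (2 * n + c)"
            by (auto simp: Bn_def)
          have "r (2 * n + c - 1) \<le> r (Suc (2 * i + c))"
            using i by (intro r_mono) auto
          then show "r (2 * n + c - 1) - r (2 * n + c) \<le> dist a b"
            using i b glip[of a b] by simp
        qed
      qed simp
      finally show ?case by (simp add: lessThan_Suc Un_commute)
    qed simp
    have sepB': "(\<Sum>i<n. ?H (Bn (2 * i + c))) \<le> ?H A" for n c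
      by (rule order_trans[OF sepB hausdorff_outer_mono]) (auto simp: Bn_def)
    define S where "S = (\<Sum>i. ?H (Bn i))"
    have "S \<le> ?H A + ?H A"
      unfolding S_def
    proof (rule suminf_le_const[OF summableI])
      fix n
      have "(\<Sum>i<n. ?H (Bn i)) \<le> (\<Sum>i<2 * n. ?H (Bn i))"
        by (rule sum_mono2) auto
      also have "\<dots> = (\<Sum>i<n. ?H (Bn (2 * i + 0))) + (\<Sum>i<n. ?H (Bn (2 * i + 1)))"
        by (induction n) (auto simp: algebra_simps)
      also have "\<dots> \<le> ?H A + ?H A"
        by (intro add_mono sepB')
      finally show "(\<Sum>i<n. ?H (Bn i)) \<le> ?H A + ?H A" .
    qed
    with fin have Sfin: "S < \<infinity>"
      by (metis ennreal_add_less_top infinity_ennreal_def le_less_trans)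
    have cov: "?H (A - F) \<le> ?H (An n) + (\<Sum>i. ?H (Bn (i + n)))" for n
    proof -
      have "A - F \<subseteq> An n \<union> (\<Union>i. Bn (i + n))"
      proof
        fix x assume x: "x \<in> A - F"
        show "x \<in> An n \<union> (\<Union>i. Bn (i + n))"
        proof (cases "r n \<le> g x")
          case False
          have "r \<longlonglongrightarrow> 0" unfolding r_def using LIMSEQ_inverse_real_of_nat by (simp add: inverse_eq_divide add.commute)
          then have "\<exists>m. r m < g x"
            using x gpos[of x] order_tendstoD(2)[of r 0 sequentially "g x"] eventually_sequentially by auto
          define m where "m = (LEAST m. r m \<le> g x)"
          have m: "r m \<le> g x" unfolding m_def using \<open>\<exists>m. r m < g x\<close> by (metis LeastI_ex less_imp_le)
          have "n < m" using False m r_mono[of m n] by force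
          then have "\<not> r (m - 1) \<le> g x"
            using not_less_Least[of "m - 1" "\<lambda>m. r m \<le> g x"] by (simp add: m_def[symmetric])
          then have "x \<in> Bn (m - 1 - n + n)"
            using m x \<open>n < m\<close> by (simp add: Bn_def)
          then show ?thesis by blast
        qed (use x in \<open>auto simp: An_def\<close>)
      qed
      then have "?H (A - F) \<le> ?H (An n \<union> (\<Union>i. Bn (i + n)))" by (rule hausdorff_outer_mono)
      also have "\<dots> \<le> ?H (An n) + ?H (\<Union>i. Bn (i + n))" by (rule hausdorff_outer_Un_le)
      also have "?H (\<Union>i. Bn (i + n)) \<le> (\<Sum>i. ?H (Bn (i + n)))" by (rule hausdorff_outer_UN_le)
      finally show ?thesis by (simp add: add_left_mono)
    qed
    \<comment> \<open>A partial sum is added on the left to complete the tail to \<open>S\<close>;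
      this avoids subtraction in \<open>ennreal\<close>, and the finite \<open>S\<close> is
      cancelled at the end.\<close>
    have step: "?H (A \<inter> F) + ?H (A - F) + (\<Sum>i<n. ?H (Bn i)) \<le> ?H A + S" for n
    proof -
      have "?H (A \<inter> F) + ?H (A - F) + (\<Sum>i<n. ?H (Bn i)) \<le>
          ?H (A \<inter> F) + (?H (An n) + (\<Sum>i. ?H (Bn (i + n)))) + (\<Sum>i<n. ?H (Bn i))"
        by (intro add_mono cov order_refl)
      also have "\<dots> = (?H (A \<inter> F) + ?H (An n)) + ((\<Sum>i. ?H (Bn (i + n))) + (\<Sum>i<n. ?H (Bn i)))"
        by (simp add: algebra_simps)
      also have "(\<Sum>i. ?H (Bn (i + n))) + (\<Sum>i<n. ?H (Bn i)) = S"
        unfolding S_def by (rule suminf_offset[symmetric]) (rule summableI)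
      finally show ?thesis using sepA[of n] by (meson add_right_mono order_trans)
    qed
    have "(SUP n. ?H (A \<inter> F) + ?H (A - F) + (\<Sum>i<n. ?H (Bn i))) \<le> ?H A + S"
      by (rule SUP_least) (rule step)
    then have "?H (A \<inter> F) + ?H (A - F) + S \<le> ?H A + S"
      unfolding S_def suminf_eq_SUP by (subst (asm) ennreal_SUP_add_right[symmetric]) auto
    with Sfin show ?thesis
      using ennreal_add_left_cancel_le[of S "?H (A \<inter> F) + ?H (A - F)" "?H A"] by (auto simp: add.commute)
  qed auto
  have "?H (A \<inter> F) + ?H (A - F) = ?H A" for A
    using ge[of A] hausdorff_outer_Un_le[of d "A \<inter> F" "A - F"]
    by (simp add: Int_Diff_Un antisym)
  then show ?thesis by (auto simp: lambda_system_def Int_commute Diff_eq)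
qed

text \<open>\<open>measure_of\<close> yields zero values unless the given function is a measure on
  the sigma-algebra. Caratheodory's theorem gives additivity on the lambda system, which contains
  the closed sets and hence all Borel sets.\<close>

lemma emeasure_hausdorff_measure:
  assumes "A \<in> sets borel"
  shows "emeasure (hausdorff_measure d) A = hausdorff_outer d (A :: 'a::metric_space set)"
proof -
  interpret sigma_algebra UNIV "Pow (UNIV :: 'a set)" by (rule sigma_algebra_Pow)
  let ?L = "lambda_system UNIV (Pow UNIV) (hausdorff_outer d :: 'a set \<Rightarrow> ennreal)"
  have ms: "measure_space UNIV ?L (hausdorff_outer d)"
    by (rule caratheodory_lemma) (rule outer_measure_space_hausdorff)
  then interpret L: sigma_algebra UNIV ?L by (simp add: measure_space_def)
  have "sigma_sets UNIV (Collect closed) \<subseteq> ?L"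
    by (rule L.sigma_sets_subset, rule subsetI, simp only: mem_Collect_eq, erule closed_in_lambda_system)
  then have sub: "sets (borel :: 'a measure) \<subseteq> ?L"
    by (simp add: borel_eq_closed)
  show ?thesis
    unfolding hausdorff_measure_def
  proof (rule emeasure_measure_of_sigma)
    show "sigma_algebra UNIV (sets (borel :: 'a measure))"
      using sets.sigma_algebra_axioms[of "borel :: 'a measure"] by simp
    show "positive (sets borel) (hausdorff_outer d :: 'a set \<Rightarrow> ennreal)" by (simp add: positive_def)
    show "countably_additive (sets borel) (hausdorff_outer d :: 'a set \<Rightarrow> ennreal)"
      using ms sub unfolding measure_space_def countably_additive_def by blast
  qed (rule assms)
qed

lemma sets_hausdorff_measure [measurable_cong, simp]: "sets (hausdorff_measure d) = sets borel"
  and space_hausdorff_measure [simp]: "space (hausdorff_measure d) = UNIV"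
  using sets.sigma_sets_eq[of borel] by (simp_all add: hausdorff_measure_def)


section \<open>Compact manifolds parametrised by a periodic immersion\<close>

lemma has_vector_derivative_at_0_iff:
  fixes f :: "real \<Rightarrow> 'a::real_normed_vector"
  shows "(f has_vector_derivative f') (at 0) \<longleftrightarrow> ((\<lambda>t. (f t - f 0) /\<^sub>R t) \<longlongrightarrow> f') (at 0)"
proof -
  have "norm (f (0 + h) - f 0 - h *\<^sub>R f') / norm h = norm ((f h - f 0) /\<^sub>R h - f')" if "h \<noteq> 0" for h
  proof -
    have "(f h - f 0) /\<^sub>R h - f' = (f (0 + h) - f 0 - h *\<^sub>R f') /\<^sub>R h"
      using that by (simp add: algebra_simps)
    then show ?thesis by (simp add: divide_inverse mult.commute)
  qed
  then have "((\<lambda>h. norm (f (0 + h) - f 0 - h *\<^sub>R f') / norm h) \<longlongrightarrow> 0) (at 0) \<longleftrightarrow>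
      ((\<lambda>h. norm ((f h - f 0) /\<^sub>R h - f')) \<longlongrightarrow> 0) (at 0)"
    by (intro tendsto_cong) (auto simp: eventually_at_filter)
  then show ?thesis
    by (simp add: has_vector_derivative_def has_derivative_at bounded_linear_scaleR_left
        tendsto_norm_zero_iff LIM_zero_iff)
qed

text \<open>\<open>F us\<close> is the iterated differential in the directions \<open>us\<close>,
  the head being the direction differentiated last. The maps live on all of \<open>rvec\<close>, so
  \<open>F_trunc\<close> records that only the first \<open>d\<close> coordinates of a direction
  count; \<open>F_eq_iff\<close> is injectivity modulo the period lattice.\<close>

locale torus_immersion =
  fixes d D k :: nat and Lp :: real and L :: "nat \<Rightarrow> real"
    and F :: "rvec list \<Rightarrow> rvec \<Rightarrow> rvec" and per :: "nat \<Rightarrow> real"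
  assumes d_pos: "1 \<le> d" and k_ge: "2 \<le> k" and Lp_pos: "0 < Lp"
    and F_in: "F [] w \<in> Rn D"
    and deriv: "length us < k \<Longrightarrow> (F us has_derivative (\<lambda>u. F (u # us) w)) (at w)"
    and cont: "length us = k \<Longrightarrow> continuous_on UNIV (F us)"
    and F_trunc: "length us < k \<Longrightarrow> F (rvec_of d (coord u) # us) w = F (u # us) w"
    and orth: "i < d \<Longrightarrow> j < d \<Longrightarrow> i \<noteq> j \<Longrightarrow> F [uvec i] w \<bullet> F [uvec j] w = 0"
    and norm_ge_1: "i < d \<Longrightarrow> 1 \<le> norm (F [uvec i] w)"
    and second: "norm u \<le> 1 \<Longrightarrow> norm v \<le> 1 \<Longrightarrow> norm (F [u, v] w) \<le> Lp"
    and higher: "3 \<le> length us \<Longrightarrow> length us \<le> k \<Longrightarrow> (\<forall>u\<in>set us. norm u \<le> 1) \<Longrightarrow>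
                 norm (F us w) \<le> L (length us)"
    and per_pos: "j < d \<Longrightarrow> 0 < per j"
    and F_eq_iff: "w \<in> Rn d \<Longrightarrow> w' \<in> Rn d \<Longrightarrow>
                 F [] w = F [] w' \<longleftrightarrow> (\<forall>j<d. \<exists>m::int. coord w' j = coord w j + m * per j)"
begin

abbreviation "\<Phi> \<equiv> F []"

definition M :: "rvec set" where "M = \<Phi> ` Rn d"

abbreviation T :: "rvec \<Rightarrow> rvec set" where "T a \<equiv> (\<lambda>u. F [u] a) ` Rn d"

text \<open>Orthogonal projection onto the tangent space followed by the inverse of the differential
  at \<open>a\<close>, written in the orthogonal frame of partial derivatives.\<close>

definition tcoeffs :: "rvec \<Rightarrow> rvec \<Rightarrow> rvec" where
  "tcoeffs a v = rvec_of d (\<lambda>j. (v \<bullet> F [uvec j] a) / (F [uvec j] a \<bullet> F [uvec j] a))"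

lemma lin: "length us < k \<Longrightarrow> bounded_linear (\<lambda>u. F (u # us) w)"
  using deriv by (rule has_derivative_bounded_linear)

lemma lin1: "bounded_linear (\<lambda>u. F [u] w)"
  using k_ge by (intro lin) simp

lemma lin2: "bounded_linear (\<lambda>u. F [u, v] w)"
  using k_ge by (intro lin) simp

lemma deriv0: "(\<Phi> has_derivative (\<lambda>u. F [u] w)) (at w)"
  using k_ge by (intro deriv) simp

lemma deriv1: "(F [v] has_derivative (\<lambda>u. F [u, v] w)) (at w)"
  using k_ge by (intro deriv) simp

text \<open>Linearity in the inner direction is inherited from first order: \<open>F [x + y]\<close>
  and the sum of \<open>F [x]\<close> and \<open>F [y]\<close> are the same function, and
  derivatives are unique.\<close>

lemma F2_add_right: "F [u, x + y] w = F [u, x] w + F [u, y] w"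
proof -
  have "F [x + y] = (\<lambda>w. F [x] w + F [y] w)"
    using linear_add[OF bounded_linear.linear[OF lin1]] by auto
  then have "(F [x + y] has_derivative (\<lambda>u. F [u, x] w + F [u, y] w)) (at w)"
    using has_derivative_add[OF deriv1[of x w] deriv1[of y w]] by simp
  from has_derivative_unique[OF deriv1 this] show ?thesis by (rule fun_cong)
qed

lemma F2_scale_right: "F [u, c *\<^sub>R x] w = c *\<^sub>R F [u, x] w"
proof -
  have "F [c *\<^sub>R x] = (\<lambda>w. c *\<^sub>R F [x] w)"
    using linear_scale[OF bounded_linear.linear[OF lin1]] by auto
  then have "(F [c *\<^sub>R x] has_derivative (\<lambda>u. c *\<^sub>R F [u, x] w)) (at w)"
    using has_derivative_scaleR_right[OF deriv1[of x w], of c] by simp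
  from has_derivative_unique[OF deriv1 this] show ?thesis by (rule fun_cong)
qed

lemma F2_scale_left: "F [c *\<^sub>R u, x] w = c *\<^sub>R F [u, x] w"
  by (rule linear_scale[OF bounded_linear.linear[OF lin2]])

lemma second_le: "norm (F [u, v] w) \<le> Lp * norm u * norm v"
proof -
  define u' v' where "u' = u /\<^sub>R norm u" and "v' = v /\<^sub>R norm v"
  have "norm u' \<le> 1" "norm v' \<le> 1" by (cases "u = 0"; cases "v = 0"; simp add: u'_def v'_def)+
  from second[OF this] have "norm u * norm v * norm (F [u', v'] w) \<le> norm u * norm v * Lp"
    by (intro mult_left_mono) auto
  moreover have "u = norm u *\<^sub>R u'" "v = norm v *\<^sub>R v'" by (cases "u = 0"; cases "v = 0"; simp add: u'_def v'_def)+
  then have "F [u, v] w = norm u *\<^sub>R norm v *\<^sub>R F [u', v'] w"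
    by (metis F2_scale_left F2_scale_right)
  then have "norm (F [u, v] w) = norm u * norm v * norm (F [u', v'] w)" by simp
  ultimately show ?thesis by (simp add: mult_ac)
qed

lemma F1_expand: "F [u] w = (\<Sum>j<d. coord u j *\<^sub>R F [uvec j] w)"
proof -
  have "F [u] w = F [rvec_of d (coord u)] w" using F_trunc[of "[]"] k_ge by simp
  also have "\<dots> = (\<Sum>j<d. coord u j *\<^sub>R F [uvec j] w)"
    unfolding rvec_of_def linear_sum[OF bounded_linear.linear[OF lin1], unfolded o_def]
      linear_scale[OF bounded_linear.linear[OF lin1]] ..
  finally show ?thesis .
qed

lemma F1_inner: "F [u] w \<bullet> F [uvec j] w = (if j < d then coord u j * (F [uvec j] w \<bullet> F [uvec j] w) else 0)"
proof (cases "j < d")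
  case True
  have "F [u] w \<bullet> F [uvec j] w = (\<Sum>i<d. coord u i * (F [uvec i] w \<bullet> F [uvec j] w))"
    by (simp add: F1_expand[of u] inner_sum_left)
  also have "\<dots> = (\<Sum>i<d. if i = j then coord u j * (F [uvec j] w \<bullet> F [uvec j] w) else 0)"
    using True orth by (intro sum.cong) auto
  finally show ?thesis using True by simp
next
  case False
  \<comment> \<open>A basis vector beyond the first \<open>d\<close> coordinates is truncated to 0,
    so its differential vanishes.\<close>
  then have "rvec_of d (coord (uvec j)) = 0" by (intro rvec_eqI) auto
  then have "F [uvec j] w = F [0] w" using F_trunc[of "[]" "uvec j" w] k_ge by simp
  then have "F [uvec j] w = 0" using linear_0[OF bounded_linear.linear[OF lin1[of w]]] by simp
  then show ?thesis using False by simp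
qed

text \<open>Pythagoras for partial derivatives that are orthogonal and of length at least 1. The
  injectivity estimates below start from here.\<close>

lemma norm_F1_ge: "u \<in> Rn d \<Longrightarrow> norm u \<le> norm (F [u] w)"
proof (rule power2_le_imp_le)
  assume u: "u \<in> Rn d"
  have "(norm u)\<^sup>2 = (\<Sum>j<d. (coord u j)\<^sup>2)"
    using u by (simp only: power2_norm_eq_inner inner_Rn) (simp only: power2_eq_square)
  also have "\<dots> \<le> (\<Sum>j<d. (coord u j)\<^sup>2 * (F [uvec j] w \<bullet> F [uvec j] w))"
  proof (rule sum_mono)
    fix j assume "j \<in> {..<d}"
    then have "1 \<le> F [uvec j] w \<bullet> F [uvec j] w"
      using power_mono[OF norm_ge_1[of j w], of 2] by (simp add: power2_norm_eq_inner)
    then show "(coord u j)\<^sup>2 \<le> (coord u j)\<^sup>2 * (F [uvec j] w \<bullet> F [uvec j] w)"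
      using mult_left_mono[of 1 "F [uvec j] w \<bullet> F [uvec j] w" "(coord u j)\<^sup>2"] by simp
  qed
  also have "\<dots> = (\<Sum>j<d. coord u j * (F [u] w \<bullet> F [uvec j] w))"
    by (intro sum.cong) (auto simp: F1_inner[of u] power2_eq_square)
  also have "\<dots> = (norm (F [u] w))\<^sup>2"
    by (simp add: power2_norm_eq_inner F1_expand[of u] inner_sum_right)
  finally show "(norm u)\<^sup>2 \<le> (norm (F [u] w))\<^sup>2" .
qed simp

lemma F1_pos: "j < d \<Longrightarrow> 0 < F [uvec j] w \<bullet> F [uvec j] w"
  using norm_ge_1[of j w] by auto

lemma tcoeffs_F1: "u \<in> Rn d \<Longrightarrow> tcoeffs a (F [u] a) = u"
  using F1_pos[of _ a] by (intro rvec_eqI) (auto simp: tcoeffs_def F1_inner[of u] Rn_def less_le)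

lemma tcoeffs_in_Rn [simp]: "tcoeffs a v \<in> Rn d"
  by (simp add: tcoeffs_def)

lemma subspace_T: "subspace (T a)"
  by (rule linear_subspace_image[OF bounded_linear.linear[OF lin1] subspace_Rn])

lemma F1_in_T [simp]: "F [u] a \<in> T a"
proof (rule image_eqI)
  show "F [u] a = F [rvec_of d (coord u)] a" using F_trunc[of "[]"] k_ge by simp
qed simp

lemma T_eq_span: "T a = span ((\<lambda>j. F [uvec j] a) ` {..<d})"
proof
  show "T a \<subseteq> span ((\<lambda>j. F [uvec j] a) ` {..<d})"
  proof
    fix z assume "z \<in> T a"
    then obtain u where "z = F [u] a" by auto
    then show "z \<in> span ((\<lambda>j. F [uvec j] a) ` {..<d})"
      by (auto simp: F1_expand[of u] intro!: span_sum span_scale intro: span_base)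
  qed
  show "span ((\<lambda>j. F [uvec j] a) ` {..<d}) \<subseteq> T a"
    by (rule span_minimal[OF _ subspace_T]) auto
qed

lemma T_orthI:
  assumes "\<And>j. j < d \<Longrightarrow> v \<bullet> F [uvec j] a = 0" "z \<in> T a"
  shows "v \<bullet> z = 0"
proof -
  obtain u where "z = F [u] a" using assms(2) by auto
  then show ?thesis by (simp add: F1_expand[of u] inner_sum_right assms(1))
qed

lemma orth_proj_T: "orth_proj (T a) v = F [tcoeffs a v] a"
proof (rule orth_proj_eqI[OF subspace_T])
  fix z assume z: "z \<in> T a"
  show "(v - F [tcoeffs a v] a) \<bullet> z = 0"
    using F1_pos[of _ a] by (intro T_orthI[OF _ z]) (auto simp: inner_diff_left F1_inner[of "tcoeffs a v"] less_le, simp add: tcoeffs_def)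
qed simp

lemma bounded_linear_tcoeffs: "bounded_linear (tcoeffs a)"
proof -
  have "bounded_linear (\<lambda>v. rvec_of d (\<lambda>j. (v \<bullet> F [uvec j] a) * inverse (F [uvec j] a \<bullet> F [uvec j] a)))"
    unfolding rvec_of_def
    by (intro bounded_linear_sum bounded_linear_scaleR_left[THEN bounded_linear_compose]
        bounded_linear_mult_left[THEN bounded_linear_compose] bounded_linear_inner_left)
  then show ?thesis unfolding tcoeffs_def[abs_def] by (simp add: divide_inverse)
qed

text \<open>The projection does not increase norms and, by \<open>norm_F1_ge\<close>, neither does
  the inverse of the differential.\<close>

lemma norm_tcoeffs_le: "norm (tcoeffs a v) \<le> norm v"
proof -
  have "norm (tcoeffs a v) \<le> norm (F [tcoeffs a v] a)" by (rule norm_F1_ge) simp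
  also have "\<dots> = norm (orth_proj (T a) v)" by (simp add: orth_proj_T)
  also have "\<dots> \<le> norm v" unfolding T_eq_span by (rule norm_orth_proj_le) simp
  finally show ?thesis .
qed

lemma tcoeffs_orth_proj: "tcoeffs a (orth_proj (T a) u) = tcoeffs a u"
  by (simp add: orth_proj_T tcoeffs_F1)

lemma F1_tcoeffs: "v \<in> T a \<Longrightarrow> F [tcoeffs a v] a = v"
  by (auto simp: tcoeffs_F1)

section \<open>Quantitative local injectivity\<close>

lemma F1_diff_le: "norm (F [u] w - F [u] a) \<le> Lp * norm u * norm (w - a)"
proof (rule differentiable_bound[of UNIV])
  show "onorm (\<lambda>v. F [v, u] x) \<le> Lp * norm u" for x
    using second_le[of _ u x] Lp_pos by (intro onorm_bound) (auto simp: mult_ac)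
qed (use deriv1 in auto)

text \<open>Mean value inequality for \<open>\<Phi>\<close> minus its differential at
  \<open>a\<close>; the bound \<open>Lp\<close> on second derivatives makes the derivative of this
  difference at most \<open>Lp * r\<close> on the ball.\<close>

lemma linearization:
  assumes "w \<in> cball a r" "w' \<in> cball a r"
  shows "norm (\<Phi> w - \<Phi> w' - F [w - w'] a) \<le> Lp * r * norm (w - w')"
proof -
  have "norm ((\<Phi> w - F [w] a) - (\<Phi> w' - F [w'] a)) \<le> Lp * r * norm (w - w')"
  proof (rule differentiable_bound[of "cball a r"])
    fix x assume x: "x \<in> cball a r"
    show "((\<lambda>w. \<Phi> w - F [w] a) has_derivative (\<lambda>u. F [u] x - F [u] a)) (at x within cball a r)"
      by (intro has_derivative_diff bounded_linear.has_derivative[OF lin1] has_derivative_ident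
          has_derivative_at_withinI[OF deriv0])
    show "onorm (\<lambda>u. F [u] x - F [u] a) \<le> Lp * r"
    proof (rule onorm_bound)
      fix u
      have "norm (F [u] x - F [u] a) \<le> Lp * norm u * norm (x - a)" by (rule F1_diff_le)
      also have "\<dots> \<le> Lp * norm u * r"
        using x Lp_pos by (intro mult_left_mono) (auto simp: dist_norm norm_minus_commute)
      finally show "norm (F [u] x - F [u] a) \<le> Lp * r * norm u" by (simp add: mult_ac)
    next
      have "0 \<le> r" using x zero_le_dist[of a x] by (simp del: zero_le_dist)
      then show "0 \<le> Lp * r" using Lp_pos by simp
    qed
  qed (use assms in auto)
  moreover have "F [w - w'] a = F [w] a - F [w'] a"
    by (rule linear_diff[OF bounded_linear.linear[OF lin1]])
  then have "\<Phi> w - \<Phi> w' - F [w - w'] a = (\<Phi> w - F [w] a) - (\<Phi> w' - F [w'] a)"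
    by (simp only:) (simp add: algebra_simps)
  ultimately show ?thesis by (simp only:)
qed

text \<open>On a ball of radius \<open>1 / (2 * Lp)\<close> the linearization error is at most half
  of the displacement, while the differential does not shrink it. The half that remains is the
  constant 2.\<close>

lemma dist_le_2_dist:
  assumes "w \<in> Rn d" "w' \<in> Rn d" "w \<in> cball a (1 / (2 * Lp))" "w' \<in> cball a (1 / (2 * Lp))"
  shows "dist w w' \<le> 2 * dist (\<Phi> w) (\<Phi> w')"
proof -
  have "norm (w - w') \<le> norm (F [w - w'] a)"
    using assms by (intro norm_F1_ge subspace_diff[OF subspace_Rn])
  moreover have "norm (\<Phi> w - \<Phi> w' - F [w - w'] a) \<le> 1 / 2 * norm (w - w')"
    using linearization[OF assms(3,4)] Lp_pos by simp
  moreover have "norm (F [w - w'] a) \<le> norm (\<Phi> w - \<Phi> w') + norm (\<Phi> w - \<Phi> w' - F [w - w'] a)"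
    by (metis norm_triangle_sub norm_minus_commute)
  ultimately show ?thesis by (simp add: dist_norm)
qed

lemma inj_on_ball: "inj_on \<Phi> (Rn d \<inter> cball a (1 / (2 * Lp)))"
  using dist_le_2_dist[of _ _ a] by (intro inj_onI) fastforce

section \<open>Compactness and connectedness of the image, and openness of the
  parametrization\<close>

lemma continuous_on_\<Phi>: "continuous_on S \<Phi>"
  using deriv0 by (meson has_derivative_continuous continuous_at_imp_continuous_on)

lemma representative:
  assumes "w \<in> Rn d"
  shows "\<exists>w'\<in>cbox_Rn d l per. \<Phi> w' = \<Phi> w"
proof -
  define m where "m j = \<lfloor>(coord w j - l j) / per j\<rfloor>" for j
  define w' where "w' = rvec_of d (\<lambda>j. coord w j - m j * per j)"
  have "l j \<le> coord w j - m j * per j \<and> coord w j - m j * per j \<le> l j + per j" if "j < d" for j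
  proof -
    have "m j \<le> (coord w j - l j) / per j" "(coord w j - l j) / per j \<le> m j + 1"
      unfolding m_def by linarith+
    with per_pos[OF that] show ?thesis by (simp add: field_simps)
  qed
  then have "w' \<in> cbox_Rn d l per" by (auto simp: cbox_Rn_def w'_def)
  moreover have "\<Phi> w' = \<Phi> w"
    using assms by (subst F_eq_iff) (auto simp: w'_def)
  ultimately show ?thesis by blast
qed

lemma M_eq_image_cbox: "M = \<Phi> ` cbox_Rn d l per"
  unfolding M_def
proof (intro equalityI subsetI)
  fix p assume "p \<in> \<Phi> ` Rn d"
  then obtain w where "w \<in> Rn d" "p = \<Phi> w" by auto
  with representative[of w l] show "p \<in> \<Phi> ` cbox_Rn d l per" by (metis image_eqI)
qed (auto simp: cbox_Rn_def)

lemma compact_M: "compact M"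
  unfolding M_eq_image_cbox[of "\<lambda>_. 0"]
  by (intro compact_continuous_image continuous_on_\<Phi> compact_cbox_Rn)

lemma connected_M: "connected M"
  unfolding M_def by (intro connected_continuous_image continuous_on_\<Phi> connected_Rn)

lemma M_subset: "M \<subseteq> Rn D"
  unfolding M_def using F_in by auto

text \<open>Openness follows from compactness. Since \<open>\<Phi>\<close> is many-to-one, the
  complement of the image is described by those points of a fundamental box all of whose lattice
  translates avoid \<open>U\<close>. They form a compact set, so the complement is closed.\<close>

lemma open_map:
  assumes "openin (top_of_set (Rn d)) W"
  shows "openin (top_of_set M) (\<Phi> ` W)"
proof -
  obtain U where U: "open U" "W = Rn d \<inter> U" using assms by (auto simp: openin_open)
  define K where "K = cbox_Rn d (\<lambda>_. 0) per"
  define \<Lambda> where "\<Lambda> = {\<nu> \<in> Rn d. \<forall>j<d. \<exists>m::int. coord \<nu> j = m * per j}"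
  define K' where "K' = K \<inter> (\<Inter>\<nu>\<in>\<Lambda>. {w. w + \<nu> \<in> - U})"
  have KR: "K \<subseteq> Rn d" by (auto simp: K_def cbox_Rn_def)
  have "compact K'"
    unfolding K'_def K_def
  proof (intro compact_Int_closed compact_cbox_Rn closed_INT ballI)
    fix \<nu>
    show "closed {w. w + \<nu> \<in> - U}"
      using U(1) by (intro closed_vimage[of "- U" "\<lambda>w. w + \<nu>", unfolded vimage_def]) (auto intro!: continuous_intros)
  qed
  then have "closed (\<Phi> ` K')"
    by (intro compact_imp_closed compact_continuous_image continuous_on_\<Phi>)
  moreover have "M - \<Phi> ` W = \<Phi> ` K'"
  proof (intro equalityI subsetI)
    fix p assume p: "p \<in> M - \<Phi> ` W"
    then obtain w where w: "w \<in> K" "p = \<Phi> w" by (auto simp: K_def M_eq_image_cbox[of "\<lambda>_. 0"])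
    have "w + \<nu> \<notin> U" if l: "\<nu> \<in> \<Lambda>" for \<nu>
    proof
      assume "w + \<nu> \<in> U"
      moreover have "w + \<nu> \<in> Rn d" using w KR l by (auto simp: \<Lambda>_def intro: subspace_add[OF subspace_Rn])
      moreover have "\<Phi> w = \<Phi> (w + \<nu>)"
        using w KR l calculation(2) by (subst F_eq_iff) (auto simp: \<Lambda>_def)
      ultimately show False using p w U by auto
    qed
    then show "p \<in> \<Phi> ` K'" using w by (auto simp: K'_def)
  next
    fix p assume "p \<in> \<Phi> ` K'"
    then obtain w where w: "w \<in> K'" "p = \<Phi> w" by auto
    have "p \<in> M" using w KR by (auto simp: M_def K'_def)
    moreover have False if "w' \<in> W" "p = \<Phi> w'" for w'
    proof -
      have R: "w \<in> Rn d" "w' \<in> Rn d" using w KR that U by (auto simp: K'_def)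
      have "\<Phi> w = \<Phi> w'" using w that by simp
      then have "w' - w \<in> \<Lambda>"
        using R subspace_diff[OF subspace_Rn R(2,1)] by (auto simp: F_eq_iff \<Lambda>_def)
      then show False using w that U by (auto simp: K'_def)
    qed
    ultimately show "p \<in> M - \<Phi> ` W" by auto
  qed
  ultimately have "closedin (top_of_set M) (M - \<Phi> ` W)"
    by (intro closed_subset) auto
  moreover have "\<Phi> ` W \<subseteq> M" using U by (auto simp: M_def)
  ultimately show ?thesis by (simp add: openin_closedin_eq)
qed

section \<open>Lifting of curves, tangent spaces and the second fundamental form\<close>

lemma nearby:
  assumes "a \<in> Rn d" "0 < r"
  shows "\<forall>\<^sub>F q in nhds (\<Phi> a). q \<in> M \<longrightarrow> (\<exists>w\<in>Rn d \<inter> ball a r. \<Phi> w = q)"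
proof -
  have "openin (top_of_set M) (\<Phi> ` (Rn d \<inter> ball a r))"
    by (intro open_map openin_open_Int) simp
  then obtain U where U: "open U" "\<Phi> ` (Rn d \<inter> ball a r) = M \<inter> U" by (auto simp: openin_open)
  moreover have "\<Phi> a \<in> U" using U assms by (metis Int_iff centre_in_ball imageI)
  ultimately show ?thesis
    unfolding eventually_nhds by (intro exI[of _ U]) (auto, metis IntI image_iff)
qed


text \<open>The curves are only differentiable at 0, so the lift is chosen pointwise among preimages
  near \<open>a\<close>. Local injectivity bounds its displacement by twice that of the curve; the
  linearization error is then quadratic, and the derivative at 0 transfers to the lift.\<close>

lemma curve_lift:
  assumes a: "a \<in> Rn d" and \<gamma>: "curve_through M (\<Phi> a) u \<gamma>"
  obtains c where "c 0 = a" "\<forall>\<^sub>F t in nhds 0. c t \<in> Rn d \<and> \<Phi> (c t) = \<gamma> t"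
    "(c has_vector_derivative tcoeffs a u) (at 0)" "F [tcoeffs a u] a = u"
proof -
  define r where "r = 1 / (2 * Lp)"
  have r: "0 < r" using Lp_pos by (simp add: r_def)
  define c where "c t = (SOME w. w \<in> Rn d \<inter> ball a r \<and> \<Phi> w = \<gamma> t)" for t
  have \<gamma>0: "\<gamma> 0 = \<Phi> a" and \<gamma>M: "\<forall>\<^sub>F t in nhds 0. \<gamma> t \<in> M"
    and \<gamma>': "((\<lambda>t. (\<gamma> t - \<Phi> a) /\<^sub>R t) \<longlongrightarrow> u) (at 0)" and \<gamma>d: "(\<gamma> has_vector_derivative u) (at 0)"
    using \<gamma> by (auto simp: curve_through_def has_vector_derivative_at_0_iff)
  have lim: "filterlim \<gamma> (nhds (\<Phi> a)) (nhds 0)"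
    using has_vector_derivative_continuous[OF \<gamma>d] \<gamma>0
    unfolding isCont_def tendsto_at_iff_tendsto_nhds by simp
  have "\<forall>\<^sub>F t in nhds 0. \<gamma> t \<in> M \<longrightarrow> (\<exists>w\<in>Rn d \<inter> ball a r. \<Phi> w = \<gamma> t)"
    using lim nearby[OF a r] by (rule eventually_compose_filterlim[rotated])
  with \<gamma>M have c: "\<forall>\<^sub>F t in nhds 0. c t \<in> Rn d \<inter> ball a r \<and> \<Phi> (c t) = \<gamma> t"
  proof eventually_elim
    case (elim t)
    then have "\<exists>w. w \<in> Rn d \<inter> ball a r \<and> \<Phi> w = \<gamma> t" by blast
    then show ?case unfolding c_def by (rule someI_ex)
  qed
  have c0: "c 0 = a"
  proof -
    have "c 0 \<in> Rn d \<inter> cball a r" "\<Phi> (c 0) = \<Phi> a"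
      using eventually_nhds_x_imp_x[OF c] \<gamma>0 by auto
    with inj_on_ball[of a] a r show ?thesis by (auto simp: inj_on_def r_def[symmetric])
  qed
  have close: "\<forall>\<^sub>F t in at 0. norm (c t - a) \<le> 2 * norm (\<gamma> t - \<Phi> a)"
    using eventually_nhds_conv_at[of _ "0::real"] c
  proof -
    have "\<forall>\<^sub>F t in at 0. c t \<in> Rn d \<inter> ball a r \<and> \<Phi> (c t) = \<gamma> t"
      using c by (simp add: eventually_nhds_conv_at)
    then show ?thesis
    proof eventually_elim
      case (elim t)
      then show ?case
        using dist_le_2_dist[of "c t" a a] a r by (auto simp: r_def[symmetric] dist_norm)
    qed
  qed
  \<comment> \<open>The error made by replacing \<open>\<Phi>\<close> with its differential along
    the lift.\<close>
  define \<rho> where "\<rho> t = \<gamma> t - \<Phi> a - F [c t - a] a" for t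
  have \<rho>: "((\<lambda>t. \<rho> t /\<^sub>R t) \<longlongrightarrow> 0) (at 0)"
  proof (rule Lim_null_comparison)
    have "\<forall>\<^sub>F t in at 0. c t \<in> Rn d \<inter> ball a r \<and> \<Phi> (c t) = \<gamma> t"
      using c by (simp add: eventually_nhds_conv_at)
    with close show "\<forall>\<^sub>F t in at 0. norm (\<rho> t /\<^sub>R t) \<le>
        Lp * 4 * norm (\<gamma> t - \<Phi> a) * norm ((\<gamma> t - \<Phi> a) /\<^sub>R t)"
    proof eventually_elim
      case (elim t)
      have "norm (\<rho> t) \<le> Lp * norm (c t - a) * norm (c t - a)"
        using linearization[of "c t" a "norm (c t - a)" a] elim
        by (simp add: \<rho>_def dist_norm norm_minus_commute)
      also have "\<dots> \<le> Lp * (2 * norm (\<gamma> t - \<Phi> a)) * (2 * norm (\<gamma> t - \<Phi> a))"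
        using elim Lp_pos by (intro mult_mono) auto
      finally have "inverse \<bar>t\<bar> * norm (\<rho> t) \<le> inverse \<bar>t\<bar> * (Lp * (2 * norm (\<gamma> t - \<Phi> a)) * (2 * norm (\<gamma> t - \<Phi> a)))"
        by (intro mult_left_mono) auto
      then show ?case by (simp add: mult_ac)
    qed
    have "(\<gamma> \<longlongrightarrow> \<Phi> a) (at 0)" using lim by (rule filterlim_mono) (auto simp: at_within_def)
    then have "((\<lambda>t. norm (\<gamma> t - \<Phi> a)) \<longlongrightarrow> 0) (at 0)" by (simp add: tendsto_norm_zero_iff LIM_zero_iff)
    from tendsto_mult[OF tendsto_mult[OF tendsto_const this] tendsto_norm[OF \<gamma>'], of "Lp * 4"]
    show "((\<lambda>t. Lp * 4 * norm (\<gamma> t - \<Phi> a) * norm ((\<gamma> t - \<Phi> a) /\<^sub>R t)) \<longlongrightarrow> 0) (at 0)" by simp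
  qed
  have c': "((\<lambda>t. (c t - c 0) /\<^sub>R t) \<longlongrightarrow> tcoeffs a u) (at 0)"
  proof (rule Lim_transform_eventually)
    note bl = bounded_linear_tcoeffs[of a]
    have "((\<lambda>t. tcoeffs a ((\<gamma> t - \<Phi> a) /\<^sub>R t) - tcoeffs a (\<rho> t /\<^sub>R t)) \<longlongrightarrow> tcoeffs a u - tcoeffs a 0) (at 0)"
      by (intro tendsto_diff bounded_linear.tendsto[OF bl] \<gamma>' \<rho>)
    then show "((\<lambda>t. tcoeffs a ((\<gamma> t - \<Phi> a) /\<^sub>R t) - tcoeffs a (\<rho> t /\<^sub>R t)) \<longlongrightarrow> tcoeffs a u) (at 0)"
      using linear_0[OF bounded_linear.linear[OF bl]] by simp
    have "\<forall>\<^sub>F t in at 0. c t \<in> Rn d \<inter> ball a r \<and> \<Phi> (c t) = \<gamma> t"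
      using c by (simp add: eventually_nhds_conv_at)
    then show "\<forall>\<^sub>F t in at 0. tcoeffs a ((\<gamma> t - \<Phi> a) /\<^sub>R t) - tcoeffs a (\<rho> t /\<^sub>R t) = (c t - c 0) /\<^sub>R t"
    proof eventually_elim
      case (elim t)
      have "tcoeffs a ((\<gamma> t - \<Phi> a) /\<^sub>R t) - tcoeffs a (\<rho> t /\<^sub>R t) = tcoeffs a (((\<gamma> t - \<Phi> a) - \<rho> t) /\<^sub>R t)"
        using linear_diff[OF bounded_linear.linear[OF bl]] by (simp add: scaleR_diff_right)
      also have "\<dots> = tcoeffs a (F [c t - a] a) /\<^sub>R t"
        using linear_scale[OF bounded_linear.linear[OF bl]] by (simp add: \<rho>_def)
      also have "tcoeffs a (F [c t - a] a) = c t - a"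
        using elim a by (intro tcoeffs_F1 subspace_diff[OF subspace_Rn]) auto
      finally show ?case by (simp add: c0)
    qed
  qed
  have "F [tcoeffs a u] a = u"
  proof (rule tendsto_unique)
    show "((\<lambda>t. F [(c t - c 0) /\<^sub>R t] a + \<rho> t /\<^sub>R t) \<longlongrightarrow> F [tcoeffs a u] a) (at 0)"
      using tendsto_add[OF bounded_linear.tendsto[OF lin1 c'] \<rho>, of a] by simp
    have "F [(c t - c 0) /\<^sub>R t] a + \<rho> t /\<^sub>R t = (\<gamma> t - \<Phi> a) /\<^sub>R t" for t
      using linear_scale[OF bounded_linear.linear[OF lin1[of a]], of "inverse t" "c t - c 0"]
      by (simp add: \<rho>_def c0 scaleR_diff_right)
    then show "((\<lambda>t. F [(c t - c 0) /\<^sub>R t] a + \<rho> t /\<^sub>R t) \<longlongrightarrow> u) (at 0)" using \<gamma>' by simp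
  qed simp
  moreover have "(c has_vector_derivative tcoeffs a u) (at 0)"
    using c' by (simp add: has_vector_derivative_at_0_iff)
  moreover have "\<forall>\<^sub>F t in nhds 0. c t \<in> Rn d \<and> \<Phi> (c t) = \<gamma> t"
    using c by eventually_elim auto
  ultimately show thesis using that c0 by blast
qed

lemma line_deriv: "((\<lambda>t. F us (a + t *\<^sub>R u)) has_vector_derivative F (u # us) a) (at 0)" if "length us < k"
proof -
  have "((\<lambda>t. a + t *\<^sub>R u) has_derivative (\<lambda>t. t *\<^sub>R u)) (at 0)"
    by (auto intro!: derivative_eq_intros)
  from has_derivative_compose[OF this, of "F us"] deriv[OF that, of a]
  have "((\<lambda>t. F us (a + t *\<^sub>R u)) has_derivative (\<lambda>t. F (t *\<^sub>R u # us) a)) (at 0)" by simp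
  then show ?thesis
    unfolding has_vector_derivative_def linear_scale[OF bounded_linear.linear[OF lin[OF that]]] .
qed

lemma line_curve:
  assumes "a \<in> Rn d" "u \<in> Rn d"
  shows "curve_through M (\<Phi> a) (F [u] a) (\<lambda>t. \<Phi> (a + t *\<^sub>R u))"
  using line_deriv[of "[]" a u] k_ge assms subspace_add[OF subspace_Rn] subspace_scale[OF subspace_Rn]
  by (auto simp: curve_through_def M_def intro!: always_eventually)

lemma tangent_space_eq: "a \<in> Rn d \<Longrightarrow> tangent_space M (\<Phi> a) = T a"
proof (intro equalityI subsetI)
  fix u assume a: "a \<in> Rn d" "u \<in> tangent_space M (\<Phi> a)"
  then obtain \<gamma> where "curve_through M (\<Phi> a) u \<gamma>" by (auto simp: tangent_space_def)
  from curve_lift[OF a(1) this] show "u \<in> T a" by (metis F1_in_T)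
qed (auto simp: tangent_space_def intro: line_curve)

text \<open>The point is independence of the curve and the field. An arbitrary field is expanded in
  the frame of partial derivatives along the lifted curve. Tested against a normal vector
  \<open>n\<close>, the frame vanishes at time 0, so the derivative of the field sees only the
  derivatives of the frame; for the coefficients, continuity at 0 suffices.\<close>

lemma second_fundamental_form_eq:
  assumes a: "a \<in> Rn d" and \<alpha>: "\<alpha> \<in> Rn d" and \<beta>: "\<beta> \<in> Rn d"
  shows "second_fundamental_form M (\<Phi> a) (F [\<alpha>] a) (F [\<beta>] a) = F [\<alpha>, \<beta>] a - orth_proj (T a) (F [\<alpha>, \<beta>] a)"
  unfolding second_fundamental_form_def
proof (rule the_equality)
  let ?\<gamma> = "\<lambda>t. \<Phi> (a + t *\<^sub>R \<alpha>)" and ?Y = "\<lambda>t. F [\<beta>] (a + t *\<^sub>R \<alpha>)"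
  have in_Rn: "a + t *\<^sub>R \<alpha> \<in> Rn d" for t
    using a \<alpha> by (intro subspace_add[OF subspace_Rn] subspace_scale[OF subspace_Rn])
  show "\<exists>\<gamma> Y Y'. curve_through M (\<Phi> a) (F [\<alpha>] a) \<gamma> \<and> Y 0 = F [\<beta>] a \<and>
      (\<forall>\<^sub>F t in nhds 0. Y t \<in> tangent_space M (\<gamma> t)) \<and> (Y has_vector_derivative Y') (at 0) \<and>
      F [\<alpha>, \<beta>] a - orth_proj (T a) (F [\<alpha>, \<beta>] a) = Y' - orth_proj (tangent_space M (\<Phi> a)) Y'"
    using line_deriv[of "[\<beta>]" a \<alpha>] k_ge a
    by (intro exI[of _ ?\<gamma>] exI[of _ ?Y] exI[of _ "F [\<alpha>, \<beta>] a"] conjI line_curve \<alpha>)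
      (auto simp: tangent_space_eq in_Rn intro!: always_eventually)
next
  fix w assume "\<exists>\<gamma> Y Y'. curve_through M (\<Phi> a) (F [\<alpha>] a) \<gamma> \<and> Y 0 = F [\<beta>] a \<and>
      (\<forall>\<^sub>F t in nhds 0. Y t \<in> tangent_space M (\<gamma> t)) \<and> (Y has_vector_derivative Y') (at 0) \<and>
      w = Y' - orth_proj (tangent_space M (\<Phi> a)) Y'"
  then obtain \<gamma> Y Y' where \<gamma>: "curve_through M (\<Phi> a) (F [\<alpha>] a) \<gamma>" and Y0: "Y 0 = F [\<beta>] a"
    and YT: "\<forall>\<^sub>F t in nhds 0. Y t \<in> tangent_space M (\<gamma> t)"
    and Y': "(Y has_vector_derivative Y') (at 0)" and w: "w = Y' - orth_proj (T a) Y'"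
    by (auto simp: tangent_space_eq a)
  obtain c where c0: "c 0 = a" and c: "\<forall>\<^sub>F t in nhds 0. c t \<in> Rn d \<and> \<Phi> (c t) = \<gamma> t"
    and c': "(c has_vector_derivative \<alpha>) (at 0)"
    using curve_lift[OF a \<gamma>] \<alpha> by (auto simp: tcoeffs_F1)
  have cont_c: "(c \<longlongrightarrow> a) (at 0)"
    using has_vector_derivative_continuous[OF c'] by (simp add: isCont_def c0)
  have comp: "((\<lambda>t. F us (c t)) has_vector_derivative F (\<alpha> # us) a) (at 0)" if us: "length us < k" for us
  proof -
    have "(F us has_derivative (\<lambda>u. F (u # us) a)) (at (c 0))" using deriv[OF us] by (simp add: c0)
    from has_derivative_compose[OF c'[unfolded has_vector_derivative_def] this]
    show ?thesis
      unfolding has_vector_derivative_def linear_scale[OF bounded_linear.linear[OF lin[OF us]]] .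
  qed
  have lim1: "((\<lambda>t. F [v] (c t)) \<longlongrightarrow> F [v] a) (at 0)" for v
    using has_vector_derivative_continuous[OF comp[of "[v]"]] k_ge by (simp add: isCont_def c0)
  have Ylim: "(Y \<longlongrightarrow> F [\<beta>] a) (at 0)"
    using has_vector_derivative_continuous[OF Y'] by (simp add: isCont_def Y0)
  have key: "Y' \<bullet> n = F [\<alpha>, \<beta>] a \<bullet> n" if n: "\<And>z. z \<in> T a \<Longrightarrow> z \<bullet> n = 0" for n
  proof -
    define b where "b t = tcoeffs (c t) (Y t)" for t
    have blim: "((\<lambda>t. coord (b t) j) \<longlongrightarrow> coord \<beta> j) (at 0)" if j: "j < d" for j
    proof -
      have "((\<lambda>t. (Y t \<bullet> F [uvec j] (c t)) / (F [uvec j] (c t) \<bullet> F [uvec j] (c t))) \<longlongrightarrow>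
          (F [\<beta>] a \<bullet> F [uvec j] a) / (F [uvec j] a \<bullet> F [uvec j] a)) (at 0)"
        using F1_pos[OF j, of a] by (intro tendsto_divide tendsto_inner Ylim lim1) auto
      moreover have "(F [\<beta>] a \<bullet> F [uvec j] a) / (F [uvec j] a \<bullet> F [uvec j] a) = coord \<beta> j"
        using j F1_pos[OF j, of a] by (simp add: F1_inner[of \<beta>] less_le)
      ultimately show ?thesis using j by (simp add: b_def tcoeffs_def)
    qed
    have qlim: "((\<lambda>t. (F [uvec j] (c t) \<bullet> n) / t) \<longlongrightarrow> F [\<alpha>, uvec j] a \<bullet> n) (at 0)" for j
    proof -
      have "((\<lambda>t. (F [uvec j] (c t) - F [uvec j] (c 0)) /\<^sub>R t) \<longlongrightarrow> F [\<alpha>, uvec j] a) (at 0)"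
        using comp[of "[uvec j]"] k_ge by (simp add: has_vector_derivative_at_0_iff)
      from tendsto_inner[OF this tendsto_const[of n]]
      show ?thesis using n[of "F [uvec j] a"] by (simp add: c0 inner_diff_left divide_inverse mult.commute)
    qed
    have "((\<lambda>t. \<Sum>j<d. coord (b t) j * ((F [uvec j] (c t) \<bullet> n) / t)) \<longlongrightarrow>
        (\<Sum>j<d. coord \<beta> j * (F [\<alpha>, uvec j] a \<bullet> n))) (at 0)"
      by (intro tendsto_sum tendsto_mult blim qlim) simp
    moreover have "\<forall>\<^sub>F t in at 0. (\<Sum>j<d. coord (b t) j * ((F [uvec j] (c t) \<bullet> n) / t)) = (Y t \<bullet> n) / t"
    proof -
      have "\<forall>\<^sub>F t in at 0. c t \<in> Rn d \<and> \<Phi> (c t) = \<gamma> t" "\<forall>\<^sub>F t in at 0. Y t \<in> tangent_space M (\<gamma> t)"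
        using c YT by (auto simp: eventually_nhds_conv_at)
      then show ?thesis
      proof eventually_elim
        case (elim t)
        then have "Y t \<in> T (c t)" using tangent_space_eq[of "c t"] by simp
        then have "Y t = F [b t] (c t)" by (simp only: b_def F1_tcoeffs)
        then have "Y t \<bullet> n = (\<Sum>j<d. coord (b t) j * (F [uvec j] (c t) \<bullet> n))"
          by (simp add: F1_expand[of "b t"] inner_sum_left)
        then show ?case by (simp add: sum_divide_distrib)
      qed
    qed
    ultimately have "((\<lambda>t. (Y t \<bullet> n) / t) \<longlongrightarrow> (\<Sum>j<d. coord \<beta> j * (F [\<alpha>, uvec j] a \<bullet> n))) (at 0)"
      by (rule Lim_transform_eventually)
    moreover have "((\<lambda>t. (Y t \<bullet> n) / t) \<longlongrightarrow> Y' \<bullet> n) (at 0)"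
    proof -
      have "((\<lambda>t. (Y t - Y 0) /\<^sub>R t) \<longlongrightarrow> Y') (at 0)"
        using Y' by (simp add: has_vector_derivative_at_0_iff)
      from tendsto_inner[OF this tendsto_const[of n]]
      show ?thesis using n[of "F [\<beta>] a"] by (simp add: Y0 inner_diff_left divide_inverse mult.commute)
    qed
    ultimately have "Y' \<bullet> n = (\<Sum>j<d. coord \<beta> j * (F [\<alpha>, uvec j] a \<bullet> n))"
      by (rule tendsto_unique[OF at_neq_bot, rotated])
    also have "\<dots> = F [\<alpha>, \<beta>] a \<bullet> n"
    proof -
      have lin: "linear (\<lambda>v. F [\<alpha>, v] a)"
        by (rule linearI) (rule F2_add_right, rule F2_scale_right)
      have "F [\<alpha>, \<beta>] a = F [\<alpha>, \<Sum>j<d. coord \<beta> j *\<^sub>R uvec j] a"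
        using rvec_of_coord[OF \<beta>] by (simp add: rvec_of_def)
      also have "\<dots> = (\<Sum>j<d. coord \<beta> j *\<^sub>R F [\<alpha>, uvec j] a)"
        unfolding linear_sum[OF lin, unfolded o_def] F2_scale_right ..
      finally show ?thesis by (simp add: inner_sum_left)
    qed
    finally show ?thesis .
  qed
  define X where "X = Y' - F [\<alpha>, \<beta>] a"
  \<comment> \<open>Testing with the normal part of \<open>X\<close> itself shows that
    \<open>X\<close> is tangent.\<close>
  define n where "n = X - orth_proj (T a) X"
  have fin: "finite ((\<lambda>j. F [uvec j] a) ` {..<d})" by simp
  have nT: "n \<bullet> z = 0" if "z \<in> T a" for z
    using that unfolding n_def T_eq_span by (intro orth_proj_orth fin)
  have "z \<bullet> n = 0" if "z \<in> T a" for z using nT[OF that] by (simp add: inner_commute)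
  from key[OF this] have "X \<bullet> n = 0" by (simp add: X_def inner_diff_left)
  moreover have "n \<bullet> orth_proj (T a) X = 0"
    by (rule nT) (auto simp: orth_proj_T)
  moreover have "n \<bullet> n = n \<bullet> X - n \<bullet> orth_proj (T a) X"
    by (subst (2) n_def) (rule inner_diff_right)
  ultimately have "n \<bullet> n = 0" by (simp add: inner_commute)
  then have "X = orth_proj (T a) X" by (simp add: n_def)
  moreover have "orth_proj (T a) X = orth_proj (T a) Y' - orth_proj (T a) (F [\<alpha>, \<beta>] a)"
    unfolding X_def T_eq_span by (rule linear_diff[OF bounded_linear.linear[OF bounded_linear_orth_proj[OF fin]]])
  ultimately show "w = F [\<alpha>, \<beta>] a - orth_proj (T a) (F [\<alpha>, \<beta>] a)"
    unfolding w X_def by (simp add: algebra_simps)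
qed


text \<open>The correction term may have a tangential component, so the reparametrisation of \<open>\<Phi>\<close>
  by the linear map \<open>tcoeffs a\<close> is already admissible; it is a contraction, hence the
  bounds on the differentials of \<open>\<Phi>\<close> carry over.\<close>

lemma local_parametrization_M:
  assumes a: "a \<in> Rn d"
  shows "local_parametrization k Lp L M (\<Phi> a)"
proof -
  define N where "N v = \<Phi> (a + tcoeffs a v) - \<Phi> a - F [tcoeffs a v] a" for v
  \<comment> \<open>Subtracting the affine part of \<open>\<Phi>\<close> at \<open>a\<close> changes
    only the differentials of order 0 and 1.\<close>
  define G where "G i v us =
    (if i = 0 then N v
     else if i = 1 then F [tcoeffs a (hd us)] (a + tcoeffs a v) - F [tcoeffs a (hd us)] a
     else F (map (tcoeffs a) us) (a + tcoeffs a v))" for i :: nat and v us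
  note bl = bounded_linear_tcoeffs[of a]
  have N_eq: "\<Phi> a + v + N v = \<Phi> (a + tcoeffs a v)" if "v \<in> T a" for v
    using F1_tcoeffs[OF that] by (simp add: N_def)
  have comp: "((\<lambda>v. F us (a + tcoeffs a v)) has_derivative (\<lambda>u. F (tcoeffs a u # us) (a + tcoeffs a v))) (at v within S)"
    if "length us < k" for us v S
  proof (rule has_derivative_at_withinI)
    have "((\<lambda>v. a + tcoeffs a v) has_derivative tcoeffs a) (at v)"
      using bounded_linear.has_derivative[OF bl has_derivative_ident] by (auto intro!: derivative_eq_intros)
    from has_derivative_compose[OF this deriv[OF that]]
    show "((\<lambda>v. F us (a + tcoeffs a v)) has_derivative (\<lambda>u. F (tcoeffs a u # us) (a + tcoeffs a v))) (at v)" .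
  qed
  have lin_comp: "((\<lambda>v. F [tcoeffs a v] a) has_derivative (\<lambda>u. F [tcoeffs a u] a)) (at v within S)" for v S
    by (intro bounded_linear.has_derivative[OF lin1] bounded_linear.has_derivative[OF bl] has_derivative_ident)
  \<comment> \<open>The smallest admissible radius. The contraction \<open>tcoeffs a\<close> keeps
    this ball inside the one of radius \<open>1 / (2 * Lp)\<close> on which \<open>\<Phi>\<close> is
    injective.\<close>
  let ?S = "T a \<inter> cball 0 (1 / (4 * Lp))"
  have in_Rn: "a + tcoeffs a v \<in> Rn d" for v
    using a by (intro subspace_add[OF subspace_Rn]) auto
  have "Ck_differentials k (T a) ?S N G"
    unfolding Ck_differentials_def
  proof (intro conjI ballI allI impI)
    fix w assume "w \<in> ?S"
    show "G 0 w [] = N w" by (simp add: G_def)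
  next
    fix i us w
    assume i: "i < k" and us: "length us = i \<and> set us \<subseteq> T a" and "w \<in> ?S"
    consider "i = 0" | "i = 1" | "2 \<le> i" by linarith
    then show "((\<lambda>y. G i y us) has_derivative (\<lambda>u. G (Suc i) w (orth_proj (T a) u # us))) (at w within ?S)"
    proof cases
      case 1
      have "((\<lambda>v. \<Phi> (a + tcoeffs a v) - \<Phi> a - F [tcoeffs a v] a) has_derivative
          (\<lambda>u. F [tcoeffs a u] (a + tcoeffs a w) - 0 - F [tcoeffs a u] a)) (at w within ?S)"
        using k_ge by (intro has_derivative_diff comp lin_comp has_derivative_const) auto
      then show ?thesis using 1 by (simp add: G_def N_def[abs_def] tcoeffs_orth_proj)
    next
      case 2
      then obtain x where "us = [x]" using us by (auto simp: length_Suc_conv)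
      moreover have "((\<lambda>v. F [tcoeffs a x] (a + tcoeffs a v) - F [tcoeffs a x] a) has_derivative
          (\<lambda>u. F [tcoeffs a u, tcoeffs a x] (a + tcoeffs a w) - 0)) (at w within ?S)"
        using k_ge by (intro has_derivative_diff comp has_derivative_const) auto
      ultimately show ?thesis using 2 by (simp add: G_def tcoeffs_orth_proj)
    next
      case 3
      then show ?thesis using comp[of "map (tcoeffs a) us" w ?S] us i
        by (simp add: G_def tcoeffs_orth_proj)
    qed
  next
    fix us assume us: "length us = k \<and> set us \<subseteq> T a"
    have "continuous_on ?S (\<lambda>v. F (map (tcoeffs a) us) (a + tcoeffs a v))"
      using us by (intro continuous_on_compose2[OF cont] continuous_intros
          bounded_linear.continuous_on[OF bl]) auto
    then show "continuous_on ?S (\<lambda>w. G k w us)" using k_ge by (simp add: G_def)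
  qed
  moreover have "(\<lambda>v. \<Phi> a + v + N v) ` ?S \<subseteq> M"
    using in_Rn by (auto simp: N_eq M_def)
  moreover have "inj_on (\<lambda>v. \<Phi> a + v + N v) ?S"
  proof (rule inj_onI)
    fix v w assume v: "v \<in> ?S" and w: "w \<in> ?S" and eq: "\<Phi> a + v + N v = \<Phi> a + w + N w"
    have ball: "a + tcoeffs a x \<in> Rn d \<inter> cball a (1 / (2 * Lp))" if "x \<in> ?S" for x
    proof -
      have "norm (tcoeffs a x) \<le> 1 / (4 * Lp)"
        using that norm_tcoeffs_le[of a x] by simp
      also have "\<dots> \<le> 1 / (2 * Lp)" using Lp_pos by (simp add: field_simps)
      finally show ?thesis using in_Rn by (simp add: dist_norm)
    qed
    have "\<Phi> (a + tcoeffs a v) = \<Phi> (a + tcoeffs a w)" using eq v w by (simp only: N_eq IntD1)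
    then have "a + tcoeffs a v = a + tcoeffs a w" by (rule inj_onD[OF inj_on_ball _ ball[OF v] ball[OF w]])
    then have "F [tcoeffs a v] a = F [tcoeffs a w] a" by simp
    then show "v = w" using v w by (simp only: F1_tcoeffs IntD1)
  qed
  moreover have "N 0 = 0"
    using linear_0[OF bounded_linear.linear[OF bl]] linear_0[OF bounded_linear.linear[OF lin1[of a]]]
    by (simp add: N_def)
  moreover have "\<forall>u\<in>T a. G 1 0 [u] = 0"
    using linear_0[OF bounded_linear.linear[OF bl]] by (simp add: G_def)
  moreover have "mult_onorm (T a) 2 (G 2 v) \<le> ennreal Lp" for v
    unfolding mult_onorm_def
  proof (rule SUP_least)
    fix us assume us: "us \<in> {us. length us = 2 \<and> set us \<subseteq> T a \<inter> cball 0 1}"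
    then obtain x y where xy: "us = [x, y]" by (auto simp: length_Suc_conv numeral_2_eq_2)
    then have "norm (tcoeffs a x) \<le> 1" "norm (tcoeffs a y) \<le> 1"
      using us norm_tcoeffs_le[of a] order_trans by auto
    from second[OF this] show "ennreal (norm (G 2 v us)) \<le> ennreal Lp"
      by (simp add: G_def xy ennreal_leI)
  qed
  moreover have "mult_onorm (T a) i (G i v) \<le> ennreal (L i)" if i: "i \<in> {3..k}" for i v
    unfolding mult_onorm_def
  proof (rule SUP_least)
    fix us assume us: "us \<in> {us. length us = i \<and> set us \<subseteq> T a \<inter> cball 0 1}"
    then have "norm (tcoeffs a x) \<le> 1" if "x \<in> set us" for x
      using that norm_tcoeffs_le[of a x] by auto
    then have "\<forall>x\<in>set (map (tcoeffs a) us). norm x \<le> 1" by simp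
    with us i show "ennreal (norm (G i v us)) \<le> ennreal (L i)"
      using higher[of "map (tcoeffs a) us"] by (auto simp: G_def ennreal_leI)
  qed
  ultimately show ?thesis
    unfolding local_parametrization_def Let_def tangent_space_eq[OF a]
    by (intro exI[of _ "1 / (4 * Lp)"] exI[of _ N] exI[of _ G]) auto
qed

text \<open>Charts are restrictions of \<open>\<Phi>\<close> to balls of radius
  \<open>1 / (2 * Lp)\<close>: their inverses are 2-Lipschitz by \<open>dist_le_2_dist\<close>, and
  their images are relatively open by \<open>open_map\<close>.\<close>

lemma submanifold_M: "submanifold_C2 D d M"
  unfolding submanifold_C2_def
proof (intro conjI ballI M_subset)
  fix p assume "p \<in> M"
  then obtain a where a: "a \<in> Rn d" "p = \<Phi> a" by (auto simp: M_def)
  define r where "r = 1 / (2 * Lp)"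
  have r: "0 < r" using Lp_pos by (simp add: r_def)
  define W where "W = Rn d \<inter> ball a r"
  have inj: "inj_on \<Phi> W"
    using inj_on_ball[of a] by (rule inj_on_subset) (auto simp: W_def r_def)
  define \<psi> where "\<psi> = the_inv_into W \<Phi>"
  define G where "G i w us = F us w" for i :: nat and w us
  have W: "openin (top_of_set (Rn d)) W" unfolding W_def by (intro openin_open_Int) simp
  have "homeomorphism W (\<Phi> ` W) \<Phi> \<psi>"
  proof (rule homeomorphismI)
    show "continuous_on W \<Phi>" by (rule continuous_on_\<Phi>)
    show \<psi>: "\<psi> (\<Phi> w) = w" if "w \<in> W" for w
      using that inj by (simp add: \<psi>_def the_inv_into_f_f)
    show "continuous_on (\<Phi> ` W) \<psi>"
    proof (rule continuous_onI)
      fix x and e :: real assume x: "x \<in> \<Phi> ` W" and "0 < e"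
      then obtain w where w: "w \<in> W" "x = \<Phi> w" by auto
      have "dist (\<psi> x') (\<psi> x) \<le> e" if x': "x' \<in> \<Phi> ` W" and "dist x' x < e / 2" for x'
      proof -
        obtain w' where w': "w' \<in> W" "x' = \<Phi> w'" using x' by auto
        have "dist w' w \<le> 2 * dist (\<Phi> w') (\<Phi> w)"
          using w w' by (intro dist_le_2_dist[of _ _ a]) (auto simp: W_def r_def)
        then show ?thesis using that w w' \<psi> by simp
      qed
      with \<open>0 < e\<close> show "\<exists>d>0. \<forall>x'\<in>\<Phi> ` W. dist x' x < d \<longrightarrow> dist (\<psi> x') (\<psi> x) \<le> e"
        by (intro exI[of _ "e / 2"]) auto
    qed
    show "\<Phi> (\<psi> x) = x" if "x \<in> \<Phi> ` W" for x using that \<psi> by auto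
    show "\<psi> ` \<Phi> ` W \<subseteq> W" using \<psi> by auto
  qed simp
  moreover have "Ck_differentials 2 (Rn d) W \<Phi> G"
    unfolding Ck_differentials_def
  proof (intro conjI ballI allI impI)
    fix i us w assume "i < 2" "length us = i \<and> set us \<subseteq> Rn d"
    then have us: "length us < k" using k_ge by simp
    show "((\<lambda>y. G i y us) has_derivative (\<lambda>u. G (Suc i) w (orth_proj (Rn d) u # us))) (at w within W)"
      unfolding G_def orth_proj_Rn using F_trunc[OF us] deriv[OF us]
      by (simp add: has_derivative_at_withinI)
  next
    fix us assume us: "length us = 2 \<and> set us \<subseteq> Rn d"
    have "continuous_on W (F us)"
    proof (cases "k = 2")
      case True
      then show ?thesis using cont[of us] us continuous_on_subset by fastforce
    next
      case False
      then have "length us < k" using us k_ge by simp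
      then show ?thesis using deriv by (meson has_derivative_continuous continuous_at_imp_continuous_on)
    qed
    then show "continuous_on W (\<lambda>w. G 2 w us)" by (simp add: G_def)
  qed (simp add: G_def)
  moreover have "\<forall>w\<in>W. \<forall>u\<in>Rn d. G 1 w [u] = 0 \<longrightarrow> u = 0"
    using norm_F1_ge unfolding G_def by (metis norm_zero norm_le_zero_iff)
  moreover have "p \<in> \<Phi> ` W" using a r by (auto simp: W_def)
  ultimately show "\<exists>W \<phi> \<psi> F. openin (top_of_set (Rn d)) W \<and> openin (top_of_set M) (\<phi> ` W) \<and> p \<in> \<phi> ` W \<and>
        homeomorphism W (\<phi> ` W) \<phi> \<psi> \<and> Ck_differentials 2 (Rn d) W \<phi> F \<and>
        (\<forall>w\<in>W. \<forall>u\<in>Rn d. F 1 w [u] = 0 \<longrightarrow> u = 0)"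
    using W open_map[OF W] by (intro exI[of _ W] exI[of _ \<Phi>] exI[of _ \<psi>] exI[of _ G]) simp
qed

text \<open>With minimal reach 0 the reach condition is void, and this is what lets the two sheets
  come arbitrarily close.\<close>

lemma M_in_manifold_class: "M \<in> manifold_class D d k 0 Lp L"
  unfolding manifold_class_def
  using submanifold_M compact_M connected_M local_parametrization_M by (simp add: M_def)

end


section \<open>Hausdorff measure of parametrised surfaces\<close>

text \<open>The finite cover is padded with empty sets, which cost nothing because
  \<open>hausdorff_term\<close> treats them apart.\<close>

lemma hausdorff_pre_finite_cover:
  assumes "finite I" "A \<subseteq> (\<Union>i\<in>I. C i)" "0 \<le> \<delta>" "b \<le> \<delta>"
    and C: "\<And>i. i \<in> I \<Longrightarrow> bounded (C i)" "\<And>i. i \<in> I \<Longrightarrow> diameter (C i) \<le> b"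
  shows "hausdorff_pre d \<delta> A \<le> of_nat (card I) * ennreal (unit_ball_vol (real d) * (b / 2) ^ d)"
proof -
  obtain e where e: "bij_betw e {0..<card I} I"
    using ex_bij_betw_nat_finite[OF assms(1)] by blast
  define E where "E n = (if n < card I then C (e n) else {})" for n
  have eI: "e n \<in> I" if "n < card I" for n using e that by (auto simp: bij_betw_def)
  have "hausdorff_pre d \<delta> A \<le> (\<Sum>n. hausdorff_term d (E n))"
  proof (rule hausdorff_pre_leI)
    show "A \<subseteq> (\<Union>n. E n)"
    proof
      fix x assume "x \<in> A"
      then obtain i where i: "i \<in> I" "x \<in> C i" using assms(2) by blast
      then have "i \<in> e ` {0..<card I}" using e by (simp add: bij_betw_def)
      then obtain n where "n < card I" "i = e n" by auto
      with i show "x \<in> (\<Union>n. E n)" by (auto simp: E_def)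
    qed
    show "bounded (E n)" "diameter (E n) \<le> \<delta>" for n
      using C eI[of n] \<open>b \<le> \<delta>\<close> \<open>0 \<le> \<delta>\<close> by (auto simp: E_def intro: order_trans)
  qed
  also have "\<dots> = (\<Sum>n<card I. hausdorff_term d (E n))"
    by (rule suminf_finite) (auto simp: E_def)
  also have "\<dots> \<le> (\<Sum>n<card I. ennreal (unit_ball_vol (real d) * (b / 2) ^ d))"
  proof (rule sum_mono)
    fix n assume "n \<in> {..<card I}"
    then have "0 \<le> diameter (E n)" "diameter (E n) \<le> b"
      using C eI[of n] by (auto simp: E_def intro: diameter_ge_0)
    then show "hausdorff_term d (E n) \<le> ennreal (unit_ball_vol (real d) * (b / 2) ^ d)"
      by (auto intro!: ennreal_leI mult_left_mono power_mono)
  qed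
  finally show ?thesis by simp
qed

lemma dist_le_cbox_Rn:
  assumes "w \<in> cbox_Rn d l (\<lambda>_. s)" "w' \<in> cbox_Rn d l (\<lambda>_. s)"
  shows "dist w w' \<le> real d * s"
proof -
  have "w - w' \<in> Rn d" using assms by (auto simp: cbox_Rn_def intro: subspace_diff[OF subspace_Rn])
  then have "norm (w - w') \<le> (\<Sum>i<d. \<bar>coord (w - w') i\<bar>)" by (rule norm_le_sum_coord)
  also have "\<dots> \<le> (\<Sum>i<d. s)"
    using assms by (intro sum_mono) (auto simp: cbox_Rn_def abs_le_iff; smt (verit))
  finally show ?thesis by (simp add: dist_norm)
qed

text \<open>The box is cut into cubes of side \<open>s\<close>, whose images have diameter at most
  \<open>b = K * (d * s)\<close>. The number of cubes grows like \<open>(1 / s) ^ d\<close>, so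
  \<open>s\<close> cancels in the total.\<close>

lemma hausdorff_outer_image_cbox_le:
  fixes \<Phi> :: "rvec \<Rightarrow> rvec"
  assumes "1 \<le> d" "0 < K" and h: "\<And>j. j < d \<Longrightarrow> 0 < h j"
    and lip: "\<And>w w'. dist (\<Phi> w) (\<Phi> w') \<le> K * dist w w'"
  shows "hausdorff_outer d (\<Phi> ` cbox_Rn d l h) \<le>
    ennreal (unit_ball_vol (real d) * (K * d) ^ d * (\<Prod>j<d. h j))"
  unfolding hausdorff_outer_def
proof (rule SUP_least)
  fix \<delta> :: real assume "\<delta> \<in> {0<..}"
  then have \<delta>: "0 < \<delta>" by simp
  define s where "s = Min (insert (\<delta> / (K * d)) (h ` {..<d}))"
  have s: "0 < s" "s \<le> \<delta> / (K * d)" "\<And>j. j < d \<Longrightarrow> s \<le> h j"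
    using \<delta> h assms(1,2) by (auto simp: s_def)
  \<comment> \<open>The extra cube accommodates rounding and the closed right end; since
    \<open>s \<le> h j\<close>, the count is still at most \<open>2 * h j / s\<close>.\<close>
  define n where "n j = nat \<lfloor>h j / s\<rfloor> + 1" for j
  define I where "I = PiE {..<d} (\<lambda>j. {..<n j})"
  define C where "C f = \<Phi> ` cbox_Rn d (\<lambda>j. l j + real (f j) * s) (\<lambda>_. s)" for f :: "nat \<Rightarrow> nat"
  have finI: "finite I" by (auto simp: I_def intro: finite_PiE)
  have cov: "\<Phi> ` cbox_Rn d l h \<subseteq> (\<Union>f\<in>I. C f)"
  proof
    fix x assume "x \<in> \<Phi> ` cbox_Rn d l h"
    then obtain w where w: "w \<in> cbox_Rn d l h" "x = \<Phi> w" by auto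
    define f where "f = (\<lambda>j\<in>{..<d}. nat \<lfloor>(coord w j - l j) / s\<rfloor>)"
    have wj: "0 \<le> (coord w j - l j) / s" "(coord w j - l j) / s \<le> h j / s" if "j < d" for j
      using w that s(1) by (auto simp: cbox_Rn_def divide_right_mono)
    have "f \<in> I"
      using wj by (auto simp: I_def f_def n_def less_Suc_eq_le intro!: nat_mono floor_mono)
    moreover have "w \<in> cbox_Rn d (\<lambda>j. l j + real (f j) * s) (\<lambda>_. s)"
    proof -
      have "l j + real (f j) * s \<le> coord w j \<and> coord w j \<le> l j + real (f j) * s + s" if j: "j < d" for j
      proof -
        have "real (f j) \<le> (coord w j - l j) / s" "(coord w j - l j) / s \<le> real (f j) + 1"
          using wj[OF j] j unfolding f_def by (simp_all; linarith)+
        then show ?thesis using s(1) by (simp add: field_simps)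
      qed
      then show ?thesis using w by (auto simp: cbox_Rn_def)
    qed
    ultimately show "x \<in> (\<Union>f\<in>I. C f)" using w by (auto simp: C_def)
  qed
  define b where "b = K * (d * s)"
  have b: "0 \<le> b" "b \<le> \<delta>"
    using s assms(1,2) \<delta> by (auto simp: b_def field_simps)
  have dist: "dist x y \<le> b" if xy: "x \<in> C f" "y \<in> C f" for x y f
  proof -
    obtain w w' where w: "x = \<Phi> w" "y = \<Phi> w'" "w \<in> cbox_Rn d (\<lambda>j. l j + real (f j) * s) (\<lambda>_. s)"
      "w' \<in> cbox_Rn d (\<lambda>j. l j + real (f j) * s) (\<lambda>_. s)"
      using xy by (auto simp: C_def)
    have "dist x y \<le> K * dist w w'" using w lip by simp
    also have "\<dots> \<le> b"
      unfolding b_def using w \<open>0 < K\<close> by (intro mult_left_mono dist_le_cbox_Rn) auto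
    finally show ?thesis .
  qed
  have "bounded (C f)" for f
    using dist unfolding bounded_def by blast
  moreover have "diameter (C f) \<le> b" for f
    using dist b by (intro diameter_le) (auto simp: dist_norm)
  ultimately have "hausdorff_pre d \<delta> (\<Phi> ` cbox_Rn d l h) \<le>
      of_nat (card I) * ennreal (unit_ball_vol (real d) * (b / 2) ^ d)"
    using b \<delta> by (intro hausdorff_pre_finite_cover[OF finI cov]) auto
  also have "\<dots> = ennreal (real (card I) * (unit_ball_vol (real d) * (b / 2) ^ d))"
    by (subst ennreal_mult) (auto simp: ennreal_of_nat_eq_real_of_nat b)
  also have "\<dots> \<le> ennreal (unit_ball_vol (real d) * (K * d) ^ d * (\<Prod>j<d. h j))"
  proof (rule ennreal_leI)
    have "real (card I) = (\<Prod>j<d. real (n j))" by (simp add: I_def card_PiE)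
    also have "\<dots> \<le> (\<Prod>j<d. 2 * h j / s)"
    proof (rule prod_mono)
      fix j assume "j \<in> {..<d}"
      then have "1 \<le> h j / s" using s by (simp add: field_simps)
      then have "real (n j) \<le> h j / s + h j / s" unfolding n_def by simp linarith
      then show "0 \<le> real (n j) \<and> real (n j) \<le> 2 * h j / s" by simp
    qed
    also have "\<dots> = (\<Prod>j<d. h j) * (2 / s) ^ d"
      by (simp add: prod_dividef prod.distrib power_divide mult_ac)
    finally have "real (card I) * (unit_ball_vol (real d) * (b / 2) ^ d) \<le>
        (\<Prod>j<d. h j) * (2 / s) ^ d * (unit_ball_vol (real d) * (b / 2) ^ d)"
      using b by (intro mult_right_mono) auto
    also have "\<dots> = unit_ball_vol (real d) * ((2 / s) * (b / 2)) ^ d * (\<Prod>j<d. h j)"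
      by (simp only: power_mult_distrib) (simp add: mult_ac)
    also have "(2 / s) * (b / 2) = K * d" using s by (simp add: b_def)
    finally show "real (card I) * (unit_ball_vol (real d) * (b / 2) ^ d) \<le>
        unit_ball_vol (real d) * (K * d) ^ d * (\<Prod>j<d. h j)" .
  qed
  finally show "hausdorff_pre d \<delta> (\<Phi> ` cbox_Rn d l h) \<le>
      ennreal (unit_ball_vol (real d) * (K * d) ^ d * (\<Prod>j<d. h j))" .
qed

text \<open>A cover of the image induces a cover of the box by cubes, whose Lebesgue measures
  are comparable to the terms of the Hausdorff premeasure.\<close>

lemma hausdorff_outer_image_cbox_ge:
  fixes \<Phi> :: "rvec \<Rightarrow> rvec"
  assumes h: "\<And>j. j < d \<Longrightarrow> 0 \<le> h j"
    and lip: "\<And>w w'. w \<in> cbox_Rn d l h \<Longrightarrow> w' \<in> cbox_Rn d l h \<Longrightarrow> dist w w' \<le> 2 * dist (\<Phi> w) (\<Phi> w')"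
  shows "ennreal (unit_ball_vol (real d) / 8 ^ d * (\<Prod>j<d. h j)) \<le> hausdorff_outer d (\<Phi> ` cbox_Rn d l h)"
proof -
  let ?B = "cbox_Rn d l h" and ?\<omega> = "unit_ball_vol (real d)"
  interpret product_sigma_finite "\<lambda>_::nat. lborel :: real measure"
    by (simp add: product_sigma_finite_def sigma_finite_lborel)
  let ?P = "PiM {..<d} (\<lambda>_. lborel :: real measure)"
  have \<omega>: "0 < ?\<omega>" by simp
  then have \<omega>0: "?\<omega> \<noteq> 0" by (rule less_imp_neq[THEN not_sym])
  have "ennreal (?\<omega> / 8 ^ d * (\<Prod>j<d. h j)) \<le> hausdorff_pre d 1 (\<Phi> ` ?B)"
    unfolding hausdorff_pre_def
  proof (rule INF_greatest)
    fix C assume C: "C \<in> covers 1 (\<Phi> ` ?B)"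
    define X where "X i = {w \<in> ?B. \<Phi> w \<in> C i}" for i
    define c where "c i = (SOME w. w \<in> X i)" for i
    \<comment> \<open>All preimages of \<open>C i\<close> in the box lie within twice its diameter
      of one of them, \<open>c i\<close>. The resulting cube has side
      \<open>4 * diameter = 8 * (diameter / 2)\<close>, the source of the factor
      \<open>8 ^ d\<close>.\<close>
    define Q where "Q i = (if X i = {} then {} else
       PiE {..<d} (\<lambda>j. {coord (c i) j - 2 * diameter (C i) .. coord (c i) j + 2 * diameter (C i)}))" for i
    have c: "c i \<in> X i" if "X i \<noteq> {}" for i using that by (auto simp: c_def intro: someI)
    have Qsets: "Q i \<in> sets ?P" for i
      unfolding Q_def by (auto intro!: sets_PiM_I_finite)
    have "(\<Prod>j<d. ennreal (h j)) = (\<Prod>j<d. emeasure lborel {l j..l j + h j})"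
      using h by (intro prod.cong) auto
    also have "\<dots> = emeasure ?P (PiE {..<d} (\<lambda>j. {l j..l j + h j}))"
      by (rule emeasure_PiM[symmetric]) auto
    also have "\<dots> \<le> emeasure ?P (\<Union>i. Q i)"
    proof (rule emeasure_mono)
      show "(\<Union>i. Q i) \<in> sets ?P" using Qsets by blast
      show "PiE {..<d} (\<lambda>j. {l j..l j + h j}) \<subseteq> (\<Union>i. Q i)"
      proof
        fix f assume f: "f \<in> PiE {..<d} (\<lambda>j. {l j..l j + h j})"
        define w where "w = rvec_of d f"
        have w: "w \<in> ?B" using f by (auto simp: w_def cbox_Rn_def PiE_iff)
        then obtain i where i: "\<Phi> w \<in> C i" using C by blast
        then have wX: "w \<in> X i" using w by (simp add: X_def)
        then have cX: "c i \<in> X i" using c by blast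
        have "dist w (c i) \<le> 2 * dist (\<Phi> w) (\<Phi> (c i))"
          using lip w cX by (simp add: X_def)
        also have "dist (\<Phi> w) (\<Phi> (c i)) \<le> diameter (C i)"
          using i cX C by (intro diameter_bounded_bound) (auto simp: X_def)
        finally have "\<bar>coord (w - c i) j\<bar> \<le> 2 * diameter (C i)" for j
          using abs_coord_le_norm[of "w - c i" j] by (simp add: dist_norm)
        then have "f \<in> Q i"
          using wX f by (auto simp: Q_def PiE_iff w_def abs_le_iff) (smt (verit))+
        then show "f \<in> (\<Union>i. Q i)" by blast
      qed
    qed
    also have "\<dots> \<le> (\<Sum>i. emeasure ?P (Q i))"
      using Qsets by (intro emeasure_subadditive_countably) auto
    also have "\<dots> \<le> (\<Sum>i. ennreal (8 ^ d / ?\<omega>) * hausdorff_term d (C i))"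
    proof (intro suminf_le summableI)
      fix i
      show "emeasure ?P (Q i) \<le> ennreal (8 ^ d / ?\<omega>) * hausdorff_term d (C i)"
      proof (cases "X i = {}")
        case False
        then have "C i \<noteq> {}" by (auto simp: X_def)
        have D: "0 \<le> diameter (C i)" using C by (auto intro: diameter_ge_0)
        have "emeasure ?P (Q i) = (\<Prod>j<d. emeasure lborel
            {coord (c i) j - 2 * diameter (C i) .. coord (c i) j + 2 * diameter (C i)})"
          using False by (simp add: Q_def emeasure_PiM)
        also have "\<dots> = ennreal ((4 * diameter (C i)) ^ d)"
          using D by (simp add: ennreal_power)
        also have "(4 * diameter (C i)) ^ d = 8 ^ d * (diameter (C i) / 2) ^ d"
          by (subst power_mult_distrib[symmetric]) simp
        also have "\<dots> = 8 ^ d / ?\<omega> * (?\<omega> * (diameter (C i) / 2) ^ d)"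
          using \<omega>0 by simp
        also have "ennreal \<dots> = ennreal (8 ^ d / ?\<omega>) * hausdorff_term d (C i)"
          using D \<omega> \<open>C i \<noteq> {}\<close> by (subst ennreal_mult) auto
        finally show ?thesis by simp
      qed (simp add: Q_def)
    qed
    also have "\<dots> = ennreal (8 ^ d / ?\<omega>) * (\<Sum>i. hausdorff_term d (C i))"
      by (rule ennreal_suminf_cmult)
    finally have "ennreal (?\<omega> / 8 ^ d) * (\<Prod>j<d. ennreal (h j)) \<le>
        ennreal (?\<omega> / 8 ^ d) * (ennreal (8 ^ d / ?\<omega>) * (\<Sum>i. hausdorff_term d (C i)))"
      by (intro mult_left_mono) auto
    also have "\<dots> = (\<Sum>i. hausdorff_term d (C i))"
      using \<omega> \<omega>0 by (simp add: mult.assoc[symmetric] ennreal_mult[symmetric] del: ennreal_1) simp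
    finally have le: "ennreal (?\<omega> / 8 ^ d) * (\<Prod>j<d. ennreal (h j)) \<le> (\<Sum>i. hausdorff_term d (C i))" .
    have "ennreal (?\<omega> / 8 ^ d) * (\<Prod>j<d. ennreal (h j)) = ennreal (?\<omega> / 8 ^ d * (\<Prod>j<d. h j))"
    proof -
      have "(\<Prod>j<d. ennreal (h j)) = ennreal (\<Prod>j<d. h j)" using h by (intro prod_ennreal) auto
      then show ?thesis using h \<omega> by (subst ennreal_mult) (auto intro: prod_nonneg)
    qed
    with le show "ennreal (?\<omega> / 8 ^ d * (\<Prod>j<d. h j)) \<le> (\<Sum>i. hausdorff_term d (C i))" by simp
  qed
  also have "\<dots> \<le> hausdorff_outer d (\<Phi> ` ?B)"
    by (rule hausdorff_pre_le_outer) simp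
  finally show ?thesis .
qed

context torus_immersion
begin

lemma lipschitz:
  assumes "0 \<le> K" "\<And>u w. norm (F [u] w) \<le> K * norm u"
  shows "dist (\<Phi> w) (\<Phi> w') \<le> K * dist w w'"
  unfolding dist_norm
proof (rule differentiable_bound[of UNIV])
  show "onorm (\<lambda>u. F [u] x) \<le> K" for x using assms by (intro onorm_bound) auto
qed (use deriv0 in auto)

text \<open>A cube of side \<open>r / d\<close> with lower corner \<open>a\<close> fits into the
  ball, and there the inverse of \<open>\<Phi>\<close> is 2-Lipschitz.\<close>

lemma hausdorff_outer_ball_ge:
  assumes a: "a \<in> Rn d" and r: "0 < r" "r \<le> 1 / (2 * Lp)"
  shows "ennreal (unit_ball_vol (real d) / 8 ^ d * (r / real d) ^ d) \<le>
    hausdorff_outer d (\<Phi> ` (Rn d \<inter> cball a r))"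
proof -
  let ?B = "cbox_Rn d (coord a) (\<lambda>_. r / real d)"
  have aB: "a \<in> ?B" using a r by (simp add: cbox_Rn_def)
  have sub: "?B \<subseteq> Rn d \<inter> cball a r"
  proof
    fix w assume "w \<in> ?B"
    with aB have "dist a w \<le> real d * (r / real d)" by (rule dist_le_cbox_Rn)
    then show "w \<in> Rn d \<inter> cball a r" using \<open>w \<in> ?B\<close> d_pos by (simp add: cbox_Rn_def)
  qed
  have "ennreal (unit_ball_vol (real d) / 8 ^ d * (\<Prod>j<d. r / real d)) \<le> hausdorff_outer d (\<Phi> ` ?B)"
  proof (rule hausdorff_outer_image_cbox_ge)
    fix w w' assume "w \<in> ?B" "w' \<in> ?B"
    then show "dist w w' \<le> 2 * dist (\<Phi> w) (\<Phi> w')"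
      using sub r by (intro dist_le_2_dist[of _ _ a]) auto
  qed (use r in auto)
  also have "\<dots> \<le> hausdorff_outer d (\<Phi> ` (Rn d \<inter> cball a r))"
    using sub by (intro hausdorff_outer_mono image_mono)
  finally show ?thesis by simp
qed

lemma hausdorff_outer_M_ge:
  "ennreal (unit_ball_vol (real d) / 8 ^ d * (1 / (2 * Lp * real d)) ^ d) \<le> hausdorff_outer d M"
proof -
  have "ennreal (unit_ball_vol (real d) / 8 ^ d * (1 / (2 * Lp) / real d) ^ d) \<le>
    hausdorff_outer d (\<Phi> ` (Rn d \<inter> cball 0 (1 / (2 * Lp))))"
    using Lp_pos by (intro hausdorff_outer_ball_ge) (auto simp: subspace_0[OF subspace_Rn])
  also have "\<dots> \<le> hausdorff_outer d M" by (rule hausdorff_outer_mono) (auto simp: M_def)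
  finally show ?thesis by simp
qed

text \<open>This makes the support of the uniform law all of \<open>M\<close>.\<close>

lemma hausdorff_outer_M_open_pos:
  assumes "open U" "p \<in> M" "p \<in> U"
  shows "0 < hausdorff_outer d (M \<inter> U)"
proof -
  obtain a where a: "a \<in> Rn d" "p = \<Phi> a" using assms by (auto simp: M_def)
  have "open (\<Phi> -` U)" using continuous_on_\<Phi>[of UNIV] assms(1) by (simp add: continuous_on_open_vimage)
  then obtain e where e: "0 < e" "cball a e \<subseteq> \<Phi> -` U"
    using a assms(3) open_contains_cball[of "\<Phi> -` U"] by (metis vimageI)
  define r where "r = min e (1 / (2 * Lp))"
  have r: "0 < r" "r \<le> 1 / (2 * Lp)" "r \<le> e" using e Lp_pos by (auto simp: r_def)
  have "0 < ennreal (unit_ball_vol (real d) / 8 ^ d * (r / real d) ^ d)"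
    using r d_pos by simp
  also have "\<dots> \<le> hausdorff_outer d (\<Phi> ` (Rn d \<inter> cball a r))"
    by (rule hausdorff_outer_ball_ge) (use a r in auto)
  also have "\<dots> \<le> hausdorff_outer d (M \<inter> U)"
    using e r by (intro hausdorff_outer_mono) (auto simp: M_def subset_iff)
  finally show ?thesis .
qed

end


section \<open>The two-point method for uniform distributions\<close>

definition uniform_law :: "nat \<Rightarrow> nat \<Rightarrow> rvec set \<Rightarrow> rvec measure" where
  "uniform_law d D S = density (restrict_space (hausdorff_measure d) (Rn D))
     (\<lambda>y. ennreal (1 / enn2real (hausdorff_outer d S)) * indicator S y)"

lemma borel_Rn_D [simp]: "Rn D \<in> sets borel"
  using closed_Rn by (rule borel_closed)

lemma sets_uniform_law: "sets (uniform_law d D S) = sets (borel_Rn D)"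
  by (simp add: uniform_law_def borel_Rn_def sets_restrict_space)

lemma space_uniform_law: "space (uniform_law d D S) = Rn D"
  by (simp add: uniform_law_def space_restrict_space)

lemma sets_borel_Rn: "A \<in> sets (borel_Rn D) \<longleftrightarrow> A \<in> sets borel \<and> A \<subseteq> Rn D"
  unfolding borel_Rn_def by (subst sets_restrict_space_iff) auto

lemma emeasure_uniform_law:
  assumes A: "A \<in> sets borel" "A \<subseteq> Rn D" and S: "S \<in> sets borel"
  shows "emeasure (uniform_law d D S) A = ennreal (1 / enn2real (hausdorff_outer d S)) * hausdorff_outer d (A \<inter> S)"
proof -
  let ?R = "restrict_space (hausdorff_measure d) (Rn D)" and ?c = "ennreal (1 / enn2real (hausdorff_outer d S))"
  have A': "A \<in> sets ?R" using A by (auto simp: sets_restrict_space_iff)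
  have S': "S \<inter> Rn D \<in> sets ?R" using S by (auto simp: sets_restrict_space_iff)
  have ind: "(indicator S :: _ \<Rightarrow> ennreal) \<in> borel_measurable ?R"
    using S by (intro measurable_restrict_space1) (simp add: measurable_cong_sets[OF sets_hausdorff_measure refl])
  have "emeasure (uniform_law d D S) A = (\<integral>\<^sup>+ y. ?c * indicator S y * indicator A y \<partial>?R)"
    unfolding uniform_law_def by (intro emeasure_density borel_measurable_times_ennreal borel_measurable_const ind A')
  also have "\<dots> = (\<integral>\<^sup>+ y. ?c * indicator (A \<inter> S) y \<partial>?R)"
    by (intro nn_integral_cong) (auto split: split_indicator)
  also have "\<dots> = ?c * emeasure ?R (A \<inter> S)"
    using A S by (intro nn_integral_cmult_indicator) (auto simp: sets_restrict_space_iff)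
  also have "emeasure ?R (A \<inter> S) = hausdorff_outer d (A \<inter> S)"
    using A S by (subst emeasure_restrict_space) (auto simp: emeasure_hausdorff_measure)
  finally show ?thesis .
qed

lemma prob_space_uniform_law:
  assumes "S \<in> sets borel" "S \<subseteq> Rn D" "0 < hausdorff_outer d S" "hausdorff_outer d S < \<infinity>"
  shows "prob_space (uniform_law d D S)"
proof
  obtain m where m: "hausdorff_outer d S = ennreal m" "0 < m"
    using assms(3,4) by (cases "hausdorff_outer d S") (auto simp: less_top)
  have "Rn D \<inter> S = S" using assms by auto
  then show "emeasure (uniform_law d D S) (space (uniform_law d D S)) = 1"
    using assms m by (simp add: space_uniform_law emeasure_uniform_law ennreal_mult[symmetric])
qed

lemma support_uniform_law:
  assumes "compact S" "S \<subseteq> Rn D" "hausdorff_outer d S < \<infinity>"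
    and pos: "\<And>U p. open U \<Longrightarrow> p \<in> S \<Longrightarrow> p \<in> U \<Longrightarrow> 0 < hausdorff_outer d (S \<inter> U)"
  shows "support (uniform_law d D S) = S"
proof (intro equalityI subsetI)
  have Sb: "S \<in> sets borel" using assms by (intro borel_compact)
  fix p assume p: "p \<in> support (uniform_law d D S)"
  show "p \<in> S"
  proof (rule ccontr)
    assume "p \<notin> S"
    moreover have "open (- S)" using assms(1) compact_imp_closed by blast
    ultimately have "0 < emeasure (uniform_law d D S) (- S \<inter> Rn D)"
      using p by (auto simp: support_def space_uniform_law)
    also have "\<dots> = 0"
    proof -
      have "- S \<inter> Rn D \<inter> S = {}" by auto
      then show ?thesis using Sb by (subst emeasure_uniform_law) auto
    qed
    finally show False by simp
  qed
next
  have Sb: "S \<in> sets borel" using assms by (intro borel_compact)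
  fix p assume p: "p \<in> S"
  have "0 < emeasure (uniform_law d D S) (U \<inter> Rn D)" if U: "open U" "p \<in> U" for U
  proof -
    have "0 < hausdorff_outer d S" using pos[of UNIV p] p by simp
    then have "0 < 1 / enn2real (hausdorff_outer d S)"
      using assms(3) by (simp add: enn2real_positive_iff)
    moreover have "U \<inter> Rn D \<inter> S = S \<inter> U" using assms(2) by auto
    ultimately show ?thesis
      using U pos[OF U(1) p U(2)] Sb
      by (subst emeasure_uniform_law) (auto simp: ennreal_zero_less_mult_iff)
  qed
  then show "p \<in> support (uniform_law d D S)"
    using p assms(2) by (auto simp: support_def space_uniform_law)
qed

lemma uniform_law_in_model_at:
  assumes S: "S \<in> manifold_class D d k \<tau> Lp L" "hausdorff_outer d S < \<infinity>"
    and pos: "\<And>U p. open U \<Longrightarrow> p \<in> S \<Longrightarrow> p \<in> U \<Longrightarrow> 0 < hausdorff_outer d (S \<inter> U)"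
    and x: "x \<in> S"
    and f: "fmin \<le> 1 / enn2real (hausdorff_outer d S)" "1 / enn2real (hausdorff_outer d S) \<le> fmax"
  shows "uniform_law d D S \<in> model_at D d k \<tau> Lp L fmin fmax x"
proof -
  have cS: "compact S" "S \<subseteq> Rn D" using S by (auto simp: manifold_class_def submanifold_C2_def)
  have supp: "support (uniform_law d D S) = S"
    by (rule support_uniform_law) (use cS S pos in auto)
  have "prob_space (uniform_law d D S)"
    using cS S(2) pos[of UNIV x] x by (intro prob_space_uniform_law) (auto intro: borel_compact)
  then show ?thesis
    unfolding model_at_def model_def using S(1) supp x f
    by (auto intro!: bexI[of _ "\<lambda>_. 1 / enn2real (hausdorff_outer d S)"] simp: uniform_law_def)
qed

text \<open>The law of the sample conditioned on all observations lying in \<open>Z\<close> is the sample law of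
  the uniform distribution on \<open>Z\<close>, whichever of the two supports containing \<open>Z\<close> one starts from.\<close>

lemma sample_law_ge:
  assumes S: "S \<in> sets borel" "S \<subseteq> Rn D" "hausdorff_outer d S = ennreal m" "0 < m"
    and Z: "Z \<in> sets borel" "Z \<subseteq> S" "hausdorff_outer d Z = ennreal z" "0 < z"
    and f: "f \<in> borel_measurable (sample_space D n)"
  shows "ennreal ((z / m) ^ n) * (\<integral>\<^sup>+ \<omega>. f \<omega> \<partial>(sample_law (uniform_law d D Z) n)) \<le>
    (\<integral>\<^sup>+ \<omega>. f \<omega> \<partial>(sample_law (uniform_law d D S) n))"
proof -
  let ?P = "uniform_law d D S" and ?Q = "uniform_law d D Z"
  interpret P: prob_space ?P by (rule prob_space_uniform_law) (use S in auto)
  interpret Q: prob_space ?Q by (rule prob_space_uniform_law) (use S Z in auto)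
  interpret PP: product_sigma_finite "\<lambda>_::nat. ?P"
    by (simp add: product_sigma_finite_def P.sigma_finite_measure_axioms)
  interpret QQ: product_sigma_finite "\<lambda>_::nat. ?Q"
    by (simp add: product_sigma_finite_def Q.sigma_finite_measure_axioms)
  let ?B = "PiE {..<n} (\<lambda>_. Z)"
  \<comment> \<open>The density of the conditioned law: the event that all observations lie in
    \<open>Z\<close> has probability \<open>(z / m) ^ n\<close>.\<close>
  define g where "g \<omega> = ennreal ((m / z) ^ n) * indicator ?B \<omega>" for \<omega> :: "nat \<Rightarrow> rvec"
  have sP: "sets (sample_law ?P n) = sets (sample_space D n)"
    by (intro sets_PiM_cong sets_uniform_law refl)
  have sQ: "sets (sample_law ?Q n) = sets (sample_space D n)"
    by (intro sets_PiM_cong sets_uniform_law refl)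
  have Bs: "?B \<in> sets (sample_law ?P n)"
    using S Z by (intro sets_PiM_I_finite) (auto simp: sets_uniform_law sets_borel_Rn)
  have g: "g \<in> borel_measurable (sample_law ?P n)"
    unfolding g_def using Bs by measurable
  have fP: "f \<in> borel_measurable (sample_law ?P n)"
    using f by (simp add: measurable_cong_sets[OF sP refl])
  have "density (sample_law ?P n) g = sample_law ?Q n"
  proof (rule QQ.PiM_eqI)
    show "sets (density (sample_law ?P n) g) = sets (sample_law ?Q n)" by (simp add: sP sQ)
    fix A assume A: "\<And>i. i \<in> {..<n} \<Longrightarrow> A i \<in> sets ?Q"
    then have A': "A i \<in> sets borel \<and> A i \<subseteq> Rn D" if "i < n" for i
      using that by (auto simp: sets_uniform_law sets_borel_Rn)
    have As: "PiE {..<n} A \<in> sets (sample_law ?P n)"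
      using A by (intro sets_PiM_I_finite) (auto simp: sets_uniform_law)
    have "emeasure (density (sample_law ?P n) g) (PiE {..<n} A) =
        (\<integral>\<^sup>+ \<omega>. g \<omega> * indicator (PiE {..<n} A) \<omega> \<partial>(sample_law ?P n))"
      using g As by (rule emeasure_density)
    also have "\<dots> = (\<integral>\<^sup>+ \<omega>. ennreal ((m / z) ^ n) * indicator (PiE {..<n} (\<lambda>i. A i \<inter> Z)) \<omega> \<partial>(sample_law ?P n))"
      by (intro nn_integral_cong) (auto simp: g_def split: split_indicator)
    also have "\<dots> = ennreal ((m / z) ^ n) * emeasure (sample_law ?P n) (PiE {..<n} (\<lambda>i. A i \<inter> Z))"
      using A' S Z by (intro nn_integral_cmult_indicator sets_PiM_I_finite)
        (auto simp: sets_uniform_law sets_borel_Rn)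
    also have "emeasure (sample_law ?P n) (PiE {..<n} (\<lambda>i. A i \<inter> Z)) = (\<Prod>i<n. emeasure ?P (A i \<inter> Z))"
      using A' S Z by (intro PP.emeasure_PiM) (auto simp: sets_uniform_law sets_borel_Rn)
    also have "ennreal ((m / z) ^ n) * \<dots> = (\<Prod>i<n. ennreal (m / z) * emeasure ?P (A i \<inter> Z))"
      using S Z by (simp add: prod.distrib ennreal_power)
    also have "\<dots> = (\<Prod>i<n. emeasure ?Q (A i))"
    proof (rule prod.cong[OF refl])
      fix i assume "i \<in> {..<n}"
      then have Ai: "A i \<in> sets borel" "A i \<subseteq> Rn D" using A' by auto
      have "A i \<inter> Z \<inter> S = A i \<inter> Z" using Z by auto
      then have "ennreal (m / z) * emeasure ?P (A i \<inter> Z) =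
          ennreal (m / z) * (ennreal (1 / m) * hausdorff_outer d (A i \<inter> Z))"
        using Ai S Z by (subst emeasure_uniform_law) auto
      also have "\<dots> = ennreal (1 / z) * hausdorff_outer d (A i \<inter> Z)"
        using S Z by (simp add: mult.assoc[symmetric] ennreal_mult[symmetric])
      also have "\<dots> = emeasure ?Q (A i)"
        using Ai Z by (subst emeasure_uniform_law) auto
      finally show "ennreal (m / z) * emeasure ?P (A i \<inter> Z) = emeasure ?Q (A i)" .
    qed
    finally show "emeasure (density (sample_law ?P n) g) (PiE {..<n} A) = (\<Prod>i<n. emeasure ?Q (A i))" .
  qed simp
  then have "(\<integral>\<^sup>+ \<omega>. f \<omega> \<partial>(sample_law ?Q n)) = (\<integral>\<^sup>+ \<omega>. g \<omega> * f \<omega> \<partial>(sample_law ?P n))"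
    using nn_integral_density[OF g fP] by simp
  also have "\<dots> \<le> (\<integral>\<^sup>+ \<omega>. ennreal ((m / z) ^ n) * f \<omega> \<partial>(sample_law ?P n))"
    by (intro nn_integral_mono mult_right_mono) (auto simp: g_def split: split_indicator)
  also have "\<dots> = ennreal ((m / z) ^ n) * (\<integral>\<^sup>+ \<omega>. f \<omega> \<partial>(sample_law ?P n))"
    by (rule nn_integral_cmult[OF fP])
  finally have "ennreal ((z / m) ^ n) * (\<integral>\<^sup>+ \<omega>. f \<omega> \<partial>(sample_law ?Q n)) \<le>
      ennreal ((z / m) ^ n) * (ennreal ((m / z) ^ n) * (\<integral>\<^sup>+ \<omega>. f \<omega> \<partial>(sample_law ?P n)))"
    by (rule mult_left_mono) simp
  also have "\<dots> = (\<integral>\<^sup>+ \<omega>. f \<omega> \<partial>(sample_law ?P n))"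
  proof -
    have "(z / m) ^ n * (m / z) ^ n = 1"
      using S Z by (simp add: power_mult_distrib[symmetric])
    then have "ennreal ((z / m) ^ n) * ennreal ((m / z) ^ n) = 1"
      using S Z by (subst ennreal_mult[symmetric]) auto
    then show ?thesis by (simp add: mult.assoc[symmetric])
  qed
  finally show ?thesis .
qed

text \<open>Both sample laws dominate a multiple of the same law, that of a sample from the uniform
  law on \<open>S0 \<inter> S1\<close>. Under it the triangle inequality bounds the sum of the two
  losses below by the distance of the targets. The losses enter only through their measurable lower
  bounds in terms of \<open>g\<close>.\<close>

lemma two_point_bound:
  fixes g :: "(nat \<Rightarrow> rvec) \<Rightarrow> rvec"
  assumes S: "compact S0" "compact S1" "S0 \<subseteq> Rn D" "S1 \<subseteq> Rn D"
    and fin: "hausdorff_outer d S0 < \<infinity>" "hausdorff_outer d S1 < \<infinity>"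
    and h0: "0 < \<eta>" "\<eta> < h0" "ennreal h0 \<le> hausdorff_outer d S0" "ennreal h0 \<le> hausdorff_outer d S1"
    and diff: "hausdorff_outer d (S0 - S1) \<le> ennreal \<eta>" "hausdorff_outer d (S1 - S0) \<le> ennreal \<eta>"
    and g: "g \<in> sample_space D n \<rightarrow>\<^sub>M borel"
    and l: "\<And>\<omega>. \<omega> \<in> space (sample_space D n) \<Longrightarrow> ennreal (norm (y0 - g \<omega>)) \<le> l0 \<omega>"
           "\<And>\<omega>. \<omega> \<in> space (sample_space D n) \<Longrightarrow> ennreal (norm (y1 - g \<omega>)) \<le> l1 \<omega>"
  shows "ennreal ((1 - \<eta> / h0) ^ n * norm (y0 - y1)) \<le>
    (\<integral>\<^sup>+ \<omega>. l0 \<omega> \<partial>(sample_law (uniform_law d D S0) n)) + (\<integral>\<^sup>+ \<omega>. l1 \<omega> \<partial>(sample_law (uniform_law d D S1) n))"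
proof -
  define Z where "Z = S0 \<inter> S1"
  have b: "S0 \<in> sets borel" "S1 \<in> sets borel" "Z \<in> sets borel"
    using S by (auto simp: Z_def intro!: borel_compact compact_Int)
  have Zsub: "Z \<subseteq> S0" "Z \<subseteq> S1" "Z \<subseteq> Rn D" using S by (auto simp: Z_def)
  obtain m0 where m0: "hausdorff_outer d S0 = ennreal m0" "0 \<le> m0"
    using fin by (cases "hausdorff_outer d S0") auto
  obtain m1 where m1: "hausdorff_outer d S1 = ennreal m1" "0 \<le> m1"
    using fin by (cases "hausdorff_outer d S1") auto
  have "hausdorff_outer d Z \<le> hausdorff_outer d S0" by (intro hausdorff_outer_mono Zsub)
  then obtain z where z: "hausdorff_outer d Z = ennreal z" "0 \<le> z"
    using fin by (cases "hausdorff_outer d Z") (auto simp: top_unique)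
  have mh: "h0 \<le> m0" "h0 \<le> m1" using h0 m0 m1 by (auto simp: ennreal_le_iff)
  \<comment> \<open>Since \<open>h0\<close> bounds both volumes from below, the common part has
    relative mass at least \<open>1 - \<eta> / h0\<close> in either support.\<close>
  have zm: "m - \<eta> \<le> z" "(1 - \<eta> / h0) ^ n \<le> (z / m) ^ n" "0 < z" "0 < m"
    if "hausdorff_outer d T = ennreal m" "0 \<le> m" "hausdorff_outer d (T - Z) \<le> ennreal \<eta>" "h0 \<le> m" for T m
  proof -
    have "ennreal m \<le> hausdorff_outer d (Z \<union> (T - Z))"
      unfolding that(1)[symmetric] by (rule hausdorff_outer_mono) auto
    also have "\<dots> \<le> hausdorff_outer d Z + hausdorff_outer d (T - Z)" by (rule hausdorff_outer_Un_le)
    also have "\<dots> \<le> ennreal z + ennreal \<eta>" using that z by (intro add_mono) auto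
    finally show mz: "m - \<eta> \<le> z" using z h0 by (simp add: ennreal_plus[symmetric] del: ennreal_plus)
    then show "0 < z" "0 < m" using that h0 by auto
    have "1 - \<eta> / h0 \<le> 1 - \<eta> / m" using that h0 by (auto intro: divide_left_mono)
    also have "\<dots> \<le> z / m" using mz \<open>0 < m\<close> divide_right_mono[of "m - \<eta>" z m] by (simp add: diff_divide_distrib)
    finally show "(1 - \<eta> / h0) ^ n \<le> (z / m) ^ n" using h0 by (intro power_mono) auto
  qed
  have z0: "(1 - \<eta> / h0) ^ n \<le> (z / m0) ^ n" "0 < z" "0 < m0"
    using zm[OF m0 _ mh(1)] diff(1) by (simp_all add: Z_def Diff_Int)
  have z1: "(1 - \<eta> / h0) ^ n \<le> (z / m1) ^ n" "0 < m1"
    using zm[OF m1 _ mh(2)] diff(2) by (simp_all add: Z_def Diff_Int)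
  let ?Q = "sample_law (uniform_law d D Z) n"
  interpret Q1: prob_space "uniform_law d D Z"
    by (rule prob_space_uniform_law) (use b Zsub z z0 in auto)
  interpret Q: prob_space ?Q
    by (intro prob_space_PiM) (rule Q1.prob_space_axioms)
  define f where "f y \<omega> = ennreal (norm (y - g \<omega>))" for y :: rvec and \<omega>
  have fm: "f y \<in> borel_measurable (sample_space D n)" for y :: rvec
  proof -
    have "(\<lambda>v :: rvec. ennreal (norm (y - v))) \<in> borel_measurable borel"
      by (intro borel_measurable_continuous_onI continuous_intros continuous_on_ennreal)
    from measurable_compose[OF g this] show ?thesis by (simp add: f_def[abs_def])
  qed
  have sQ: "sets ?Q = sets (sample_space D n)"
    by (intro sets_PiM_cong sets_uniform_law refl)
  have fQ: "f y \<in> borel_measurable ?Q" for y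
    using fm by (simp add: measurable_cong_sets[OF sQ refl])
  let ?\<kappa> = "ennreal ((1 - \<eta> / h0) ^ n)"
  have lower: "?\<kappa> * (\<integral>\<^sup>+ \<omega>. f y \<omega> \<partial>?Q) \<le> (\<integral>\<^sup>+ \<omega>. l \<omega> \<partial>(sample_law (uniform_law d D T) n))"
    if T: "T \<in> sets borel" "T \<subseteq> Rn D" "hausdorff_outer d T = ennreal m" "0 < m" "Z \<subseteq> T"
      "(1 - \<eta> / h0) ^ n \<le> (z / m) ^ n" "\<And>\<omega>. \<omega> \<in> space (sample_space D n) \<Longrightarrow> f y \<omega> \<le> l \<omega>" for T m y l
  proof -
    have "?\<kappa> * (\<integral>\<^sup>+ \<omega>. f y \<omega> \<partial>?Q) \<le> ennreal ((z / m) ^ n) * (\<integral>\<^sup>+ \<omega>. f y \<omega> \<partial>?Q)"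
      by (intro mult_right_mono ennreal_leI T) simp
    also have "\<dots> \<le> (\<integral>\<^sup>+ \<omega>. f y \<omega> \<partial>(sample_law (uniform_law d D T) n))"
      by (rule sample_law_ge) (use T b z z0 fm in auto)
    also have "\<dots> \<le> (\<integral>\<^sup>+ \<omega>. l \<omega> \<partial>(sample_law (uniform_law d D T) n))"
    proof (intro nn_integral_mono T)
      fix \<omega> assume "\<omega> \<in> space (sample_law (uniform_law d D T) n)"
      then show "\<omega> \<in> space (sample_space D n)"
        using sets_eq_imp_space_eq[of "sample_law (uniform_law d D T) n" "sample_space D n"]
        by (simp cong: sets_PiM_cong add: sets_uniform_law)
    qed
    finally show ?thesis .
  qed
  have "ennreal ((1 - \<eta> / h0) ^ n * norm (y0 - y1)) = ?\<kappa> * (\<integral>\<^sup>+ \<omega>. ennreal (norm (y0 - y1)) \<partial>?Q)"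
    using h0 by (simp add: Q.emeasure_space_1 ennreal_mult)
  also have "\<dots> \<le> ?\<kappa> * (\<integral>\<^sup>+ \<omega>. f y0 \<omega> + f y1 \<omega> \<partial>?Q)"
  proof (intro mult_left_mono nn_integral_mono)
    fix \<omega>
    have "norm (y0 - y1) \<le> norm (y0 - g \<omega>) + norm (y1 - g \<omega>)"
      by (metis dist_norm dist_triangle2)
    then show "ennreal (norm (y0 - y1)) \<le> f y0 \<omega> + f y1 \<omega>"
      unfolding f_def ennreal_plus[OF norm_ge_zero norm_ge_zero, symmetric] by (rule ennreal_leI)
  qed simp
  also have "\<dots> = ?\<kappa> * (\<integral>\<^sup>+ \<omega>. f y0 \<omega> \<partial>?Q) + ?\<kappa> * (\<integral>\<^sup>+ \<omega>. f y1 \<omega> \<partial>?Q)"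
    by (subst nn_integral_add[OF fQ fQ]) (rule distrib_left)
  also have "\<dots> \<le> (\<integral>\<^sup>+ \<omega>. l0 \<omega> \<partial>(sample_law (uniform_law d D S0) n)) + (\<integral>\<^sup>+ \<omega>. l1 \<omega> \<partial>(sample_law (uniform_law d D S1) n))"
    using l by (intro add_mono lower[OF b(1) S(3) m0(1) z0(3) Zsub(1) z0(1)]
        lower[OF b(2) S(4) m1(1) z1(2) Zsub(2) z1(1)]) (simp_all add: f_def)
  finally show ?thesis .
qed

text \<open>For a fixed sample size the factor \<open>(1 - \<eta> / h0) ^ n\<close> tends to 1 as
  \<open>\<eta>\<close> tends to 0, and the larger of two risks is at least half of their
  sum.\<close>

lemma minimax_lower_bound:
  fixes g :: "(nat \<Rightarrow> rvec) \<Rightarrow> rvec"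
  assumes "0 < h0" "0 \<le> \<Delta>" and g: "g \<in> sample_space D n \<rightarrow>\<^sub>M borel"
    and ex: "\<And>\<eta>. 0 < \<eta> \<Longrightarrow> \<exists>S0 S1 y0 y1.
      compact S0 \<and> compact S1 \<and> S0 \<subseteq> Rn D \<and> S1 \<subseteq> Rn D \<and>
      hausdorff_outer d S0 < \<infinity> \<and> hausdorff_outer d S1 < \<infinity> \<and>
      ennreal h0 \<le> hausdorff_outer d S0 \<and> ennreal h0 \<le> hausdorff_outer d S1 \<and>
      hausdorff_outer d (S0 - S1) \<le> ennreal \<eta> \<and> hausdorff_outer d (S1 - S0) \<le> ennreal \<eta> \<and>
      uniform_law d D S0 \<in> \<P> \<and> uniform_law d D S1 \<in> \<P> \<and> \<Delta> \<le> norm (y0 - y1) \<and>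
      (\<forall>\<omega>\<in>space (sample_space D n). ennreal (norm (y0 - g \<omega>)) \<le> loss (uniform_law d D S0) \<omega> \<and>
         ennreal (norm (y1 - g \<omega>)) \<le> loss (uniform_law d D S1) \<omega>)"
  shows "ennreal (\<Delta> / 2) \<le> (SUP P\<in>\<P>. \<integral>\<^sup>+ \<omega>. loss P \<omega> \<partial>(sample_law P n))"
    (is "_ \<le> ?sup")
proof (cases ?sup)
  case (real s)
  have "(1 - \<eta> / h0) ^ n * \<Delta> \<le> 2 * s" if \<eta>: "0 < \<eta>" "\<eta> < h0" for \<eta>
  proof -
    obtain S0 S1 y0 y1 where *: "compact S0" "compact S1" "S0 \<subseteq> Rn D" "S1 \<subseteq> Rn D"
      "hausdorff_outer d S0 < \<infinity>" "hausdorff_outer d S1 < \<infinity>"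
      "ennreal h0 \<le> hausdorff_outer d S0" "ennreal h0 \<le> hausdorff_outer d S1"
      "hausdorff_outer d (S0 - S1) \<le> ennreal \<eta>" "hausdorff_outer d (S1 - S0) \<le> ennreal \<eta>"
      and P: "uniform_law d D S0 \<in> \<P>" "uniform_law d D S1 \<in> \<P>" and \<Delta>: "\<Delta> \<le> norm (y0 - y1)"
      and l: "\<And>\<omega>. \<omega> \<in> space (sample_space D n) \<Longrightarrow> ennreal (norm (y0 - g \<omega>)) \<le> loss (uniform_law d D S0) \<omega>"
         "\<And>\<omega>. \<omega> \<in> space (sample_space D n) \<Longrightarrow> ennreal (norm (y1 - g \<omega>)) \<le> loss (uniform_law d D S1) \<omega>"
      using ex[OF \<eta>(1)] by (elim exE conjE) blast
    have "ennreal ((1 - \<eta> / h0) ^ n * \<Delta>) \<le> ennreal ((1 - \<eta> / h0) ^ n * norm (y0 - y1))"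
      using \<Delta> \<eta> by (intro ennreal_leI mult_left_mono) auto
    also have "\<dots> \<le> (\<integral>\<^sup>+ \<omega>. loss (uniform_law d D S0) \<omega> \<partial>(sample_law (uniform_law d D S0) n)) +
        (\<integral>\<^sup>+ \<omega>. loss (uniform_law d D S1) \<omega> \<partial>(sample_law (uniform_law d D S1) n))"
      by (rule two_point_bound[OF *(1-6) \<eta> *(7-10) g l])
    also have "\<dots> \<le> ?sup + ?sup"
      using P by (intro add_mono SUP_upper)
    also have "\<dots> = ennreal (2 * s)" using real by (simp add: ennreal_plus[symmetric] del: ennreal_plus)
    finally show ?thesis using real by (subst (asm) ennreal_le_iff) auto
  qed
  then have "\<forall>\<^sub>F \<eta> in at_right 0. (1 - \<eta> / h0) ^ n * \<Delta> \<le> 2 * s"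
    using \<open>0 < h0\<close> unfolding eventually_at_right_field by blast
  moreover have "((\<lambda>\<eta>. (1 - \<eta> / h0) ^ n * \<Delta>) \<longlongrightarrow> (1 - 0 / h0) ^ n * \<Delta>) (at_right 0)"
    using \<open>0 < h0\<close> by (intro tendsto_intros) auto
  ultimately have "(1 - 0 / h0) ^ n * \<Delta> \<le> 2 * s"
    by (intro tendsto_upperbound) auto
  then show ?thesis using real by (auto intro: ennreal_leI)
next
  case top
  then show ?thesis by (simp only: top_greatest)
qed


section \<open>Functions with uniformly bounded derivatives\<close>

lemma sin_add_Suc_quarter: "sin (x + real (Suc i) * (pi / 2)) = cos (x + real i * (pi / 2))"
proof -
  have e: "x + real (Suc i) * (pi / 2) = (x + real i * (pi / 2)) + pi / 2"
    by (simp add: field_simps)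
  show ?thesis unfolding e by (subst sin_add) simp
qed

text \<open>Only the first \<open>d\<close> coordinates may matter, and the bounds are uniform in the parameter \<open>p\<close>.\<close>

primrec bounded_Ck :: "nat \<Rightarrow> nat \<Rightarrow> ('p \<Rightarrow> rvec \<Rightarrow> real) \<Rightarrow> bool" where
  "bounded_Ck d 0 f \<longleftrightarrow> (\<exists>B. \<forall>p w. \<bar>f p w\<bar> \<le> B) \<and> (\<forall>p. continuous_on UNIV (f p))"
| "bounded_Ck d (Suc i) f \<longleftrightarrow> (\<exists>B. \<forall>p w. \<bar>f p w\<bar> \<le> B) \<and>
     (\<exists>g. (\<forall>p w. (f p has_derivative (\<lambda>u. \<Sum>j<d. coord u j * g j p w)) (at w)) \<and> (\<forall>j<d. bounded_Ck d i (g j)))"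

lemma bounded_Ck_bounded: "bounded_Ck d i f \<Longrightarrow> \<exists>B. \<forall>p w. \<bar>f p w\<bar> \<le> B"
  by (cases i) auto

lemma bounded_Ck_continuous:
  assumes "bounded_Ck d i f"
  shows "continuous_on UNIV (f p)"
proof (cases i)
  case (Suc n)
  then obtain g where "\<And>p w. (f p has_derivative (\<lambda>u. \<Sum>j<d. coord u j * g j p w)) (at w)"
    using assms unfolding Suc bounded_Ck.simps by blast
  then show ?thesis by (rule has_derivative_continuous_on[of UNIV])
qed (use assms in simp)

lemma bounded_Ck_SucD: "bounded_Ck d (Suc i) f \<Longrightarrow> bounded_Ck d i f"
proof (induction i arbitrary: f)
  case 0
  then show ?case using bounded_Ck_continuous[OF 0] by auto
next
  case (Suc i)
  then obtain g where "\<And>p w. (f p has_derivative (\<lambda>u. \<Sum>j<d. coord u j * g j p w)) (at w)"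
    "\<And>j. j < d \<Longrightarrow> bounded_Ck d (Suc i) (g j)"
    unfolding bounded_Ck.simps(2)[of d "Suc i"] by blast
  moreover have "\<exists>B. \<forall>p w. \<bar>f p w\<bar> \<le> B" using Suc.prems by (rule bounded_Ck_bounded)
  ultimately show ?case
    unfolding bounded_Ck.simps(2)[of d i f] using Suc.IH by blast
qed

lemma bounded_Ck_const: "bounded_Ck d i (\<lambda>p w. c)"
proof (induction i arbitrary: c)
  case (Suc i)
  have "\<exists>B. \<forall>(p::'a) (w::rvec). \<bar>c\<bar> \<le> B" by auto
  then show ?case
    unfolding bounded_Ck.simps by (intro conjI exI[of _ "\<lambda>_ _ _. 0"]) (use Suc in auto)
qed auto

lemma bounded_Ck_add: "bounded_Ck d i f \<Longrightarrow> bounded_Ck d i g \<Longrightarrow> bounded_Ck d i (\<lambda>p w. f p w + g p w)"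
proof (induction i arbitrary: f g)
  case 0
  obtain B B' where "\<And>p w. \<bar>f p w\<bar> \<le> B" "\<And>p w. \<bar>g p w\<bar> \<le> B'" using 0 by auto
  then have "\<bar>f p w + g p w\<bar> \<le> B + B'" for p w
    by (rule order_trans[OF abs_triangle_ineq add_mono])
  with 0 show ?case by (auto intro!: continuous_intros)
next
  case (Suc i)
  obtain B B' where "\<And>p w. \<bar>f p w\<bar> \<le> B" "\<And>p w. \<bar>g p w\<bar> \<le> B'"
    using Suc.prems[THEN bounded_Ck_bounded] by blast
  then have "\<bar>f p w + g p w\<bar> \<le> B + B'" for p w
    by (rule order_trans[OF abs_triangle_ineq add_mono])
  moreover obtain f' g' where "\<And>p w. (f p has_derivative (\<lambda>u. \<Sum>j<d. coord u j * f' j p w)) (at w)"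
    "\<And>p w. (g p has_derivative (\<lambda>u. \<Sum>j<d. coord u j * g' j p w)) (at w)"
    "\<And>j. j < d \<Longrightarrow> bounded_Ck d i (f' j)" "\<And>j. j < d \<Longrightarrow> bounded_Ck d i (g' j)"
    using Suc.prems unfolding bounded_Ck.simps by blast
  ultimately show ?case
    unfolding bounded_Ck.simps
    by (intro conjI exI[of _ "B + B'"] exI[of _ "\<lambda>j p w. f' j p w + g' j p w"])
      (auto intro!: Suc.IH simp: distrib_left sum.distrib intro: has_derivative_add)
qed

lemma bounded_Ck_mult: "bounded_Ck d i f \<Longrightarrow> bounded_Ck d i g \<Longrightarrow> bounded_Ck d i (\<lambda>p w. f p w * g p w)"
proof (induction i arbitrary: f g)
  case 0
  obtain B B' where "\<And>p w. \<bar>f p w\<bar> \<le> B" "\<And>p w. \<bar>g p w\<bar> \<le> B'" using 0 by auto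
  then have "\<bar>f p w * g p w\<bar> \<le> B * B'" for p w
    unfolding abs_mult by (intro mult_mono) (auto intro: order_trans[OF abs_ge_zero])
  with 0 show ?case by (auto intro!: continuous_intros)
next
  case (Suc i)
  obtain B B' where "\<And>p w. \<bar>f p w\<bar> \<le> B" "\<And>p w. \<bar>g p w\<bar> \<le> B'"
    using Suc.prems[THEN bounded_Ck_bounded] by blast
  then have "\<bar>f p w * g p w\<bar> \<le> B * B'" for p w
    unfolding abs_mult by (intro mult_mono) (auto intro: order_trans[OF abs_ge_zero])
  moreover obtain f' g' where d: "\<And>p w. (f p has_derivative (\<lambda>u. \<Sum>j<d. coord u j * f' j p w)) (at w)"
    "\<And>p w. (g p has_derivative (\<lambda>u. \<Sum>j<d. coord u j * g' j p w)) (at w)"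
    and n: "\<And>j. j < d \<Longrightarrow> bounded_Ck d i (f' j)" "\<And>j. j < d \<Longrightarrow> bounded_Ck d i (g' j)"
    using Suc.prems unfolding bounded_Ck.simps by blast
  have "((\<lambda>w. f p w * g p w) has_derivative
      (\<lambda>u. \<Sum>j<d. coord u j * (f p w * g' j p w + f' j p w * g p w))) (at w)" for p w
    using has_derivative_mult[OF d(1)[of p w] d(2)[of p w]]
    by (simp add: distrib_left sum.distrib sum_distrib_left sum_distrib_right mult_ac)
  moreover have "bounded_Ck d i (\<lambda>p w. f p w * g' j p w + f' j p w * g p w)" if "j < d" for j
    using n that bounded_Ck_SucD[OF Suc.prems(1)] bounded_Ck_SucD[OF Suc.prems(2)] by (intro bounded_Ck_add Suc.IH) auto
  ultimately show ?case
    unfolding bounded_Ck.simps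
    by (intro conjI exI[of _ "B * B'"] exI[of _ "\<lambda>j p w. f p w * g' j p w + f' j p w * g p w"]) auto
qed

lemma bounded_Ck_coord:
  assumes "j < d"
    and "\<And>i p t. i < k \<Longrightarrow> (g i p has_real_derivative g (Suc i) p t) (at t)"
    and "\<And>i. i \<le> k \<Longrightarrow> \<exists>B. \<forall>p t. \<bar>g i p t\<bar> \<le> B"
    and "\<And>p. continuous_on UNIV (g k p)"
  shows "bounded_Ck d k (\<lambda>p w. g 0 p (coord w j))"
  using assms(2-)
proof (induction k arbitrary: g)
  case 0
  have "continuous_on UNIV (\<lambda>w. g 0 p (coord w j))" for p
    by (rule continuous_on_compose2[OF 0(3)[of p] continuous_on_coord[OF continuous_on_id]]) simp
  moreover obtain B where "\<And>p t. \<bar>g 0 p t\<bar> \<le> B" using 0(2)[of 0] by auto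
  ultimately show ?case by auto
next
  case (Suc k)
  have "bounded_Ck d k (\<lambda>p w. g (Suc 0) p (coord w j))"
  proof (rule Suc.IH[of "\<lambda>i. g (Suc i)"])
    show "(g (Suc i) p has_real_derivative g (Suc (Suc i)) p t) (at t)" if "i < k" for i p t
      by (rule Suc.prems(1)) (use that in simp)
    show "\<exists>B. \<forall>p t. \<bar>g (Suc i) p t\<bar> \<le> B" if "i \<le> k" for i
      by (rule Suc.prems(2)) (use that in simp)
    show "continuous_on UNIV (g (Suc k) p)" for p by (rule Suc.prems(3))
  qed
  then have "bounded_Ck d k (\<lambda>p w. if l = j then g 1 p (coord w j) else 0)" for l
    by (cases "l = j") (auto intro: bounded_Ck_const)
  moreover have "((\<lambda>w. g 0 p (coord w j)) has_derivative
      (\<lambda>u. \<Sum>l<d. coord u l * (if l = j then g 1 p (coord w j) else 0))) (at w)" for p w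
  proof -
    have "((\<lambda>w. g 0 p (coord w j)) has_derivative (\<lambda>u. g 1 p (coord w j) * coord u j)) (at w)"
      using has_derivative_compose[OF bounded_linear_imp_has_derivative[OF bounded_linear_coord]
          Suc.prems(1)[of 0 p "coord w j", unfolded has_field_derivative_def]] by simp
    then show ?thesis using \<open>j < d\<close> by (simp add: if_distrib mult.commute sum.delta cong: if_cong)
  qed
  moreover have "\<exists>B. \<forall>p w. \<bar>g 0 p (coord w j)\<bar> \<le> B" using Suc.prems(2)[of 0] by fastforce
  ultimately show ?case unfolding bounded_Ck.simps
    by (intro conjI exI[of _ "\<lambda>l p w. if l = j then g 1 p (coord w j) else 0"]) auto
qed

section \<open>Multilinear differentials assembled from partial derivatives\<close>

definition bounded_differentials ::
  "nat \<Rightarrow> nat \<Rightarrow> ('p \<Rightarrow> rvec \<Rightarrow> real) \<Rightarrow> ('p \<Rightarrow> rvec list \<Rightarrow> rvec \<Rightarrow> real) \<Rightarrow> real \<Rightarrow> bool" where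
  "bounded_differentials d k f F B \<longleftrightarrow> (\<forall>p. F p [] = f p) \<and>
    (\<forall>p us w. length us < k \<longrightarrow> (F p us has_derivative (\<lambda>u. F p (u # us) w)) (at w)) \<and>
    (\<forall>p us. length us = k \<longrightarrow> continuous_on UNIV (F p us)) \<and>
    (\<forall>p us w u. length us < k \<longrightarrow> F p (rvec_of d (coord u) # us) w = F p (u # us) w) \<and>
    (\<forall>p us w. length us \<le> k \<longrightarrow> (\<forall>u\<in>set us. norm u \<le> 1) \<longrightarrow> \<bar>F p us w\<bar> \<le> B)"

lemma bounded_differentialsD:
  assumes "bounded_differentials d k f F B"
  shows "F p [] = f p"
    and "length us < k \<Longrightarrow> (F p us has_derivative (\<lambda>u. F p (u # us) w)) (at w)"
    and "length us = k \<Longrightarrow> continuous_on UNIV (F p us)"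
    and "length us < k \<Longrightarrow> F p (rvec_of d (coord u) # us) w = F p (u # us) w"
    and "length us \<le> k \<Longrightarrow> (\<forall>u\<in>set us. norm u \<le> 1) \<Longrightarrow> \<bar>F p us w\<bar> \<le> B"
  using assms by (simp_all add: bounded_differentials_def)

text \<open>Induction on the order. The last list entry is the direction differentiated first, so it
  is expanded along the gradient, and the rest of the list is passed to the differentials of the
  partial derivatives.\<close>

lemma bounded_Ck_differentials:
  assumes "bounded_Ck d k f"
  shows "\<exists>F B. bounded_differentials d k f F B"
  using assms
proof (induction k arbitrary: f)
  case 0
  then obtain B where "\<forall>p w. \<bar>f p w\<bar> \<le> B" by auto
  with 0 have "bounded_differentials d 0 f (\<lambda>p us. f p) B" by (simp add: bounded_differentials_def)
  then show ?case by blast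
next
  case (Suc k)
  obtain g where g: "\<And>p w. (f p has_derivative (\<lambda>u. \<Sum>j<d. coord u j * g j p w)) (at w)"
    "\<And>j. j < d \<Longrightarrow> bounded_Ck d k (g j)"
    using Suc.prems unfolding bounded_Ck.simps by blast
  obtain B0 where B0: "\<And>p w. \<bar>f p w\<bar> \<le> B0" using bounded_Ck_bounded[OF Suc.prems] by blast
  have "\<forall>j. \<exists>G B. j < d \<longrightarrow> bounded_differentials d k (g j) G B"
    using Suc.IH[OF g(2)] by blast
  then obtain G B where GB: "\<And>j. j < d \<Longrightarrow> bounded_differentials d k (g j) (G j) (B j)"
    by metis
  note G0 = bounded_differentialsD(1)[OF GB] and Gd = bounded_differentialsD(2)[OF GB]
    and Gc = bounded_differentialsD(3)[OF GB] and Gt = bounded_differentialsD(4)[OF GB]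
    and B = bounded_differentialsD(5)[OF GB]
  define F where "F p us w = (if us = [] then f p w else \<Sum>j<d. coord (last us) j * G j p (butlast us) w)" for p us w
  have F_ne: "F p us = (\<lambda>w. \<Sum>j<d. coord (last us) j * G j p (butlast us) w)" if "us \<noteq> []" for p us
    using that by (auto simp: F_def)
  have "bounded_differentials d (Suc k) f F (\<bar>B0\<bar> + (\<Sum>j<d. \<bar>B j\<bar>))"
    unfolding bounded_differentials_def
  proof (intro conjI allI impI)
    show "F p [] = f p" for p by (auto simp: F_def)
    show "(F p us has_derivative (\<lambda>u. F p (u # us) w)) (at w)" if "length us < Suc k" for p us w
    proof (cases "us = []")
      case True
      have "F p [] = f p" by (auto simp: F_def)
      then show ?thesis using g(1)[of p w] G0 True by (simp add: F_ne)
    next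
      case False
      then have "length (butlast us) < k" using that by (cases us rule: rev_cases) auto
      moreover have "F p (u # us) w = (\<Sum>j<d. coord (last us) j * G j p (u # butlast us) w)" for u
        using False by (simp add: F_ne)
      ultimately show ?thesis
        unfolding F_ne[OF False] by (auto intro!: has_derivative_sum has_derivative_mult_right Gd)
    qed
    show "continuous_on UNIV (F p us)" if "length us = Suc k" for p us
    proof -
      have "us \<noteq> []" "length (butlast us) = k" using that by auto
      then show ?thesis unfolding F_ne[OF \<open>us \<noteq> []\<close>] by (intro continuous_intros Gc) auto
    qed
    show "F p (rvec_of d (coord u) # us) w = F p (u # us) w" if "length us < Suc k" for p us w u
    proof (cases "us = []")
      case False
      then have "length (butlast us) < k" using that by (cases us rule: rev_cases) auto
      then show ?thesis using False by (simp add: F_ne Gt)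
    qed (simp add: F_ne)
    show "\<bar>F p us w\<bar> \<le> \<bar>B0\<bar> + (\<Sum>j<d. \<bar>B j\<bar>)"
      if us: "length us \<le> Suc k" "\<forall>u\<in>set us. norm u \<le> 1" for p us w
    proof (cases "us = []")
      case True
      then show ?thesis using B0[of p w] by (simp add: F_def add_increasing2 sum_nonneg)
    next
      case False
      then have l: "length (butlast us) \<le> k" "\<forall>u\<in>set (butlast us). norm u \<le> 1" "norm (last us) \<le> 1"
        using us by (auto dest: in_set_butlastD)
      have "\<bar>F p us w\<bar> \<le> (\<Sum>j<d. \<bar>coord (last us) j * G j p (butlast us) w\<bar>)"
        unfolding F_ne[OF False] by (rule sum_abs)
      also have "\<dots> \<le> (\<Sum>j<d. 1 * \<bar>B j\<bar>)"
        unfolding abs_mult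
      proof (intro sum_mono mult_mono)
        fix j assume "j \<in> {..<d}"
        then show "\<bar>G j p (butlast us) w\<bar> \<le> \<bar>B j\<bar>" using B[of j "butlast us" p w] l by auto
        show "\<bar>coord (last us) j\<bar> \<le> 1" using abs_coord_le_norm l(3) by (rule order_trans)
      qed auto
      finally show ?thesis by simp
    qed
  qed
  then show ?case by blast
qed

section \<open>Periodic bumps of arbitrary width with uniformly small derivatives\<close>

lemma has_real_derivative_max_power:
  "((\<lambda>x. max 0 x ^ Suc (Suc n)) has_real_derivative real (Suc (Suc n)) * max 0 x ^ Suc n) (at x)"
proof -
  consider "x < 0" | "x = 0" | "0 < x" by linarith
  then show ?thesis
  proof cases
    case 1
    have "((\<lambda>x. 0) has_real_derivative real (Suc (Suc n)) * max 0 x ^ Suc n) (at x)" using 1 by simp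
    then show ?thesis
      by (rule has_field_derivative_transform_within_open[of _ _ _ "{..<0}"]) (use 1 in auto)
  next
    case 3
    have "((\<lambda>x. x ^ Suc (Suc n)) has_real_derivative real (Suc (Suc n)) * max 0 x ^ Suc n) (at x)"
      using 3 DERIV_pow[of "Suc (Suc n)" x] by (simp add: max_absorb2)
    then show ?thesis
      by (rule has_field_derivative_transform_within_open[of _ _ _ "{0<..}"]) (use 3 in auto)
  next
    case 2
    have "((\<lambda>h. (max 0 (0 + h) ^ Suc (Suc n) - max 0 0 ^ Suc (Suc n)) / h) \<longlongrightarrow> 0) (at (0::real))"
    proof (rule Lim_null_comparison)
      have "norm ((max 0 (0 + h) ^ Suc (Suc n) - max 0 0 ^ Suc (Suc n)) / h) \<le> \<bar>h\<bar> ^ Suc n" if "h \<noteq> 0" for h :: real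
      proof (cases "0 < h")
        case True
        then show ?thesis by (simp add: max_absorb2)
      next
        case False
        then have "norm ((max 0 (0 + h) ^ Suc (Suc n) - max 0 0 ^ Suc (Suc n)) / h) = 0" by simp
        then show ?thesis by (simp only: zero_le_power abs_ge_zero)
      qed
      then show "\<forall>\<^sub>F h in at 0. norm ((max 0 (0 + h) ^ Suc (Suc n) - max 0 0 ^ Suc (Suc n)) / h) \<le> \<bar>h\<bar> ^ Suc n"
        by (auto simp: eventually_at_filter)
      have "((\<lambda>h. \<bar>h\<bar> ^ Suc n) \<longlongrightarrow> \<bar>0 :: real\<bar> ^ Suc n) (at 0)" by (intro tendsto_intros)
      then show "((\<lambda>h. \<bar>h\<bar> ^ Suc n) \<longlongrightarrow> 0) (at (0::real))" by simp
    qed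
    then show ?thesis using 2 by (simp add: DERIV_def)
  qed
qed

lemma bounded_Ck_trig:
  assumes "j < d"
  shows "bounded_Ck d i (\<lambda>(p :: 'p) w. - sin (coord w j))"
proof -
  define g where "g i (p :: 'p) t = - sin (t + real i * (pi / 2))" for i p t
  have "bounded_Ck d i (\<lambda>p w. g 0 p (coord w j))"
  proof (rule bounded_Ck_coord[OF assms])
    fix i p t
    show "(g i p has_real_derivative g (Suc i) p t) (at t)"
      unfolding g_def[abs_def] sin_add_Suc_quarter by (auto intro!: derivative_eq_intros)
  next
    show "\<exists>B. \<forall>p t. \<bar>g i p t\<bar> \<le> B" for i
      by (intro exI[of _ 1]) (simp add: g_def)
  next
    show "continuous_on UNIV (g i p)" for p unfolding g_def by (intro continuous_intros)
  qed
  then show ?thesis by (simp add: g_def)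
qed

text \<open>Each differentiation lowers the exponent by one and yields a factor
  \<open>- sin\<close>, so exponent \<open>i + 1\<close> leaves a continuous \<open>i\<close>-th
  derivative. The base lies between 0 and 2 whatever the width, so the bounds do not depend on
  \<open>\<epsilon>\<close>.\<close>

lemma bounded_Ck_bump: "Suc i \<le> m \<Longrightarrow> bounded_Ck 1 i (\<lambda>\<epsilon> w. max 0 (cos (coord w 0) - cos \<epsilon>) ^ m)"
proof (induction i arbitrary: m)
  case 0
  have "\<bar>max 0 (cos (coord w 0) - cos \<epsilon>) ^ m\<bar> \<le> 2 ^ m" for w \<epsilon>
  proof -
    have "max 0 (cos (coord w 0) - cos \<epsilon>) \<le> 2"
      using cos_le_one[of "coord w 0"] cos_ge_minus_one[of \<epsilon>] by linarith
    then show ?thesis by (simp add: power_mono)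
  qed
  moreover have "continuous_on UNIV (\<lambda>w. max 0 (cos (coord w 0) - cos \<epsilon>) ^ m)" for \<epsilon>
    by (intro continuous_intros)
  ultimately show ?case by auto
next
  case (Suc i)
  then obtain n where m: "m = Suc (Suc n)" by (cases m; cases "m - 1"; auto)
  have "\<bar>max 0 (cos (coord w 0) - cos \<epsilon>) ^ m\<bar> \<le> 2 ^ m" for w \<epsilon>
  proof -
    have "max 0 (cos (coord w 0) - cos \<epsilon>) \<le> 2"
      using cos_le_one[of "coord w 0"] cos_ge_minus_one[of \<epsilon>] by linarith
    then show ?thesis by (simp add: power_mono)
  qed
  moreover have "((\<lambda>w. max 0 (cos (coord w 0) - cos \<epsilon>) ^ m) has_derivative
      (\<lambda>u. \<Sum>j<1. coord u j * (real m * max 0 (cos (coord w 0) - cos \<epsilon>) ^ Suc n * - sin (coord w 0)))) (at w)" for \<epsilon> w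
  proof -
    have "((\<lambda>w. cos (coord w 0) - cos \<epsilon>) has_derivative (\<lambda>u. - sin (coord w 0) * coord u 0 - 0)) (at w)"
      by (auto intro!: derivative_eq_intros bounded_linear_imp_has_derivative[OF bounded_linear_coord])
    from has_derivative_compose[OF this has_real_derivative_max_power[of n, unfolded has_field_derivative_def]]
    show ?thesis by (simp add: m mult_ac del: power_Suc)
  qed
  moreover have "bounded_Ck 1 i (\<lambda>\<epsilon> w. real m * max 0 (cos (coord w 0) - cos \<epsilon>) ^ Suc n * - sin (coord w 0))"
    using Suc by (intro bounded_Ck_mult bounded_Ck_const bounded_Ck_trig Suc.IH) (auto simp: m)
  ultimately show ?case
    unfolding bounded_Ck.simps
    by (intro conjI exI[of _ "\<lambda>j \<epsilon> w. real m * max 0 (cos (coord w 0) - cos \<epsilon>) ^ Suc n * - sin (coord w 0)"]) auto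
qed

text \<open>Stating everything through \<open>cos\<close> makes bumps periodic, so profile curves
  stay closed. The width is \<open>\<epsilon>\<close>, and the bound \<open>\<delta>\<close> is
  common to all widths. Derivatives are asked to vanish where the inequality is strict, an open set
  on which the bump is locally 0.\<close>

definition is_bump :: "nat \<Rightarrow> real \<Rightarrow> (nat \<Rightarrow> real \<Rightarrow> real \<Rightarrow> real) \<Rightarrow> bool" where
  "is_bump k \<delta> h \<longleftrightarrow>
    (\<forall>i \<epsilon> t. i < k \<longrightarrow> (h i \<epsilon> has_real_derivative h (Suc i) \<epsilon> t) (at t)) \<and>
    (\<forall>i \<epsilon> t. i \<le> k \<longrightarrow> \<bar>h i \<epsilon> t\<bar> \<le> \<delta>) \<and> (\<forall>\<epsilon>. continuous_on UNIV (h k \<epsilon>)) \<and>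
    (\<forall>\<epsilon> t. cos \<epsilon> < cos t \<longrightarrow> 0 < h 0 \<epsilon> t) \<and> (\<forall>\<epsilon> t. cos t \<le> cos \<epsilon> \<longrightarrow> h 0 \<epsilon> t = 0) \<and>
    (\<forall>i \<epsilon> t. i \<le> k \<longrightarrow> cos t < cos \<epsilon> \<longrightarrow> h i \<epsilon> t = 0) \<and>
    (\<forall>\<epsilon> t t'. cos t = cos t' \<longrightarrow> h 0 \<epsilon> t = h 0 \<epsilon> t')"

lemma is_bumpD:
  assumes "is_bump k \<delta> h"
  shows "i < k \<Longrightarrow> (h i \<epsilon> has_real_derivative h (Suc i) \<epsilon> t) (at t)"
    "i \<le> k \<Longrightarrow> \<bar>h i \<epsilon> t\<bar> \<le> \<delta>" "continuous_on UNIV (h k \<epsilon>)"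
    "cos \<epsilon> < cos t \<Longrightarrow> 0 < h 0 \<epsilon> t" "cos t \<le> cos \<epsilon> \<Longrightarrow> h 0 \<epsilon> t = 0"
    "i \<le> k \<Longrightarrow> cos t < cos \<epsilon> \<Longrightarrow> h i \<epsilon> t = 0" "cos t = cos t' \<Longrightarrow> h 0 \<epsilon> t = h 0 \<epsilon> t'"
  using assms unfolding is_bump_def by blast+

text \<open>The derivative bound of the raw bumps is the same for all widths, so a single factor
  \<open>r\<close> makes all of them small at once.\<close>

lemma bump_exists:
  assumes "0 < \<delta>"
  shows "\<exists>h. is_bump k \<delta> h"
proof -
  define f where "f = (\<lambda>\<epsilon> w. max 0 (cos (coord w 0) - cos \<epsilon>) ^ Suc k)"
  have "bounded_Ck 1 k f" unfolding f_def by (rule bounded_Ck_bump) simp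
  then obtain F B where FB: "bounded_differentials 1 k f F B"
    using bounded_Ck_differentials by blast
  define r where "r = \<delta> / (\<bar>B\<bar> + 1)"
  have r: "0 < r" using assms by (simp add: r_def add_nonneg_pos)
  define h where "h i \<epsilon> t = r * F \<epsilon> (replicate i (uvec 0)) (t *\<^sub>R uvec 0)" for i \<epsilon> t
  have h0: "h 0 \<epsilon> t = r * max 0 (cos t - cos \<epsilon>) ^ Suc k" for \<epsilon> t
    using bounded_differentialsD(1)[OF FB, of \<epsilon>] by (simp add: h_def f_def)
  have deriv: "(h i \<epsilon> has_real_derivative h (Suc i) \<epsilon> t) (at t)" if i: "i < k" for i \<epsilon> t
  proof -
    let ?us = "replicate i (uvec 0)"
    have us: "length ?us < k" using i by simp
    note d = bounded_differentialsD(2)[OF FB us]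
    have "((\<lambda>t. t *\<^sub>R uvec 0) has_derivative (\<lambda>x. x *\<^sub>R uvec 0)) (at t)" by (auto intro!: derivative_eq_intros)
    from has_derivative_compose[OF this d[of \<epsilon> "t *\<^sub>R uvec 0"]]
    have "((\<lambda>t. F \<epsilon> ?us (t *\<^sub>R uvec 0)) has_derivative (\<lambda>x. F \<epsilon> (x *\<^sub>R uvec 0 # ?us) (t *\<^sub>R uvec 0))) (at t)" .
    moreover have "F \<epsilon> (x *\<^sub>R uvec 0 # ?us) w = x * F \<epsilon> (uvec 0 # ?us) w" for x w
      using linear_scale[OF bounded_linear.linear[OF has_derivative_bounded_linear[OF d[of \<epsilon> w]]], of x "uvec 0"] by simp
    ultimately have "((\<lambda>t. F \<epsilon> ?us (t *\<^sub>R uvec 0)) has_real_derivative F \<epsilon> (uvec 0 # ?us) (t *\<^sub>R uvec 0)) (at t)"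
      by (simp add: has_field_derivative_def mult_commute_abs)
    from DERIV_cmult[OF this, of r] show ?thesis unfolding h_def[abs_def] by simp
  qed
  have bound: "\<bar>h i \<epsilon> t\<bar> \<le> \<delta>" if "i \<le> k" for i \<epsilon> t
  proof -
    have "\<bar>F \<epsilon> (replicate i (uvec 0)) (t *\<^sub>R uvec 0)\<bar> \<le> B"
      by (rule bounded_differentialsD(5)[OF FB]) (use that in auto)
    then have "\<bar>h i \<epsilon> t\<bar> \<le> r * (\<bar>B\<bar> + 1)"
      unfolding h_def abs_mult using r by (intro mult_mono) auto
    also have "\<dots> = \<delta>" by (simp add: r_def)
    finally show ?thesis .
  qed
  have cont: "continuous_on UNIV (h k \<epsilon>)" for \<epsilon>
    unfolding h_def[abs_def]
    by (intro continuous_intros continuous_on_compose2[OF bounded_differentialsD(3)[OF FB, of "replicate k (uvec 0)" \<epsilon>]]) auto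
  have zero: "h i \<epsilon> t = 0" if "i \<le> k" "cos t < cos \<epsilon>" for i \<epsilon> t
    using that
  proof (induction i arbitrary: t)
    case 0
    then show ?case by (simp add: h0)
  next
    case (Suc i)
    have "open {t. cos t < cos \<epsilon>}" by (intro open_Collect_less continuous_intros)
    with deriv[of i \<epsilon> t] Suc.prems have "((\<lambda>t. 0) has_real_derivative h (Suc i) \<epsilon> t) (at t)"
      using has_field_derivative_transform_within_open[of "h i \<epsilon>" "h (Suc i) \<epsilon> t" t "{t. cos t < cos \<epsilon>}" "\<lambda>t. 0"]
        Suc.IH by simp
    from DERIV_unique[OF this DERIV_const] show ?case .
  qed
  have "is_bump k \<delta> h"
    unfolding is_bump_def
  proof (intro conjI allI impI)
    show "0 < h 0 \<epsilon> t" if "cos \<epsilon> < cos t" for \<epsilon> t using that r by (simp add: h0)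
    show "h 0 \<epsilon> t = 0" if "cos t \<le> cos \<epsilon>" for \<epsilon> t using that by (simp add: h0)
    show "h 0 \<epsilon> t = h 0 \<epsilon> t'" if "cos t = cos t'" for \<epsilon> t t' using that by (simp add: h0)
  qed (use deriv bound cont zero in auto)
  then show ?thesis by blast
qed


section \<open>Nested tori\<close>

text \<open>The functions \<open>a\<close>, \<open>b\<close>, \<open>c\<close> are the coordinates
  of a closed profile curve, their first index counting derivatives; the rotations act on
  \<open>b\<close>. In \<open>R_large\<close>, the term added to \<open>q\<close> pays for the
  rotations: \<open>d * d\<close> entries of the second differential, each with \<open>d + 2\<close>
  components of size at most \<open>6 * B / R\<close>.\<close>

locale nested_torus =
  fixes d k :: nat and R B q T0 :: real and a b c :: "nat \<Rightarrow> 'p \<Rightarrow> real \<Rightarrow> real"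
  assumes d_ge: "1 \<le> d" and k_ge: "2 \<le> k"
    and a_deriv: "i < k \<Longrightarrow> (a i p has_real_derivative a (Suc i) p t) (at t)"
    and b_deriv: "i < k \<Longrightarrow> (b i p has_real_derivative b (Suc i) p t) (at t)"
    and c_deriv: "i < k \<Longrightarrow> (c i p has_real_derivative c (Suc i) p t) (at t)"
    and a_bound: "i \<le> k \<Longrightarrow> \<bar>a i p t\<bar> \<le> B" and b_bound: "i \<le> k \<Longrightarrow> \<bar>b i p t\<bar> \<le> B"
    and c_bound: "i \<le> k \<Longrightarrow> \<bar>c i p t\<bar> \<le> B"
    and a_cont: "continuous_on UNIV (a k p)" and b_cont: "continuous_on UNIV (b k p)"
    and c_cont: "continuous_on UNIV (c k p)"
    and speed: "1 \<le> (a 1 p t)\<^sup>2 + (b 1 p t)\<^sup>2 + (c 1 p t)\<^sup>2"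
    and curv: "(a 2 p t)\<^sup>2 + (b 2 p t)\<^sup>2 + (c 2 p t)\<^sup>2 \<le> q\<^sup>2" and q_nonneg: "0 \<le> q"
    and B_ge: "3 \<le> B" and R_ge: "B \<le> R"
    and R_large: "q + real d * real d * (real d + 2) * (6 * B / R) \<le> 1"
    and T0_pos: "0 < T0"
    and curve_eq_iff: "(a 0 p t = a 0 p t' \<and> b 0 p t = b 0 p t' \<and> c 0 p t = c 0 p t') \<longleftrightarrow>
       (\<exists>m::int. t' = t + m * T0)"
begin

text \<open>The next radius \<open>rad (Suc j)\<close> is twice the bound
  \<open>2 * (4 ^ j * R)\<close> on the coordinate to be rotated, so the rotated coordinate stays
  away from the axis. The frequency \<open>kap\<close> makes the speed of rotation lie between 1 and
  3.\<close>

definition rad :: "nat \<Rightarrow> real" where "rad j = 4 ^ j * R"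
definition kap :: "nat \<Rightarrow> real" where "kap j = 2 / (4 ^ j * R)"

text \<open>The point \<open>(rad + s) (cos \<theta>, sin \<theta>)\<close> replaces the last coordinate \<open>s\<close> of the previous
  torus; phase \<open>pi / 2\<close> selects the cosine.\<close>

primrec s :: "nat \<Rightarrow> real \<Rightarrow> 'p \<Rightarrow> rvec \<Rightarrow> real" where
  "s 0 \<phi> p w = b 0 p (coord w 0)"
| "s (Suc j) \<phi> p w = (rad (Suc j) + s j 0 p w) * sin (kap (Suc j) * coord w (Suc j) + \<phi>)"

primrec ds :: "nat \<Rightarrow> real \<Rightarrow> nat \<Rightarrow> 'p \<Rightarrow> rvec \<Rightarrow> real" where
  "ds 0 \<phi> i p w = (if i = 0 then b 1 p (coord w 0) else 0)"
| "ds (Suc j) \<phi> i p w = ds j 0 i p w * sin (kap (Suc j) * coord w (Suc j) + \<phi>) +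
     (if i = Suc j then (rad (Suc j) + s j 0 p w) * kap (Suc j) * cos (kap (Suc j) * coord w (Suc j) + \<phi>) else 0)"

primrec dds :: "nat \<Rightarrow> real \<Rightarrow> nat \<Rightarrow> nat \<Rightarrow> 'p \<Rightarrow> rvec \<Rightarrow> real" where
  "dds 0 \<phi> i l p w = (if i = 0 \<and> l = 0 then b 2 p (coord w 0) else 0)"
| "dds (Suc j) \<phi> i l p w = dds j 0 i l p w * sin (kap (Suc j) * coord w (Suc j) + \<phi>) +
     (if l = Suc j then ds j 0 i p w * kap (Suc j) * cos (kap (Suc j) * coord w (Suc j) + \<phi>) else 0) +
     (if i = Suc j then ds j 0 l p w * kap (Suc j) * cos (kap (Suc j) * coord w (Suc j) + \<phi>) else 0) -
     (if i = Suc j \<and> l = Suc j then (rad (Suc j) + s j 0 p w) * (kap (Suc j))\<^sup>2 *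
        sin (kap (Suc j) * coord w (Suc j) + \<phi>) else 0)"

section \<open>Bounds on the rotated coordinates and their first two derivatives\<close>

lemma R_pos: "0 < R" using B_ge R_ge by simp

lemma kap_pos: "0 < kap j" using R_pos by (simp add: kap_def)

lemma kap_le: "kap j \<le> 2 / R"
proof -
  have "1 * R \<le> 4 ^ j * R" using R_pos by (intro mult_right_mono) auto
  then show ?thesis unfolding kap_def using R_pos by (intro divide_left_mono) auto
qed

lemma ds_zero: "j < i \<Longrightarrow> ds j \<phi> i p w = 0"
  by (induction j arbitrary: \<phi>) auto

lemma dds_zero: "j < i \<or> j < l \<Longrightarrow> dds j \<phi> i l p w = 0"
  by (induction j arbitrary: \<phi>) (auto simp: ds_zero)

lemma rad_Suc: "rad (Suc j) = 4 * (4 ^ j * R)"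
  by (simp add: rad_def)

lemma s_bound: "\<bar>s j \<phi> p w\<bar> \<le> 2 * (4 ^ j * R)"
proof (induction j arbitrary: \<phi>)
  case 0
  then show ?case using b_bound[of 0 p "coord w 0"] R_ge B_ge by simp
next
  case (Suc j)
  have "0 < 4 ^ j * R" using R_pos by simp
  have "\<bar>s (Suc j) \<phi> p w\<bar> \<le> \<bar>rad (Suc j) + s j 0 p w\<bar> * 1"
    unfolding s.simps abs_mult by (intro mult_left_mono) auto
  also have "\<dots> \<le> 8 * (4 ^ j * R)"
  proof -
    define X where "X = 4 ^ j * R"
    have "\<bar>s j 0 p w\<bar> \<le> 2 * X" "0 < X" using Suc[of 0] \<open>0 < 4 ^ j * R\<close> by (auto simp: X_def)
    then have "\<bar>4 * X + s j 0 p w\<bar> \<le> 8 * X" by (simp add: abs_le_iff)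
    then show ?thesis unfolding rad_Suc X_def by simp
  qed
  finally show ?case by simp
qed

lemma rad_s_kap: "1 \<le> (rad (Suc j) + s j 0 p w) * kap (Suc j)" "(rad (Suc j) + s j 0 p w) * kap (Suc j) \<le> 3"
proof -
  define X where "X = 4 ^ j * R"
  have p: "0 < X" using R_pos by (simp add: X_def)
  define A where "A = rad (Suc j) + s j 0 p w"
  have "2 * X \<le> A" "A \<le> 6 * X"
    using s_bound[of j 0 p w] unfolding A_def rad_Suc X_def[symmetric] by linarith+
  moreover have kap: "kap (Suc j) = 1 / (2 * X)" by (simp add: kap_def X_def)
  ultimately show "1 \<le> (rad (Suc j) + s j 0 p w) * kap (Suc j)"
    "(rad (Suc j) + s j 0 p w) * kap (Suc j) \<le> 3"
    unfolding A_def[symmetric] kap using p by (simp_all add: field_simps)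
qed

lemma rad_s_pos: "0 < rad (Suc j) + s j 0 p w"
  using rad_s_kap(1)[of j p w] kap_pos[of "Suc j"]
  by (metis less_le_trans zero_less_mult_pos2 zero_less_one)

lemma ds_bound: "\<bar>ds j \<phi> i p w\<bar> \<le> B"
proof (induction j arbitrary: \<phi>)
  case 0
  then show ?case using b_bound[of 1 p "coord w 0"] B_ge k_ge by simp
next
  case (Suc j)
  show ?case
  proof (cases "i = Suc j")
    case True
    have "\<bar>(rad (Suc j) + s j 0 p w) * kap (Suc j) * cos (kap (Suc j) * coord w (Suc j) + \<phi>)\<bar> \<le> 3 * 1"
      unfolding abs_mult[of "_ * _" "cos _"] using rad_s_kap[of j p w] by (intro mult_mono) auto
    then show ?thesis using True B_ge by (simp add: ds_zero)
  next
    case False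
    have "\<bar>ds j 0 i p w * sin (kap (Suc j) * coord w (Suc j) + \<phi>)\<bar> \<le> B * 1"
      unfolding abs_mult using Suc[of 0] B_ge by (intro mult_mono) auto
    then show ?thesis using False by simp
  qed
qed

text \<open>Apart from the pure second derivative of the profile, each term carries a factor
  \<open>kap \<le> 2 / R\<close>; what remains is a first derivative, at most \<open>B\<close>, or a
  speed of rotation, at most 3.\<close>

lemma dds_bound: "i \<noteq> 0 \<or> l \<noteq> 0 \<Longrightarrow> \<bar>dds j \<phi> i l p w\<bar> \<le> 6 * B / R"
proof (induction j arbitrary: \<phi>)
  case 0
  then show ?case using B_ge R_pos by auto
next
  case (Suc j)
  let ?S = "sin (kap (Suc j) * coord w (Suc j) + \<phi>)" and ?C = "cos (kap (Suc j) * coord w (Suc j) + \<phi>)"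
  have mixed: "\<bar>ds j 0 m p w * kap (Suc j) * ?C\<bar> \<le> 6 * B / R" for m
  proof -
    have "\<bar>ds j 0 m p w * kap (Suc j) * ?C\<bar> \<le> B * (2 / R) * 1"
      unfolding abs_mult using ds_bound[of j 0 m p w] kap_le[of "Suc j"] kap_pos[of "Suc j"] B_ge R_pos
      by (intro mult_mono) auto
    also have "\<dots> \<le> 6 * B / R" using B_ge R_pos by (simp add: field_simps)
    finally show ?thesis .
  qed
  consider "i = Suc j" "l = Suc j" | "i = Suc j" "l \<noteq> Suc j" | "i \<noteq> Suc j" "l = Suc j" | "i \<noteq> Suc j" "l \<noteq> Suc j"
    by blast
  then show ?case
  proof cases
    case 1
    have "\<bar>(rad (Suc j) + s j 0 p w) * kap (Suc j) * kap (Suc j) * ?S\<bar> \<le> 3 * (2 / R) * 1"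
      unfolding abs_mult[of _ ?S] abs_mult[of "_ * _" "kap _"]
      using rad_s_kap[of j p w] kap_le[of "Suc j"] kap_pos[of "Suc j"] R_pos
      by (intro mult_mono) auto
    also have "\<dots> \<le> 6 * B / R" using B_ge R_pos by (simp add: field_simps)
    finally show ?thesis using 1 by (simp add: dds_zero ds_zero power2_eq_square mult.assoc)
  next
    case 4
    have "\<bar>dds j 0 i l p w * ?S\<bar> \<le> (6 * B / R) * 1"
      unfolding abs_mult using Suc B_ge R_pos by (intro mult_mono) auto
    then show ?thesis using 4 by simp
  qed (use mixed in \<open>auto simp: dds_zero\<close>)
qed

section \<open>Differentiability, smoothness classes and Gram matrices\<close>

lemma has_derivative_b: "i < k \<Longrightarrow> ((\<lambda>w. b i p (coord w 0)) has_derivative (\<lambda>u. b (Suc i) p (coord w 0) * coord u 0)) (at w)"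
  using has_derivative_compose[OF bounded_linear_imp_has_derivative[OF bounded_linear_coord]
          b_deriv[of i p "coord w 0", unfolded has_field_derivative_def]] by simp

lemma has_derivative_sin_coord:
  "((\<lambda>w. sin (\<kappa> * coord w j + \<phi>)) has_derivative (\<lambda>u. \<kappa> * cos (\<kappa> * coord w j + \<phi>) * coord u j)) (at w)"
  "((\<lambda>w. cos (\<kappa> * coord w j + \<phi>)) has_derivative (\<lambda>u. - \<kappa> * sin (\<kappa> * coord w j + \<phi>) * coord u j)) (at w)"
  by (auto intro!: derivative_eq_intros bounded_linear_imp_has_derivative[OF bounded_linear_coord])

lemma sum_if_mult: "j < d \<Longrightarrow> (\<Sum>i<d. coord u i * (if i = j then x else 0)) = coord u j * x"
  by (simp add: if_distrib sum.delta cong: if_cong)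

lemma s_deriv: "j < d \<Longrightarrow> (s j \<phi> p has_derivative (\<lambda>u. \<Sum>i<d. coord u i * ds j \<phi> i p w)) (at w)"
proof (induction j arbitrary: \<phi>)
  case 0
  have "s 0 \<phi> p = (\<lambda>w. b 0 p (coord w 0))" by auto
  with has_derivative_b[of 0 p w] 0 k_ge show ?case by (simp add: sum_if_mult mult.commute)
next
  case (Suc j)
  let ?S = "\<lambda>w. sin (kap (Suc j) * coord w (Suc j) + \<phi>)" and ?C = "\<lambda>w. cos (kap (Suc j) * coord w (Suc j) + \<phi>)"
  have "s (Suc j) \<phi> p = (\<lambda>w. (rad (Suc j) + s j 0 p w) * ?S w)" by auto
  moreover have "((\<lambda>w. (rad (Suc j) + s j 0 p w) * ?S w) has_derivative
    (\<lambda>u. (rad (Suc j) + s j 0 p w) * (kap (Suc j) * ?C w * coord u (Suc j)) +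
      (0 + (\<Sum>i<d. coord u i * ds j 0 i p w)) * ?S w)) (at w)"
    using Suc by (intro has_derivative_mult has_derivative_add has_derivative_const has_derivative_sin_coord) auto
  moreover have "(\<Sum>i<d. coord u i * ds (Suc j) \<phi> i p w) =
      (rad (Suc j) + s j 0 p w) * (kap (Suc j) * ?C w * coord u (Suc j)) +
      (0 + (\<Sum>i<d. coord u i * ds j 0 i p w)) * ?S w" for u
    using Suc.prems
    by (simp only: ds.simps distrib_left sum.distrib sum_if_mult) (simp add: sum_distrib_left mult_ac)
  ultimately show ?case by simp
qed

lemma ds_deriv: "j < d \<Longrightarrow> (ds j \<phi> i p has_derivative (\<lambda>u. \<Sum>l<d. coord u l * dds j \<phi> i l p w)) (at w)"
proof (induction j arbitrary: \<phi>)
  case 0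
  show ?case
  proof (cases "i = 0")
    case True
    then have "ds 0 \<phi> i p = (\<lambda>w. b 1 p (coord w 0))" by auto
    moreover have "(\<Sum>l<d. coord u l * dds 0 \<phi> i l p w) = b 2 p (coord w 0) * coord u 0" for u
      using True 0 by (simp add: sum_if_mult mult.commute)
    ultimately show ?thesis using has_derivative_b[of 1 p w] k_ge by (simp add: numeral_2_eq_2)
  next
    case False
    then have "ds 0 \<phi> i p = (\<lambda>w. 0)" by auto
    then show ?thesis using False by simp
  qed
next
  case (Suc j)
  let ?S = "\<lambda>w. sin (kap (Suc j) * coord w (Suc j) + \<phi>)" and ?C = "\<lambda>w. cos (kap (Suc j) * coord w (Suc j) + \<phi>)"
  define e where "e = (if i = Suc j then 1 else 0 :: real)"
  define \<rho> where "\<rho> = rad (Suc j) + s j 0 p w"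
  have "ds (Suc j) \<phi> i p = (\<lambda>w. ds j 0 i p w * ?S w + (rad (Suc j) + s j 0 p w) * (e * kap (Suc j) * ?C w))"
    by (auto simp: e_def)
  moreover have "((\<lambda>w. ds j 0 i p w * ?S w + (rad (Suc j) + s j 0 p w) * (e * kap (Suc j) * ?C w)) has_derivative
    (\<lambda>u. (ds j 0 i p w * (kap (Suc j) * ?C w * coord u (Suc j)) + (\<Sum>l<d. coord u l * dds j 0 i l p w) * ?S w) +
      ((rad (Suc j) + s j 0 p w) * (e * kap (Suc j) * (- kap (Suc j) * ?S w * coord u (Suc j))) +
      (0 + (\<Sum>l<d. coord u l * ds j 0 l p w)) * (e * kap (Suc j) * ?C w)))) (at w)"
    using Suc by (intro has_derivative_mult has_derivative_mult_right has_derivative_add has_derivative_const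
        has_derivative_sin_coord s_deriv) auto
  moreover have "(\<Sum>l<d. coord u l * dds (Suc j) \<phi> i l p w) =
    (ds j 0 i p w * (kap (Suc j) * ?C w * coord u (Suc j)) + (\<Sum>l<d. coord u l * dds j 0 i l p w) * ?S w) +
      ((rad (Suc j) + s j 0 p w) * (e * kap (Suc j) * (- kap (Suc j) * ?S w * coord u (Suc j))) +
      (0 + (\<Sum>l<d. coord u l * ds j 0 l p w)) * (e * kap (Suc j) * ?C w))" for u
  proof -
    have "dds (Suc j) \<phi> i l p w = dds j 0 i l p w * ?S w + (if l = Suc j then ds j 0 i p w * kap (Suc j) * ?C w else 0) +
        ds j 0 l p w * (e * kap (Suc j) * ?C w) +
        (if l = Suc j then - \<rho> * e * (kap (Suc j))\<^sup>2 * ?S w else 0)" for l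
      by (auto simp: e_def \<rho>_def algebra_simps)
    then have "(\<Sum>l<d. coord u l * dds (Suc j) \<phi> i l p w) = (\<Sum>l<d. coord u l * (dds j 0 i l p w * ?S w)) +
       coord u (Suc j) * (ds j 0 i p w * kap (Suc j) * ?C w) + (\<Sum>l<d. coord u l * (ds j 0 l p w * (e * kap (Suc j) * ?C w))) +
       coord u (Suc j) * (- \<rho> * e * (kap (Suc j))\<^sup>2 * ?S w)"
      using Suc.prems by (simp only: distrib_left sum.distrib sum_if_mult)
    then show ?thesis unfolding \<rho>_def[symmetric]
      by (simp del: dds.simps add: sum_distrib_left mult_ac power2_eq_square)
  qed
  ultimately show ?case by simp
qed

lemma bounded_Ck_s: "j < d \<Longrightarrow> bounded_Ck d k (s j \<phi>)"
proof (induction j arbitrary: \<phi>)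
  case 0
  have "s 0 \<phi> = (\<lambda>p w. b 0 p (coord w 0))" by (auto simp: fun_eq_iff)
  moreover have "bounded_Ck d k (\<lambda>p w. b 0 p (coord w 0))"
  proof (rule bounded_Ck_coord[of 0 d k b])
    show "\<exists>B. \<forall>p t. \<bar>b i p t\<bar> \<le> B" if "i \<le> k" for i using b_bound[OF that] by blast
  qed (use 0 b_deriv b_cont in auto)
  ultimately show ?case by simp
next
  case (Suc j)
  define g where "g i (p :: 'p) t = kap (Suc j) ^ i * sin (kap (Suc j) * t + \<phi> + real i * (pi / 2))" for i p t
  have "bounded_Ck d k (\<lambda>p w. g 0 p (coord w (Suc j)))"
  proof (rule bounded_Ck_coord)
    fix i p t
    show "(g i p has_real_derivative g (Suc i) p t) (at t)"
      unfolding g_def[abs_def] sin_add_Suc_quarter by (auto intro!: derivative_eq_intros)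
  next
    fix i
    have "\<bar>g i p t\<bar> \<le> kap (Suc j) ^ i * 1" for p t
      unfolding g_def abs_mult using kap_pos[of "Suc j"] by (intro mult_mono) auto
    then show "\<exists>B. \<forall>p t. \<bar>g i p t\<bar> \<le> B" by blast
  next
    show "continuous_on UNIV (g k p)" for p unfolding g_def by (intro continuous_intros)
  qed (use Suc in simp)
  moreover have "s (Suc j) \<phi> = (\<lambda>p w. (rad (Suc j) + s j 0 p w) * g 0 p (coord w (Suc j)))"
    by (auto simp: g_def fun_eq_iff)
  ultimately show ?case
    using Suc by (simp only:) (intro bounded_Ck_mult bounded_Ck_add bounded_Ck_const Suc.IH, auto)
qed

text \<open>A rotation trades the last coordinate for a cosine and a sine component. By
  \<open>sin\<^sup>2 + cos\<^sup>2 = 1\<close> their contributions recombine into that of the old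
  coordinate plus, on the diagonal, the squared speed of the new rotation.\<close>

lemma gram_s: "(\<Sum>m=1..j. ds m (pi / 2) i p w * ds m (pi / 2) l p w) + ds j 0 i p w * ds j 0 l p w =
  (if i = l \<and> i \<le> j then (if i = 0 then (b 1 p (coord w 0))\<^sup>2 else ((rad i + s (i - 1) 0 p w) * kap i)\<^sup>2) else 0)"
proof (induction j)
  case 0
  then show ?case by (simp add: power2_eq_square)
next
  case (Suc j)
  let ?S = "sin (kap (Suc j) * coord w (Suc j))" and ?C = "cos (kap (Suc j) * coord w (Suc j))"
  define r where "r = (rad (Suc j) + s j 0 p w) * kap (Suc j)"
  define e :: "nat \<Rightarrow> real" where "e x = (if x = Suc j then 1 else 0)" for x
  have A: "ds (Suc j) (pi / 2) x p w = ds j 0 x p w * ?C - e x * r * ?S" for x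
    by (simp add: e_def r_def sin_add cos_add)
  have A': "ds (Suc j) 0 x p w = ds j 0 x p w * ?S + e x * r * ?C" for x
    by (simp add: e_def r_def)
  have "ds (Suc j) (pi / 2) i p w * ds (Suc j) (pi / 2) l p w + ds (Suc j) 0 i p w * ds (Suc j) 0 l p w =
      (ds j 0 i p w * ds j 0 l p w + e i * e l * r\<^sup>2) * (?S\<^sup>2 + ?C\<^sup>2)"
    unfolding A A' by algebra
  also have "\<dots> = ds j 0 i p w * ds j 0 l p w + e i * e l * r\<^sup>2" by simp
  finally have "(\<Sum>m=1..Suc j. ds m (pi / 2) i p w * ds m (pi / 2) l p w) + ds (Suc j) 0 i p w * ds (Suc j) 0 l p w =
      (\<Sum>m=1..j. ds m (pi / 2) i p w * ds m (pi / 2) l p w) + ds j 0 i p w * ds j 0 l p w + e i * e l * r\<^sup>2"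
    by (simp del: ds.simps)
  also note Suc
  finally show ?case unfolding e_def r_def by (rule trans) auto
qed

text \<open>Rotations only turn the second derivative along the profile and preserve its length, so
  the term \<open>q\<close> never picks up a dimensional factor.\<close>

lemma gram_dds: "(\<Sum>m=1..j. (dds m (pi / 2) 0 0 p w)\<^sup>2) + (dds j 0 0 0 p w)\<^sup>2 = (b 2 p (coord w 0))\<^sup>2"
proof (induction j)
  case (Suc j)
  have "(dds (Suc j) (pi / 2) 0 0 p w)\<^sup>2 + (dds (Suc j) 0 0 0 p w)\<^sup>2 = (dds j 0 0 0 p w)\<^sup>2"
    using sin_cos_squared_add[of "kap (Suc j) * coord w (Suc j)"]
    by (simp add: sin_add power_mult_distrib flip: distrib_left)
  then show ?case using Suc by simp
qed simp

text \<open>For \<open>1 \<le> m < d\<close>, component \<open>m\<close> is the cosine part of the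
  \<open>m\<close>-th rotation; component \<open>d\<close> is the sine part of the last one, or
  \<open>b\<close> itself if \<open>d = 1\<close>. Components 0 and \<open>d + 1\<close> are
  \<open>a\<close> and \<open>c\<close>.\<close>

definition level :: "nat \<Rightarrow> nat" where "level m = (if m < d then m else d - 1)"
definition phase :: "nat \<Rightarrow> real" where "phase m = (if m < d then pi / 2 else 0)"

definition cmp :: "nat \<Rightarrow> 'p \<Rightarrow> rvec \<Rightarrow> real" where
  "cmp m p w = (if m = 0 then a 0 p (coord w 0) else if m = Suc d then c 0 p (coord w 0)
     else s (level m) (phase m) p w)"

definition dcmp :: "nat \<Rightarrow> nat \<Rightarrow> 'p \<Rightarrow> rvec \<Rightarrow> real" where
  "dcmp m i p w = (if m = 0 then (if i = 0 then a 1 p (coord w 0) else 0)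
     else if m = Suc d then (if i = 0 then c 1 p (coord w 0) else 0)
     else ds (level m) (phase m) i p w)"

definition ddcmp :: "nat \<Rightarrow> nat \<Rightarrow> nat \<Rightarrow> 'p \<Rightarrow> rvec \<Rightarrow> real" where
  "ddcmp m i l p w = (if m = 0 then (if i = 0 \<and> l = 0 then a 2 p (coord w 0) else 0)
     else if m = Suc d then (if i = 0 \<and> l = 0 then c 2 p (coord w 0) else 0)
     else dds (level m) (phase m) i l p w)"

lemma level_less: "level m < d" using d_ge by (auto simp: level_def)

lemma has_derivative_coord0:
  assumes "\<And>t. (g has_real_derivative g' t) (at t)"
  shows "((\<lambda>w. g (coord w 0)) has_derivative (\<lambda>u. \<Sum>i<d. coord u i * (if i = 0 then g' (coord w 0) else 0))) (at w)"
  using has_derivative_compose[OF bounded_linear_imp_has_derivative[OF bounded_linear_coord]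
          assms[of "coord w 0", unfolded has_field_derivative_def]] d_ge
  by (simp add: sum_if_mult mult.commute)

lemma cmp_deriv: "(cmp m p has_derivative (\<lambda>u. \<Sum>i<d. coord u i * dcmp m i p w)) (at w)"
proof -
  consider "m = 0" | "m = Suc d" "m \<noteq> 0" | "m \<noteq> 0" "m \<noteq> Suc d" by blast
  then show ?thesis
  proof cases
    case 1
    then show ?thesis using has_derivative_coord0[OF a_deriv[of 0 p]] k_ge
      by (simp add: cmp_def[abs_def] dcmp_def cong: if_cong)
  next
    case 2
    then show ?thesis using has_derivative_coord0[OF c_deriv[of 0 p]] k_ge
      by (simp add: cmp_def[abs_def] dcmp_def cong: if_cong)
  next
    case 3
    then have "cmp m p = s (level m) (phase m) p" "\<And>i. dcmp m i p w = ds (level m) (phase m) i p w"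
      by (auto simp: cmp_def dcmp_def fun_eq_iff)
    then show ?thesis using s_deriv[OF level_less] by simp
  qed
qed

lemma dcmp_deriv: "(dcmp m i p has_derivative (\<lambda>u. \<Sum>l<d. coord u l * ddcmp m i l p w)) (at w)"
proof -
  consider "m = 0 \<or> m = Suc d" "i \<noteq> 0" | "m = 0" "i = 0" | "m = Suc d" "m \<noteq> 0" "i = 0" | "m \<noteq> 0" "m \<noteq> Suc d"
    by blast
  then show ?thesis
  proof cases
    case 1
    then show ?thesis by (auto simp: dcmp_def[abs_def] ddcmp_def)
  next
    case 2
    then show ?thesis using has_derivative_coord0[OF a_deriv[of 1 p]] k_ge
      by (simp add: dcmp_def[abs_def] ddcmp_def numeral_2_eq_2 cong: if_cong)
  next
    case 3
    then show ?thesis using has_derivative_coord0[OF c_deriv[of 1 p]] k_ge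
      by (simp add: dcmp_def[abs_def] ddcmp_def numeral_2_eq_2 cong: if_cong)
  next
    case 4
    then have "dcmp m i p = ds (level m) (phase m) i p" "\<And>l. ddcmp m i l p w = dds (level m) (phase m) i l p w"
      by (auto simp: dcmp_def ddcmp_def fun_eq_iff)
    then show ?thesis using ds_deriv[OF level_less] by simp
  qed
qed

lemma bounded_Ck_cmp: "bounded_Ck d k (cmp m)"
proof -
  consider "m = 0" | "m = Suc d" "m \<noteq> 0" | "m \<noteq> 0" "m \<noteq> Suc d" by blast
  then show ?thesis
  proof cases
    case 1
    have "bounded_Ck d k (\<lambda>p w. a 0 p (coord w 0))"
    proof (rule bounded_Ck_coord[of 0 d k a])
      show "\<exists>B. \<forall>p t. \<bar>a i p t\<bar> \<le> B" if "i \<le> k" for i using a_bound[OF that] by blast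
    qed (use d_ge a_deriv a_cont in auto)
    then show ?thesis using 1 by (simp add: cmp_def[abs_def])
  next
    case 2
    have "bounded_Ck d k (\<lambda>p w. c 0 p (coord w 0))"
    proof (rule bounded_Ck_coord[of 0 d k c])
      show "\<exists>B. \<forall>p t. \<bar>c i p t\<bar> \<le> B" if "i \<le> k" for i using c_bound[OF that] by blast
    qed (use d_ge c_deriv c_cont in auto)
    then show ?thesis using 2 by (simp add: cmp_def[abs_def])
  next
    case 3
    then have "cmp m = s (level m) (phase m)" by (auto simp: cmp_def fun_eq_iff)
    then show ?thesis using bounded_Ck_s[OF level_less] by simp
  qed
qed

lemma sum_components: "(\<Sum>m<d + 2. f m) = f 0 + ((\<Sum>m=1..d - 1. f m) + f d) + f (Suc d)" for f :: "nat \<Rightarrow> real"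
proof -
  have "(\<Sum>m<d + 2. f m) = (\<Sum>m<d. f m) + f d + f (Suc d)" by simp
  also have "{..<d} = insert 0 {1..d - 1}" using d_ge by auto
  finally show ?thesis by (simp add: add_ac)
qed

lemma gram: "i < d \<Longrightarrow> l < d \<Longrightarrow> (\<Sum>m<d + 2. dcmp m i p w * dcmp m l p w) =
  (if i = l then (if i = 0 then (a 1 p (coord w 0))\<^sup>2 + (b 1 p (coord w 0))\<^sup>2 + (c 1 p (coord w 0))\<^sup>2
     else ((rad i + s (i - 1) 0 p w) * kap i)\<^sup>2) else 0)"
proof -
  assume il: "i < d" "l < d"
  have "(\<Sum>m=1..d - 1. dcmp m i p w * dcmp m l p w) + dcmp d i p w * dcmp d l p w =
      (\<Sum>m=1..d - 1. ds m (pi / 2) i p w * ds m (pi / 2) l p w) + ds (d - 1) 0 i p w * ds (d - 1) 0 l p w"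
  proof (intro arg_cong2[where f = "(+)"])
    show "(\<Sum>m=1..d - 1. dcmp m i p w * dcmp m l p w) = (\<Sum>m=1..d - 1. ds m (pi / 2) i p w * ds m (pi / 2) l p w)"
      using d_ge by (intro sum.cong) (auto simp: dcmp_def level_def phase_def)
  qed (use d_ge in \<open>auto simp: dcmp_def level_def phase_def\<close>)
  then show ?thesis
    unfolding sum_components gram_s using il d_ge
    by (auto simp: dcmp_def power2_eq_square)
qed

lemma gram_dd: "(\<Sum>m<d + 2. (ddcmp m 0 0 p w)\<^sup>2) =
   (a 2 p (coord w 0))\<^sup>2 + (b 2 p (coord w 0))\<^sup>2 + (c 2 p (coord w 0))\<^sup>2"
proof -
  have "(\<Sum>m=1..d - 1. (ddcmp m 0 0 p w)\<^sup>2) + (ddcmp d 0 0 p w)\<^sup>2 =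
      (\<Sum>m=1..d - 1. (dds m (pi / 2) 0 0 p w)\<^sup>2) + (dds (d - 1) 0 0 0 p w)\<^sup>2"
  proof (intro arg_cong2[where f = "(+)"])
    show "(\<Sum>m=1..d - 1. (ddcmp m 0 0 p w)\<^sup>2) = (\<Sum>m=1..d - 1. (dds m (pi / 2) 0 0 p w)\<^sup>2)"
      using d_ge by (intro sum.cong) (auto simp: ddcmp_def level_def phase_def)
  qed (use d_ge in \<open>auto simp: ddcmp_def level_def phase_def\<close>)
  then show ?thesis
    unfolding sum_components gram_dds by (simp add: ddcmp_def)
qed

end

lemma polar_eqD:
  fixes r r' :: real
  assumes "0 < r" "0 < r'" "r * sin x = r' * sin y" "r * cos x = r' * cos y"
  shows "r = r'" "\<exists>n::int. y = x + 2 * pi * n"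
proof -
  have "r\<^sup>2 * ((sin x)\<^sup>2 + (cos x)\<^sup>2) = r'\<^sup>2 * ((sin y)\<^sup>2 + (cos y)\<^sup>2)"
    using arg_cong[OF assms(3), of "\<lambda>z. z\<^sup>2"] arg_cong[OF assms(4), of "\<lambda>z. z\<^sup>2"]
    by (simp only: power_mult_distrib distrib_left)
  then show "r = r'" using assms(1,2) by (simp add: power2_eq_iff_nonneg)
  then have "sin y = sin x \<and> cos y = cos x" using assms by auto
  then show "\<exists>n::int. y = x + 2 * pi * n" by (simp add: sin_cos_eq_iff)
qed

context nested_torus
begin

text \<open>One choice serves all parameters \<open>p\<close>; hence \<open>bnd\<close> does not
  depend on the width of the bump.\<close>

definition cmp_differentials :: "nat \<Rightarrow> ('p \<Rightarrow> rvec list \<Rightarrow> rvec \<Rightarrow> real) \<times> real" where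
  "cmp_differentials m = (SOME FB. bounded_differentials d k (cmp m) (fst FB) (snd FB))"

definition torus_diff :: "'p \<Rightarrow> rvec list \<Rightarrow> rvec \<Rightarrow> rvec" where
  "torus_diff p us w = rvec_of (d + 2) (\<lambda>m. fst (cmp_differentials m) p us w)"

definition bnd :: real where "bnd = (\<Sum>m<d + 2. \<bar>snd (cmp_differentials m)\<bar>)"

lemma cmp_differentials: "bounded_differentials d k (cmp m) (fst (cmp_differentials m)) (snd (cmp_differentials m))"
proof -
  obtain F B' where "bounded_differentials d k (cmp m) F B'"
    using bounded_Ck_differentials[OF bounded_Ck_cmp] by blast
  then show ?thesis unfolding cmp_differentials_def
    by (intro someI[of "\<lambda>FB. bounded_differentials d k (cmp m) (fst FB) (snd FB)" "(F, B')"]) simp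
qed

lemma torus_diff_deriv: "length us < k \<Longrightarrow> (torus_diff p us has_derivative (\<lambda>u. torus_diff p (u # us) w)) (at w)"
  unfolding torus_diff_def[abs_def] by (intro has_derivative_rvec_of bounded_differentialsD(2)[OF cmp_differentials])

lemma torus_diff_cont: "length us = k \<Longrightarrow> continuous_on UNIV (torus_diff p us)"
  unfolding torus_diff_def[abs_def] by (intro continuous_on_rvec_of bounded_differentialsD(3)[OF cmp_differentials])

lemma torus_diff_trunc: "length us < k \<Longrightarrow> torus_diff p (rvec_of d (coord u) # us) w = torus_diff p (u # us) w"
  unfolding torus_diff_def by (simp add: bounded_differentialsD(4)[OF cmp_differentials])

lemma torus_diff_bound: "length us \<le> k \<Longrightarrow> (\<forall>u\<in>set us. norm u \<le> 1) \<Longrightarrow> norm (torus_diff p us w) \<le> bnd"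
proof -
  assume us: "length us \<le> k" "\<forall>u\<in>set us. norm u \<le> 1"
  have "norm (torus_diff p us w) \<le> (\<Sum>m<d + 2. \<bar>fst (cmp_differentials m) p us w\<bar>)"
    unfolding torus_diff_def by (rule norm_rvec_of_le)
  also have "\<dots> \<le> bnd"
    unfolding bnd_def
  proof (rule sum_mono)
    fix m
    show "\<bar>fst (cmp_differentials m) p us w\<bar> \<le> \<bar>snd (cmp_differentials m)\<bar>"
      using bounded_differentialsD(5)[OF cmp_differentials us, of m p w] by simp
  qed
  finally show ?thesis .
qed

lemma torus_diff0: "torus_diff p [] w = rvec_of (d + 2) (\<lambda>m. cmp m p w)"
  by (simp add: torus_diff_def bounded_differentialsD(1)[OF cmp_differentials])

lemma torus_diff1: "torus_diff p [u] w = rvec_of (d + 2) (\<lambda>m. \<Sum>i<d. coord u i * dcmp m i p w)"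
proof -
  have "(torus_diff p [] has_derivative (\<lambda>u. rvec_of (d + 2) (\<lambda>m. \<Sum>i<d. coord u i * dcmp m i p w))) (at w)"
    unfolding torus_diff0[abs_def] by (intro has_derivative_rvec_of cmp_deriv)
  from has_derivative_unique[OF torus_diff_deriv[of "[]" p w] this] k_ge show ?thesis
    by (simp add: fun_eq_iff)
qed

lemma torus_diff2: "torus_diff p [u, v] w = rvec_of (d + 2) (\<lambda>m. \<Sum>i<d. coord v i * (\<Sum>l<d. coord u l * ddcmp m i l p w))"
proof -
  have "(torus_diff p [v] has_derivative
      (\<lambda>u. rvec_of (d + 2) (\<lambda>m. \<Sum>i<d. coord v i * (\<Sum>l<d. coord u l * ddcmp m i l p w)))) (at w)"
    unfolding torus_diff1[abs_def]
    by (intro has_derivative_rvec_of has_derivative_sum has_derivative_mult_right dcmp_deriv)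
  from has_derivative_unique[OF torus_diff_deriv[of "[v]" p w] this] k_ge show ?thesis
    by (simp add: fun_eq_iff)
qed

lemma torus_diff_scale: "length us < k \<Longrightarrow> torus_diff p (x *\<^sub>R u # us) w = x *\<^sub>R torus_diff p (u # us) w"
  by (rule linear_scale[OF bounded_linear.linear[OF has_derivative_bounded_linear[OF torus_diff_deriv]]])

lemma torus_diff1_uvec: "i < d \<Longrightarrow> torus_diff p [uvec i] w = rvec_of (d + 2) (\<lambda>m. dcmp m i p w)"
proof -
  assume i: "i < d"
  have "(\<Sum>l<d. coord (uvec i) l * dcmp m l p w) = (\<Sum>l<d. if l = i then dcmp m i p w else 0)" for m
    by (intro sum.cong) auto
  then show ?thesis using i by (simp add: torus_diff1)
qed

lemma torus_diff1_inner: "i < d \<Longrightarrow> l < d \<Longrightarrow> torus_diff p [uvec i] w \<bullet> torus_diff p [uvec l] w = (\<Sum>m<d + 2. dcmp m i p w * dcmp m l p w)"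
  unfolding torus_diff1_uvec by (subst inner_Rn[of _ "d + 2"]) auto

lemma torus_diff1_orth: "i < d \<Longrightarrow> l < d \<Longrightarrow> i \<noteq> l \<Longrightarrow> torus_diff p [uvec i] w \<bullet> torus_diff p [uvec l] w = 0"
  unfolding torus_diff1_inner gram by simp

lemma torus_diff1_norm: "i < d \<Longrightarrow> 1 \<le> norm (torus_diff p [uvec i] w)"
proof -
  assume i: "i < d"
  have "1\<^sup>2 \<le> (norm (torus_diff p [uvec i] w))\<^sup>2"
  proof (cases i)
    case 0
    then show ?thesis using i speed[where p = p and t = "coord w 0"]
      unfolding power2_norm_eq_inner torus_diff1_inner[OF i i] gram[OF i i] by simp
  next
    case (Suc j)
    have "1\<^sup>2 \<le> ((rad (Suc j) + s j 0 p w) * kap (Suc j))\<^sup>2"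
      using rad_s_kap(1)[of j p w] by (intro power_mono) auto
    then show ?thesis
      unfolding power2_norm_eq_inner torus_diff1_inner[OF i i] gram[OF i i] using Suc by simp
  qed
  then show ?thesis by (rule power2_le_imp_le) simp
qed

text \<open>Only the entry with both directions along the profile is large, and for it the Euclidean
  bound \<open>q\<close> is available. All other entries are estimated crudely, component by
  component, by the small constant \<open>K\<close>.\<close>

lemma torus_diff2_norm: "norm u \<le> 1 \<Longrightarrow> norm v \<le> 1 \<Longrightarrow> norm (torus_diff p [u, v] w) \<le> 1"
proof -
  assume uv: "norm u \<le> 1" "norm v \<le> 1"
  define V where "V i l = rvec_of (d + 2) (\<lambda>m. ddcmp m i l p w)" for i l
  define K where "K = (real d + 2) * (6 * B / R)"
  have K: "0 \<le> K" using B_ge R_pos by (simp add: K_def)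
  have "torus_diff p [u, v] w = (\<Sum>i<d. \<Sum>l<d. (coord v i * coord u l) *\<^sub>R V i l)"
    unfolding torus_diff2 V_def by (intro rvec_eqI) (simp add: coord_sum sum_distrib_left mult.assoc)
  also have "norm \<dots> \<le> (\<Sum>i<d. norm (\<Sum>l<d. (coord v i * coord u l) *\<^sub>R V i l))"
    by (rule norm_sum)
  also have "\<dots> \<le> (\<Sum>i<d. \<Sum>l<d. norm ((coord v i * coord u l) *\<^sub>R V i l))"
    by (intro sum_mono norm_sum)
  also have "\<dots> \<le> (\<Sum>i<d. \<Sum>l<d. (if i = 0 then if l = 0 then q else 0 else 0) + K)"
  proof (intro sum_mono)
    fix i l
    have "norm ((coord v i * coord u l) *\<^sub>R V i l) \<le> (1 * 1) * norm (V i l)"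
      unfolding norm_scaleR abs_mult using order_trans[OF abs_coord_le_norm uv(2)] order_trans[OF abs_coord_le_norm uv(1)]
      by (intro mult_right_mono mult_mono) auto
    also have "\<dots> \<le> (if i = 0 then if l = 0 then q else 0 else 0) + K"
    proof (cases "i = 0 \<and> l = 0")
      case True
      have "(norm (V 0 0))\<^sup>2 = (\<Sum>m<d + 2. (ddcmp m 0 0 p w)\<^sup>2)"
        unfolding power2_norm_eq_inner V_def by (subst inner_Rn[of _ "d + 2"]) (auto simp: power2_eq_square)
      also have "\<dots> \<le> q\<^sup>2" unfolding gram_dd by (rule curv)
      finally have "norm (V 0 0) \<le> q" using q_nonneg by (rule power2_le_imp_le)
      then show ?thesis using True K by simp
    next
      case False
      have "norm (V i l) \<le> (\<Sum>m<d + 2. \<bar>ddcmp m i l p w\<bar>)"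
        unfolding V_def by (rule norm_rvec_of_le)
      also have "\<dots> \<le> (\<Sum>m<d + 2. 6 * B / R)"
      proof (rule sum_mono)
        fix m
        show "\<bar>ddcmp m i l p w\<bar> \<le> 6 * B / R"
          using dds_bound[of i l "level m" "phase m" p w] False B_ge R_pos by (auto simp: ddcmp_def)
      qed
      also have "\<dots> = K" by (simp add: K_def)
      finally show ?thesis using False q_nonneg by auto
    qed
    finally show "norm ((coord v i * coord u l) *\<^sub>R V i l) \<le> (if i = 0 then if l = 0 then q else 0 else 0) + K" .
  qed
  also have "\<dots> = q + real d * real d * K"
  proof -
    have "(\<Sum>i<d. \<Sum>l<d. (if i = 0 then if l = 0 then q else 0 else 0)) = (\<Sum>i<d. if i = 0 then q else 0)"
      using d_ge by (intro sum.cong) auto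
    then show ?thesis using d_ge by (simp add: sum.distrib)
  qed
  also have "\<dots> \<le> 1" using R_large by (simp add: K_def mult.assoc)
  finally show ?thesis .
qed

section \<open>Periods, injectivity modulo periods, and scaling\<close>

definition prd :: "nat \<Rightarrow> real" where "prd j = (if j = 0 then T0 else 2 * pi / kap j)"

lemma prd_pos: "0 < prd j"
  using T0_pos kap_pos[of j] by (simp add: prd_def)

lemma angle_period_iff:
  "(\<exists>m::int. kap (Suc j) * y = kap (Suc j) * x + 2 * pi * m) \<longleftrightarrow> (\<exists>m::int. y = x + m * prd (Suc j))"
  using kap_pos[of "Suc j"] by (simp add: prd_def field_simps)

text \<open>Rotations are undone from the outermost inwards: with positive radii, the cosine and
  sine parts determine the radius, hence the inner coordinate, and the angle up to its period. What
  remains is injectivity of the profile curve.\<close>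

lemma torus_diff0_eq_iff: "torus_diff p [] w = torus_diff p [] w' \<longleftrightarrow> (\<forall>j<d. \<exists>m::int. coord w' j = coord w j + m * prd j)"
proof
  assume eq: "torus_diff p [] w = torus_diff p [] w'"
  have c: "cmp m p w = cmp m p w'" if "m < d + 2" for m
    using arg_cong[OF eq, of "\<lambda>x. coord x m"] that by (simp add: torus_diff0)
  have step: "s j 0 p w = s j 0 p w' \<and> (\<exists>n::int. coord w' (Suc j) = coord w (Suc j) + n * prd (Suc j))"
    if j: "Suc j < d" and sj: "s (Suc j) 0 p w = s (Suc j) 0 p w'" for j
  proof -
    have cj: "s (Suc j) (pi / 2) p w = s (Suc j) (pi / 2) p w'"
      using c[of "Suc j"] j by (simp add: cmp_def level_def phase_def)
    have sn: "(rad (Suc j) + s j 0 p w) * sin (kap (Suc j) * coord w (Suc j)) =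
        (rad (Suc j) + s j 0 p w') * sin (kap (Suc j) * coord w' (Suc j))"
      using sj by simp
    have cs: "(rad (Suc j) + s j 0 p w) * cos (kap (Suc j) * coord w (Suc j)) =
        (rad (Suc j) + s j 0 p w') * cos (kap (Suc j) * coord w' (Suc j))"
      using cj by (simp add: sin_add)
    from polar_eqD[OF rad_s_pos rad_s_pos sn cs] show ?thesis
      by (simp add: angle_period_iff)
  qed
  have top: "s (d - 1) 0 p w = s (d - 1) 0 p w'"
    using c[of d] d_ge by (simp add: cmp_def level_def phase_def)
  \<comment> \<open>Downward induction on the level. Natural subtraction saturates at 0, so large
    \<open>i\<close> form a separate case.\<close>
  have all: "s (d - 1 - i) 0 p w = s (d - 1 - i) 0 p w'" for i
  proof (induction i)
    case (Suc i)
    show ?case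
    proof (cases "i < d - 1")
      case True
      then have "d - 1 - i = Suc (d - 1 - Suc i)" "Suc (d - 1 - Suc i) < d" by auto
      then show ?thesis using step[of "d - 1 - Suc i"] Suc by metis
    next
      case False
      then have "d - 1 - Suc i = d - 1 - i" by simp
      then show ?thesis using Suc by simp
    qed
  qed (use top in simp)
  have s_eq: "s j 0 p w = s j 0 p w'" if "j < d" for j
    using all[of "d - 1 - j"] that by simp
  show "\<forall>j<d. \<exists>m::int. coord w' j = coord w j + m * prd j"
  proof (intro allI impI)
    fix j assume j: "j < d"
    show "\<exists>m::int. coord w' j = coord w j + m * prd j"
    proof (cases j)
      case 0
      have "a 0 p (coord w 0) = a 0 p (coord w' 0)" "c 0 p (coord w 0) = c 0 p (coord w' 0)"
        "b 0 p (coord w 0) = b 0 p (coord w' 0)"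
        using c[of 0] c[of "Suc d"] s_eq[of 0] d_ge by (auto simp: cmp_def)
      then show ?thesis using curve_eq_iff[where p = p and t = "coord w 0" and t' = "coord w' 0"] 0
        by (simp add: prd_def)
    next
      case (Suc i)
      then show ?thesis using step[of i] s_eq[of j] j by simp
    qed
  qed
next
  assume per: "\<forall>j<d. \<exists>m::int. coord w' j = coord w j + m * prd j"
  have abc: "a 0 p (coord w 0) = a 0 p (coord w' 0) \<and> b 0 p (coord w 0) = b 0 p (coord w' 0) \<and>
      c 0 p (coord w 0) = c 0 p (coord w' 0)"
    using per d_ge curve_eq_iff[where p = p and t = "coord w 0" and t' = "coord w' 0"]
    by (auto simp: prd_def)
  have "s j \<phi> p w = s j \<phi> p w'" if "j < d" for j \<phi>
    using that
  proof (induction j arbitrary: \<phi>)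
    case (Suc j)
    obtain n :: int where "kap (Suc j) * coord w' (Suc j) = kap (Suc j) * coord w (Suc j) + 2 * pi * n"
      using per Suc.prems angle_period_iff[of j "coord w' (Suc j)" "coord w (Suc j)"] by blast
    then have "kap (Suc j) * coord w' (Suc j) + \<phi> = (kap (Suc j) * coord w (Suc j) + \<phi>) + 2 * pi * n"
      by simp
    then have "sin (kap (Suc j) * coord w' (Suc j) + \<phi>) = sin (kap (Suc j) * coord w (Suc j) + \<phi>)"
      using sin_cos_eq_iff by blast
    then show ?case using Suc by simp
  qed (use abc in simp)
  then have "cmp m p w = cmp m p w'" for m
    using abc level_less by (simp add: cmp_def)
  then show "torus_diff p [] w = torus_diff p [] w'" by (simp add: torus_diff0)
qed

text \<open>The translate by \<open>x0\<close> of the torus shrunk by \<open>lam\<close> and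
  reparametrised at unchanged speed; the differential of order \<open>i\<close> gets the factor
  \<open>lam ^ (i - 1)\<close>, written as a quotient so that \<open>i = 0\<close> gives
  \<open>1 / lam\<close>.\<close>

definition scaled_torus :: "real \<Rightarrow> rvec \<Rightarrow> 'p \<Rightarrow> rvec list \<Rightarrow> rvec \<Rightarrow> rvec" where
  "scaled_torus lam x0 p us w = (if us = [] then x0 else 0) + (lam ^ length us / lam) *\<^sub>R torus_diff p us (lam *\<^sub>R w)"

text \<open>First derivatives are invariant under the scaling, and second derivatives pass from at
  most 1 to at most \<open>lam\<close>. If \<open>c\<close> vanishes, the last component drops out
  and codimension 1 suffices.\<close>

lemma torus_immersion_scaled:
  assumes lam: "0 < lam" and L: "\<And>i. 3 \<le> i \<Longrightarrow> i \<le> k \<Longrightarrow> bnd * lam ^ (i - 1) \<le> L i"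
    and x0: "x0 \<in> Rn D" and D: "d + 2 \<le> D \<or> (d + 1 \<le> D \<and> (\<forall>t. c 0 p t = 0))"
  shows "torus_immersion d D k lam L (scaled_torus lam x0 p) (\<lambda>j. prd j / lam)"
proof
  show "1 \<le> d" by (rule d_ge)
  show "2 \<le> k" by (rule k_ge)
  show "0 < lam" by (rule lam)
  show "scaled_torus lam x0 p [] w \<in> Rn D" for w
  proof -
    have "torus_diff p [] (lam *\<^sub>R w) \<in> Rn D"
    proof (cases "d + 2 \<le> D")
      case True
      then show ?thesis unfolding torus_diff0 by (rule subsetD[OF Rn_mono rvec_of_in_Rn])
    next
      case False
      then have "D = Suc d" "cmp (Suc d) p (lam *\<^sub>R w) = 0" using D by (auto simp: cmp_def)
      then show ?thesis by (auto simp: torus_diff0 Rn_def le_Suc_eq less_Suc_eq)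
    qed
    then show ?thesis unfolding scaled_torus_def using x0
      by (auto intro!: subspace_add[OF subspace_Rn] subspace_scale[OF subspace_Rn])
  qed
  show "(scaled_torus lam x0 p us has_derivative (\<lambda>u. scaled_torus lam x0 p (u # us) w)) (at w)" if us: "length us < k" for us w
  proof -
    have "((\<lambda>w. lam *\<^sub>R w) has_derivative (\<lambda>u. lam *\<^sub>R u)) (at w)" by (auto intro!: derivative_eq_intros)
    from has_derivative_compose[OF this torus_diff_deriv[OF us]]
    have "((\<lambda>w. torus_diff p us (lam *\<^sub>R w)) has_derivative (\<lambda>u. lam *\<^sub>R torus_diff p (u # us) (lam *\<^sub>R w))) (at w)"
      by (simp add: torus_diff_scale[OF us])
    from has_derivative_add[OF has_derivative_const has_derivative_scaleR_right[OF this], of "if us = [] then x0 else 0" "lam ^ length us / lam"]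
    show ?thesis by (simp add: scaled_torus_def[abs_def] mult.commute)
  qed
  show "continuous_on UNIV (scaled_torus lam x0 p us)" if "length us = k" for us
    unfolding scaled_torus_def[abs_def]
    by (intro continuous_intros continuous_on_compose2[OF torus_diff_cont[OF that]]) auto
  show "scaled_torus lam x0 p (rvec_of d (coord u) # us) w = scaled_torus lam x0 p (u # us) w" if "length us < k" for us u w
    by (simp add: scaled_torus_def torus_diff_trunc[OF that])
  show "scaled_torus lam x0 p [uvec i] w \<bullet> scaled_torus lam x0 p [uvec j] w = 0" if "i < d" "j < d" "i \<noteq> j" for i j w
    using that by (simp add: scaled_torus_def torus_diff1_orth)
  show "1 \<le> norm (scaled_torus lam x0 p [uvec i] w)" if "i < d" for i w
    using that lam by (simp add: scaled_torus_def torus_diff1_norm)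
  show "norm (scaled_torus lam x0 p [u, v] w) \<le> lam" if "norm u \<le> 1" "norm v \<le> 1" for u v w
    using mult_left_mono[OF torus_diff2_norm[OF that, of p "lam *\<^sub>R w"], of lam] lam
    by (simp add: scaled_torus_def)
  show "norm (scaled_torus lam x0 p us w) \<le> L (length us)"
    if us: "3 \<le> length us" "length us \<le> k" "\<forall>u\<in>set us. norm u \<le> 1" for us w
  proof -
    have "us \<noteq> []" using us by auto
    have "lam ^ length us / lam = lam ^ (length us - 1)"
      using lam us by (cases us) auto
    then have "norm (scaled_torus lam x0 p us w) = lam ^ (length us - 1) * norm (torus_diff p us (lam *\<^sub>R w))"
      using \<open>us \<noteq> []\<close> lam by (simp add: scaled_torus_def)
    also have "\<dots> \<le> lam ^ (length us - 1) * bnd"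
      using torus_diff_bound[OF us(2,3)] lam by (intro mult_left_mono) auto
    also have "\<dots> \<le> L (length us)" using L[OF us(1,2)] by (simp add: mult.commute)
    finally show ?thesis .
  qed
  show "0 < prd j / lam" if "j < d" for j using prd_pos lam by simp
  show "scaled_torus lam x0 p [] w = scaled_torus lam x0 p [] w' \<longleftrightarrow> (\<forall>j<d. \<exists>m::int. coord w' j = coord w j + m * (prd j / lam))" for w w'
  proof -
    have "scaled_torus lam x0 p [] w = scaled_torus lam x0 p [] w' \<longleftrightarrow> torus_diff p [] (lam *\<^sub>R w) = torus_diff p [] (lam *\<^sub>R w')"
      using lam by (simp add: scaled_torus_def)
    also have "\<dots> \<longleftrightarrow> (\<forall>j<d. \<exists>m::int. lam * coord w' j = lam * coord w j + m * prd j)"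
      by (simp add: torus_diff0_eq_iff)
    also have "\<dots> \<longleftrightarrow> (\<forall>j<d. \<exists>m::int. coord w' j = coord w j + m * (prd j / lam))"
      using lam by (simp add: field_simps)
    finally show ?thesis .
  qed
qed

end


section \<open>Two surfaces through a common point\<close>

text \<open>The range contains both \<open>\<tau>\<close> and \<open>\<tau> - pi\<close> for
  \<open>\<tau>\<close> between \<open>- pi / 2\<close> and \<open>3 * pi / 2\<close>, which is how
  it will be used. Past \<open>pi\<close> the cosine is no longer monotone, but it is not positive
  there.\<close>

lemma abs_le_of_cos_gt:
  assumes "\<bar>x\<bar> \<le> 3 * pi / 2" "0 < e" "e < pi / 2" "cos e < cos x"
  shows "\<bar>x\<bar> \<le> e"
proof (rule ccontr)
  assume "\<not> \<bar>x\<bar> \<le> e"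
  then have x: "e \<le> \<bar>x\<bar>" by simp
  have "cos \<bar>x\<bar> \<le> cos e"
  proof (cases "\<bar>x\<bar> \<le> pi")
    case True
    then show ?thesis using x assms by (intro cos_monotone_0_pi_le) auto
  next
    case False
    have "0 \<le> cos (\<bar>x\<bar> - pi)" using False assms by (intro cos_ge_zero) auto
    then have "cos \<bar>x\<bar> \<le> 0" by (simp add: cos_diff)
    also have "0 \<le> cos e" using assms by (intro cos_ge_zero) auto
    finally show ?thesis .
  qed
  then show False using assms by simp
qed

context nested_torus
begin

text \<open>Where all rotation angles are 0, the profile coordinates \<open>a\<close>,
  \<open>b\<close>, \<open>c\<close> sit in components 0, 1 and \<open>d + 1\<close>, and the other
  components are constant. The image of the origin of the profile is \<open>center\<close>.\<close>

definition vec3 :: "real \<Rightarrow> real \<Rightarrow> real \<Rightarrow> rvec" where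
  "vec3 x y z = rvec_of (d + 2) (\<lambda>m. if m = 0 then x else if m = 1 then y else if m = Suc d then z else 0)"

definition center :: rvec where
  "center = rvec_of d (\<lambda>m. if 1 \<le> m then rad m else 0)"

lemma s_axis: "s (Suc j) \<phi> p (t *\<^sub>R uvec 0) = (rad (Suc j) + s j 0 p (t *\<^sub>R uvec 0)) * sin \<phi>"
  by simp

lemma s_axis_0: "s j 0 p (t *\<^sub>R uvec 0) = (if j = 0 then b 0 p t else 0)"
  by (cases j) auto

lemma ds_axis_0: "ds j 0 0 p (t *\<^sub>R uvec 0) = (if j = 0 then b 1 p t else 0)"
  by (cases j) auto

lemma dds_axis_0: "dds j 0 0 0 p (t *\<^sub>R uvec 0) = (if j = 0 then b 2 p t else 0)"
  by (cases j) auto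

lemma ds_axis: "ds (Suc j) (pi / 2) 0 p (t *\<^sub>R uvec 0) = (if j = 0 then b 1 p t else 0)"
  by (cases j) auto

lemma dds_axis: "dds (Suc j) (pi / 2) 0 0 p (t *\<^sub>R uvec 0) = (if j = 0 then b 2 p t else 0)"
  by (cases j) auto

lemma torus_diff0_axis:
  assumes "a 0 p t = 0" "b 0 p t = 0" "c 0 p t = 0"
  shows "torus_diff p [] (t *\<^sub>R uvec 0) = center"
proof (rule rvec_eqI)
  fix m
  have "cmp m p (t *\<^sub>R uvec 0) = (if 1 \<le> m \<and> m < d then rad m else 0)" if m: "m < d + 2"
  proof -
    consider "m = 0 \<or> m = Suc d" | "1 \<le> m" "m < d" | "m = d" "1 \<le> m" using m d_ge by force
    then show ?thesis
    proof cases
      case 2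
      then obtain j where "m = Suc j" by (cases m) auto
      with 2 show ?thesis using assms by (simp add: cmp_def level_def phase_def s_axis_0 del: s.simps add: s_axis)
    next
      case 3
      then show ?thesis using assms by (simp add: cmp_def level_def phase_def s_axis_0 del: s.simps)
    qed (use assms in \<open>auto simp: cmp_def\<close>)
  qed
  then show "coord (torus_diff p [] (t *\<^sub>R uvec 0)) m = coord center m"
    by (auto simp: torus_diff0 center_def)
qed

lemma dcmp_axis: "m < d + 2 \<Longrightarrow> dcmp m 0 p (t *\<^sub>R uvec 0) =
   (if m = 0 then a 1 p t else if m = 1 then b 1 p t else if m = Suc d then c 1 p t else 0)"
proof -
  assume "m < d + 2"
  then consider "m = 0 \<or> m = Suc d" | "1 \<le> m" "m < d" | "m = d" "1 \<le> m" using d_ge by force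
  then show ?thesis
  proof cases
    case 2
    then obtain j where "m = Suc j" by (cases m) auto
    with 2 show ?thesis by (simp add: dcmp_def level_def phase_def ds_axis del: ds.simps)
  next
    case 3
    then show ?thesis by (auto simp add: dcmp_def level_def phase_def ds_axis_0 simp del: ds.simps)
  qed (use d_ge in \<open>auto simp: dcmp_def\<close>)
qed

lemma ddcmp_axis: "m < d + 2 \<Longrightarrow> ddcmp m 0 0 p (t *\<^sub>R uvec 0) =
   (if m = 0 then a 2 p t else if m = 1 then b 2 p t else if m = Suc d then c 2 p t else 0)"
proof -
  assume "m < d + 2"
  then consider "m = 0 \<or> m = Suc d" | "1 \<le> m" "m < d" | "m = d" "1 \<le> m" using d_ge by force
  then show ?thesis
  proof cases
    case 2
    then obtain j where "m = Suc j" by (cases m) auto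
    with 2 show ?thesis by (simp add: ddcmp_def level_def phase_def dds_axis del: dds.simps)
  next
    case 3
    then show ?thesis by (auto simp add: ddcmp_def level_def phase_def dds_axis_0 simp del: dds.simps)
  qed (use d_ge in \<open>auto simp: ddcmp_def\<close>)
qed

lemma torus_diff1_axis: "torus_diff p [uvec 0] (t *\<^sub>R uvec 0) = vec3 (a 1 p t) (b 1 p t) (c 1 p t)"
  using d_ge by (intro rvec_eqI) (simp add: torus_diff1_uvec vec3_def dcmp_axis)

lemma torus_diff2_axis: "torus_diff p [uvec 0, uvec 0] (t *\<^sub>R uvec 0) = vec3 (a 2 p t) (b 2 p t) (c 2 p t)"
proof (rule rvec_eqI)
  fix m
  have "(\<Sum>i<d. coord (uvec 0) i * (\<Sum>l<d. coord (uvec 0) l * ddcmp m i l p w)) = ddcmp m 0 0 p w" for w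
  proof -
    have "(\<Sum>l<d. coord (uvec 0) l * ddcmp m i l p w) = (\<Sum>l<d. if l = 0 then ddcmp m i 0 p w else 0)" for i
      by (intro sum.cong) auto
    then have "(\<Sum>i<d. coord (uvec 0) i * (\<Sum>l<d. coord (uvec 0) l * ddcmp m i l p w)) =
        (\<Sum>i<d. if i = 0 then ddcmp m 0 0 p w else 0)"
      using d_ge by (intro sum.cong) auto
    then show ?thesis using d_ge by simp
  qed
  then show "coord (torus_diff p [uvec 0, uvec 0] (t *\<^sub>R uvec 0)) m = coord (vec3 (a 2 p t) (b 2 p t) (c 2 p t)) m"
    using ddcmp_axis[of m p t] by (simp add: torus_diff2 vec3_def)
qed

lemma inner_vec3: "vec3 x y z \<bullet> v = x * coord v 0 + y * coord v 1 + z * coord v (Suc d)"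
proof -
  have "vec3 x y z \<bullet> v = (\<Sum>m<d + 2. (if m = 0 then x else if m = 1 then y else if m = Suc d then z else 0) * coord v m)"
    by (subst inner_Rn[of _ "d + 2"]) (auto simp: vec3_def intro!: sum.cong)
  also have "\<dots> = (\<Sum>m\<in>{0, 1, Suc d}. (if m = 0 then x else if m = 1 then y else if m = Suc d then z else 0) * coord v m)"
    by (rule sum.mono_neutral_right) (use d_ge in auto)
  also have "\<dots> = x * coord v 0 + y * coord v 1 + z * coord v (Suc d)"
    using d_ge by simp
  finally show ?thesis .
qed

text \<open>At angle 0 a rotation moves its sine part and leaves its cosine part stationary, so
  components 0, 1 and \<open>d + 1\<close> do not change in the rotation directions.\<close>

lemma torus_diff1_axis_orth:
  assumes "1 \<le> i" "i < d"
  shows "torus_diff p [uvec i] (t *\<^sub>R uvec 0) \<bullet> vec3 x y z = 0"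
proof -
  have "dcmp m i p (t *\<^sub>R uvec 0) = 0" if "m = 0 \<or> m = 1 \<or> m = Suc d" for m
  proof (cases "m = 1")
    case True
    then show ?thesis using assms
      by (cases "i = 1") (auto simp: dcmp_def level_def phase_def ds_zero)
  qed (use that assms in \<open>auto simp: dcmp_def\<close>)
  then show ?thesis
    using assms by (subst inner_commute) (simp add: inner_vec3 torus_diff1_uvec)
qed

lemma torus_diff1_le: "norm (torus_diff p [u] w) \<le> bnd * norm u"
proof (cases "u = 0")
  case True
  then show ?thesis using torus_diff_scale[of "[]" p 0 u w] k_ge by simp
next
  case False
  have "norm (torus_diff p [u /\<^sub>R norm u] w) \<le> bnd"
    using False k_ge by (intro torus_diff_bound) auto
  then have "inverse (norm u) * norm (torus_diff p [u] w) \<le> bnd"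
    using torus_diff_scale[of "[]" p "inverse (norm u)" u w] k_ge by simp
  then show ?thesis using False by (simp add: field_simps)
qed

lemma bnd_ge_1: "1 \<le> bnd"
proof -
  have "1 \<le> norm (torus_diff undefined [uvec 0] 0)" using d_ge by (intro torus_diff1_norm) simp
  also have "\<dots> \<le> bnd" using k_ge by (intro torus_diff_bound) auto
  finally show ?thesis .
qed

text \<open>Volume bounds at scale 1, the upper one from a full period box and the lower one from a
  single injectivity ball. At scale \<open>lam\<close> both are divided by
  \<open>lam ^ d\<close>.\<close>

definition upper_volume :: real where
  "upper_volume = unit_ball_vol (real d) * (bnd * d) ^ d * (\<Prod>j<d. prd j)"

definition lower_volume :: real where
  "lower_volume = unit_ball_vol (real d) / 8 ^ d * (1 / (2 * real d)) ^ d"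

lemma volumes_pos: "0 < upper_volume" "0 < lower_volume"
  using d_ge bnd_ge_1 prd_pos by (auto simp: upper_volume_def lower_volume_def intro!: mult_pos_pos prod_pos)

text \<open>The entries answer the conditions on the \<open>L i\<close>, on \<open>fmin\<close> and
  on \<open>fmax\<close>, the density of a uniform law being the inverse volume.\<close>

definition threshold :: real where
  "threshold = max bnd (max upper_volume (1 / lower_volume))"

end

text \<open>In the index \<open>(n, z)\<close>, \<open>n\<close> sets the width
  \<open>1 / (n + 1)\<close> of the neighbourhoods where the curves may differ, and \<open>z\<close>
  names the sheet that keeps passing through the contact point. The contact parameters 0 and
  \<open>pi * al\<close> are half a period apart.\<close>

locale two_sheets = nested_torus d k R B q "2 * pi * al" a b c
  for d k :: nat and R B q al :: real and a b c :: "nat \<Rightarrow> nat \<times> bool \<Rightarrow> real \<Rightarrow> real" +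
  assumes al_pos: "0 < al"
    and agree: "cos (t / al) \<le> cos (1 / (real n + 1)) \<Longrightarrow> - cos (t / al) \<le> cos (1 / (real n + 1)) \<Longrightarrow>
      a 0 (n, False) t = a 0 (n, True) t \<and> b 0 (n, False) t = b 0 (n, True) t \<and> c 0 (n, False) t = c 0 (n, True) t"
    and base: "a 0 (n, z) (if z then pi * al else 0) = 0" "b 0 (n, z) (if z then pi * al else 0) = 0"
      "c 0 (n, z) (if z then pi * al else 0) = 0"
begin

definition base :: "bool \<Rightarrow> real" where "base z = (if z then pi * al else 0)"

text \<open>The translation moves the contact point, which is \<open>center / lam\<close> after
  scaling, to the prescribed \<open>x\<close> for both values of \<open>z\<close>.\<close>

definition sheet :: "real \<Rightarrow> rvec \<Rightarrow> nat \<Rightarrow> bool \<Rightarrow> rvec list \<Rightarrow> rvec \<Rightarrow> rvec" where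
  "sheet lam x n z = scaled_torus lam (x - center /\<^sub>R lam) (n, z)"

definition base_point :: "real \<Rightarrow> bool \<Rightarrow> rvec" where
  "base_point lam z = (base z / lam) *\<^sub>R uvec 0"

lemma base_point_in_Rn: "base_point lam z \<in> Rn d"
  unfolding base_point_def using d_ge by (intro subspace_scale[OF subspace_Rn]) auto

context
  fixes D :: nat and lam fmin fmax :: real and L :: "nat \<Rightarrow> real" and x :: rvec
  assumes lam: "0 < lam" and x: "x \<in> Rn D" and fmin: "0 < fmin"
    and large: "large_parameters d k threshold lam L fmin fmax"
    and D: "d + 2 \<le> D \<or> (d + 1 \<le> D \<and> (\<forall>p t. c 0 p t = 0))"
begin

lemma immersion: "torus_immersion d D k lam L (sheet lam x n z) (\<lambda>j. prd j / lam)"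
  unfolding sheet_def
proof (rule torus_immersion_scaled[OF lam])
  show "bnd * lam ^ (i - 1) \<le> L i" if "3 \<le> i" "i \<le> k" for i
  proof -
    have "bnd \<le> threshold" by (simp add: threshold_def)
    also have "\<dots> \<le> L i / lam ^ (i - 1)" using large that by (simp add: large_parameters_def)
    finally show ?thesis using lam by (simp add: field_simps)
  qed
  have "center \<in> Rn D" unfolding center_def using D by (intro subsetD[OF Rn_mono rvec_of_in_Rn]) auto
  then show "x - center /\<^sub>R lam \<in> Rn D"
    using x by (intro subspace_diff[OF subspace_Rn] subspace_scale[OF subspace_Rn])
qed (use D in auto)

interpretation im: torus_immersion d D k lam L "sheet lam x n z" "\<lambda>j. prd j / lam" for n z
  by (rule immersion)

abbreviation surf :: "nat \<Rightarrow> bool \<Rightarrow> rvec set" where "surf n z \<equiv> im.M n z"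

lemma sheet_base: "sheet lam x n z [] (base_point lam z) = x"
proof -
  have "lam *\<^sub>R base_point lam z = base z *\<^sub>R uvec 0" using lam by (simp add: base_point_def)
  moreover have "torus_diff (n, z) [] (base z *\<^sub>R uvec 0) = center"
    unfolding base_def by (intro torus_diff0_axis base)
  ultimately show ?thesis by (simp add: sheet_def scaled_torus_def divide_inverse)
qed

lemma x_in_surf: "x \<in> surf n z"
  unfolding im.M_def using sheet_base base_point_in_Rn by (metis imageI)

lemma sheet_lipschitz: "dist (sheet lam x n z [] w) (sheet lam x n z [] w') \<le> bnd * dist w w'"
proof (rule im.lipschitz)
  show "norm (sheet lam x n z [u] w) \<le> bnd * norm u" for u w
    using torus_diff1_le lam by (simp add: sheet_def scaled_torus_def)
qed (use bnd_ge_1 in simp)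

lemma surf_upper: "hausdorff_outer d (surf n z) \<le> ennreal (upper_volume / lam ^ d)"
proof -
  have "hausdorff_outer d (surf n z) \<le>
      ennreal (unit_ball_vol (real d) * (bnd * d) ^ d * (\<Prod>j<d. prd j / lam))"
    unfolding im.M_eq_image_cbox[of n z "\<lambda>_. 0"] using bnd_ge_1 prd_pos lam
    by (intro hausdorff_outer_image_cbox_le d_ge sheet_lipschitz) auto
  then show ?thesis by (simp add: upper_volume_def prod_dividef)
qed

lemma surf_lower: "ennreal (lower_volume / lam ^ d) \<le> hausdorff_outer d (surf n z)"
  using im.hausdorff_outer_M_ge[of n z] by (simp add: lower_volume_def power_divide power_mult_distrib mult_ac)

lemma surf_uniform_law: "uniform_law d D (surf n z) \<in> model_at D d k 0 lam L fmin fmax x"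
proof (rule uniform_law_in_model_at)
  show "surf n z \<in> manifold_class D d k 0 lam L" by (rule im.M_in_manifold_class)
  show fin: "hausdorff_outer d (surf n z) < \<infinity>"
    using le_less_trans[OF surf_upper] by simp
  show "0 < hausdorff_outer d (surf n z \<inter> U)" if "open U" "p \<in> surf n z" "p \<in> U" for U p
    using that by (rule im.hausdorff_outer_M_open_pos)
  show "x \<in> surf n z" by (rule x_in_surf)
  define m where "m = enn2real (hausdorff_outer d (surf n z))"
  have m: "hausdorff_outer d (surf n z) = ennreal m" "0 \<le> m" using fin by (auto simp: m_def less_top)
  have up: "m \<le> upper_volume / lam ^ d"
    using surf_upper[of n z] volumes_pos lam unfolding m(1) by (subst (asm) ennreal_le_iff) auto
  have lo: "lower_volume / lam ^ d \<le> m"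
    using surf_lower[of n z] m(2) unfolding m(1) by (subst (asm) ennreal_le_iff) auto
  have l0: "0 < lower_volume / lam ^ d" using volumes_pos lam by simp
  then have m0: "0 < m" using lo by linarith
  have "upper_volume \<le> lam ^ d / fmin" "1 / lower_volume \<le> fmax / lam ^ d"
    using large by (auto simp: large_parameters_def threshold_def)
  then have f: "fmin \<le> lam ^ d / upper_volume" "lam ^ d / lower_volume \<le> fmax"
    using volumes_pos lam fmin by (auto simp: field_simps)
  have "lam ^ d / upper_volume = 1 / (upper_volume / lam ^ d)" by simp
  also have "\<dots> \<le> 1 / m" using up m0 volumes_pos lam by (intro divide_left_mono mult_pos_pos) auto
  finally show "fmin \<le> 1 / enn2real (hausdorff_outer d (surf n z))"
    using f unfolding m_def[symmetric] by simp
  have "1 / m \<le> 1 / (lower_volume / lam ^ d)" using lo l0 by (intro divide_left_mono mult_pos_pos) auto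
  also have "\<dots> = lam ^ d / lower_volume" by simp
  finally show "1 / enn2real (hausdorff_outer d (surf n z)) \<le> fmax"
    using f unfolding m_def[symmetric] by simp
qed

lemma support_surf: "support (uniform_law d D (surf n z)) = surf n z"
  using le_less_trans[OF surf_upper, of \<infinity> n z]
  by (intro support_uniform_law im.compact_M im.M_subset im.hausdorff_outer_M_open_pos) auto

text \<open>The surfaces can differ only where the profile parameter is near a contact parameter.
  Those points lie in the images of two boxes whose first side is proportional to
  \<open>1 / (n + 1)\<close>, under maps whose Lipschitz constant \<open>bnd\<close> is independent
  of \<open>n\<close>.\<close>

lemma surf_diff_le:
  "hausdorff_outer d (surf n z - surf n (\<not> z)) \<le>
    ennreal (2 * (unit_ball_vol (real d) * (bnd * d) ^ d * (2 * al / lam * (\<Prod>j\<in>{1..<d}. prd j / lam))) / (real n + 1))"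
proof -
  define e where "e = 1 / (real n + 1)"
  have e: "0 < e" "e < pi / 2"
  proof -
    show "0 < e" by (simp add: e_def)
    have "e \<le> 1" by (simp add: e_def)
    then show "e < pi / 2" using pi_gt3 by simp
  qed
  \<comment> \<open>The period window starts a quarter period before the first contact parameter, so
    both neighbourhoods lie in its interior.\<close>
  define l where "l = (\<lambda>j::nat. if j = 0 then - (pi / 2) * al / lam else 0)"
  define h where "h = (\<lambda>j. if j = 0 then 2 * e * al / lam else prd j / lam)"
  define l' where "l' t = (\<lambda>j::nat. if j = 0 then (t - e) * al / lam else 0)" for t
  define Box where "Box t = sheet lam x n z [] ` cbox_Rn d (l' t) h" for t
  have "surf n z - surf n (\<not> z) \<subseteq> Box 0 \<union> Box pi"
  proof
    fix p assume p: "p \<in> surf n z - surf n (\<not> z)"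
    then obtain w where w: "w \<in> cbox_Rn d l (\<lambda>j. prd j / lam)" "p = sheet lam x n z [] w"
      unfolding im.M_eq_image_cbox[of n z l] by auto
    then have wR: "w \<in> Rn d" by (simp add: cbox_Rn_def)
    define \<tau> where "\<tau> = lam * coord w 0 / al"
    have c0: "coord w 0 = \<tau> * al / lam" using al_pos lam by (simp add: \<tau>_def)
    have \<tau>: "- (pi / 2) \<le> \<tau>" "\<tau> \<le> 3 * pi / 2"
    proof -
      have "- (pi / 2) * al / lam \<le> coord w 0" "coord w 0 \<le> - (pi / 2) * al / lam + 2 * pi * al / lam"
        using w d_ge by (auto simp: cbox_Rn_def l_def prd_def)
      then show "- (pi / 2) \<le> \<tau>" "\<tau> \<le> 3 * pi / 2"
        using lam al_pos by (auto simp: \<tau>_def field_simps)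
    qed
    have "\<bar>\<tau>\<bar> \<le> e \<or> \<bar>\<tau> - pi\<bar> \<le> e"
    proof (rule ccontr)
      assume no: "\<not> ?thesis"
      have "\<bar>\<tau>\<bar> \<le> 3 * pi / 2" "\<bar>\<tau> - pi\<bar> \<le> 3 * pi / 2" using \<tau> pi_gt_zero by (intro abs_leI; linarith)+
      then have "\<not> cos e < cos \<tau>" "\<not> cos e < cos (\<tau> - pi)"
        using no abs_le_of_cos_gt[OF _ e, of \<tau>] abs_le_of_cos_gt[OF _ e, of "\<tau> - pi"] by auto
      then have "cos \<tau> \<le> cos e" "- cos \<tau> \<le> cos e" by (auto simp: cos_diff)
      then have ag: "a 0 (n, False) (lam * coord w 0) = a 0 (n, True) (lam * coord w 0) \<and>
          b 0 (n, False) (lam * coord w 0) = b 0 (n, True) (lam * coord w 0) \<and>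
          c 0 (n, False) (lam * coord w 0) = c 0 (n, True) (lam * coord w 0)"
        unfolding \<tau>_def e_def by (rule agree)
      have "s j \<phi> (n, False) (lam *\<^sub>R w) = s j \<phi> (n, True) (lam *\<^sub>R w)" for j \<phi>
        by (induction j arbitrary: \<phi>) (use ag in auto)
      then have "cmp m (n, False) (lam *\<^sub>R w) = cmp m (n, True) (lam *\<^sub>R w)" for m
        using ag by (auto simp: cmp_def)
      then have "torus_diff (n, False) [] (lam *\<^sub>R w) = torus_diff (n, True) [] (lam *\<^sub>R w)" by (simp add: torus_diff0)
      then have "sheet lam x n False [] w = sheet lam x n True [] w" by (simp add: sheet_def scaled_torus_def)
      then have "sheet lam x n z [] w = sheet lam x n (\<not> z) [] w" by (cases z) auto
      then show False using p w(2) wR unfolding im.M_def by auto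
    qed
    moreover have "p \<in> Box t" if t: "\<bar>\<tau> - t\<bar> \<le> e" for t
    proof -
      have "t - e \<le> \<tau>" "\<tau> \<le> t + e" using t by auto
      then have "(t - e) * al / lam \<le> \<tau> * al / lam" "\<tau> * al / lam \<le> (t + e) * al / lam"
        using al_pos lam by (auto intro!: divide_right_mono mult_right_mono)
      moreover have "(t + e) * al / lam = (t - e) * al / lam + 2 * e * al / lam"
        by (simp add: add_divide_distrib[symmetric] algebra_simps)
      ultimately have "w \<in> cbox_Rn d (l' t) h"
        using w by (auto simp: cbox_Rn_def l'_def h_def c0 l_def)
      then show ?thesis using w by (simp add: Box_def)
    qed
    ultimately show "p \<in> Box 0 \<union> Box pi" by force
  qed
  then have "hausdorff_outer d (surf n z - surf n (\<not> z)) \<le> hausdorff_outer d (Box 0 \<union> Box pi)"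
    by (rule hausdorff_outer_mono)
  also have "\<dots> \<le> hausdorff_outer d (Box 0) + hausdorff_outer d (Box pi)"
    by (rule hausdorff_outer_Un_le)
  also have "\<dots> \<le> ennreal (unit_ball_vol (real d) * (bnd * d) ^ d * (\<Prod>j<d. h j)) +
      ennreal (unit_ball_vol (real d) * (bnd * d) ^ d * (\<Prod>j<d. h j))"
    unfolding Box_def using bnd_ge_1 prd_pos lam al_pos e
    by (intro add_mono hausdorff_outer_image_cbox_le d_ge sheet_lipschitz) (auto simp: h_def)
  also have "\<dots> = ennreal (2 * (unit_ball_vol (real d) * (bnd * d) ^ d * (\<Prod>j<d. h j)))"
  proof -
    have "0 \<le> unit_ball_vol (real d) * (bnd * d) ^ d * (\<Prod>j<d. h j)"
      using bnd_ge_1 less_imp_le[OF prd_pos] lam al_pos e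
      by (intro mult_nonneg_nonneg prod_nonneg) (auto simp: h_def)
    moreover have "ennreal X + ennreal X = ennreal (2 * X)" if "0 \<le> X" for X
      using that by (simp flip: ennreal_plus)
    ultimately show ?thesis by blast
  qed
  also have "(\<Prod>j<d. h j) = (2 * al / lam * (\<Prod>j\<in>{1..<d}. prd j / lam)) / (real n + 1)"
  proof -
    have "{..<d} = insert 0 {1..<d}" using d_ge by auto
    then have "(\<Prod>j<d. h j) = h 0 * (\<Prod>j\<in>{1..<d}. h j)" by simp
    also have "(\<Prod>j\<in>{1..<d}. h j) = (\<Prod>j\<in>{1..<d}. prd j / lam)"
      by (rule prod.cong) (auto simp: h_def)
    finally show ?thesis by (simp add: h_def e_def)
  qed
  finally show ?thesis by simp
qed

text \<open>The targets \<open>y False\<close> and \<open>y True\<close> are values at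
  \<open>x\<close> of a feature of the surfaces. They must not depend on \<open>n\<close>, which is
  chosen only after \<open>\<eta>\<close>.\<close>

lemma two_sheets_minimax:
  fixes g :: "(nat \<Rightarrow> rvec) \<Rightarrow> rvec"
  assumes "0 \<le> \<Delta>" and g: "g \<in> sample_space D N \<rightarrow>\<^sub>M borel" and \<Delta>: "\<Delta> \<le> norm (y False - y True)"
    and l: "\<And>n z \<omega>. \<omega> \<in> space (sample_space D N) \<Longrightarrow> ennreal (norm (y z - g \<omega>)) \<le> loss (surf n z) \<omega>"
  shows "ennreal (\<Delta> / 2) \<le>
    (SUP P\<in>model_at D d k 0 lam L fmin fmax x. \<integral>\<^sup>+ \<omega>. loss (support P) \<omega> \<partial>(sample_law P N))"
proof (rule minimax_lower_bound[of "lower_volume / lam ^ d" _ g])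
  show "0 < lower_volume / lam ^ d" using volumes_pos lam by simp
  fix \<eta> :: real assume \<eta>: "0 < \<eta>"
  define K where "K = 2 * (unit_ball_vol (real d) * (bnd * d) ^ d * (2 * al / lam * (\<Prod>j\<in>{1..<d}. prd j / lam)))"
  obtain n where n: "K / \<eta> < real n" using reals_Archimedean2 by blast
  have "K / (real n + 1) \<le> \<eta>"
    using n \<eta> by (simp add: field_simps)
  then have diff: "hausdorff_outer d (surf n z - surf n (\<not> z)) \<le> ennreal \<eta>" for z
    by (intro order_trans[OF surf_diff_le[of n z, folded K_def] ennreal_leI])
  have fin: "hausdorff_outer d (surf n z) < \<infinity>" for z
    using le_less_trans[OF surf_upper, of \<infinity> n z] by simp
  show "\<exists>S0 S1 y0 y1.
      compact S0 \<and> compact S1 \<and> S0 \<subseteq> Rn D \<and> S1 \<subseteq> Rn D \<and>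
      hausdorff_outer d S0 < \<infinity> \<and> hausdorff_outer d S1 < \<infinity> \<and>
      ennreal (lower_volume / lam ^ d) \<le> hausdorff_outer d S0 \<and> ennreal (lower_volume / lam ^ d) \<le> hausdorff_outer d S1 \<and>
      hausdorff_outer d (S0 - S1) \<le> ennreal \<eta> \<and> hausdorff_outer d (S1 - S0) \<le> ennreal \<eta> \<and>
      uniform_law d D S0 \<in> model_at D d k 0 lam L fmin fmax x \<and>
      uniform_law d D S1 \<in> model_at D d k 0 lam L fmin fmax x \<and> \<Delta> \<le> norm (y0 - y1) \<and>
      (\<forall>\<omega>\<in>space (sample_space D N). ennreal (norm (y0 - g \<omega>)) \<le> loss (support (uniform_law d D S0)) \<omega> \<and>
         ennreal (norm (y1 - g \<omega>)) \<le> loss (support (uniform_law d D S1)) \<omega>)"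
    using diff[of False] diff[of True] fin l[of _ _ n] \<Delta>
    by (intro exI[of _ "surf n False"] exI[of _ "surf n True"] exI[of _ "y False"] exI[of _ "y True"] conjI
        im.compact_M im.M_subset surf_lower surf_uniform_law ballI) (simp_all only: support_surf not_False_eq_True not_True_eq_False)
qed (use assms in auto)

section \<open>Geometry of the two sheets at the contact point\<close>

lemma surf_tangent_space:
  "tangent_space (surf n z) x = (\<lambda>u. sheet lam x n z [u] (base_point lam z)) ` Rn d"
  using im.tangent_space_eq[OF base_point_in_Rn[of lam z], of n z] by (simp add: sheet_base)

lemma sheet_axis:
  "sheet lam x n z [uvec 0] (base_point lam z) =
     vec3 (a 1 (n, z) (base z)) (b 1 (n, z) (base z)) (c 1 (n, z) (base z))"
  "sheet lam x n z [uvec 0, uvec 0] (base_point lam z) =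
     lam *\<^sub>R vec3 (a 2 (n, z) (base z)) (b 2 (n, z) (base z)) (c 2 (n, z) (base z))"
  using lam torus_diff1_axis[of "(n, z)" "base z"] torus_diff2_axis[of "(n, z)" "base z"]
  by (simp_all add: sheet_def scaled_torus_def base_point_def)

lemma orth_proj_tangent_self:
  "orth_proj (tangent_space (surf n z) x) (r *\<^sub>R vec3 (a 1 (n, z) (base z)) (b 1 (n, z) (base z)) (c 1 (n, z) (base z))) =
   r *\<^sub>R vec3 (a 1 (n, z) (base z)) (b 1 (n, z) (base z)) (c 1 (n, z) (base z))"
  unfolding surf_tangent_space sheet_axis(1)[symmetric]
  by (intro orth_proj_id im.subspace_T subspace_scale[OF im.subspace_T] im.F1_in_T)

text \<open>A vector in the profile components is automatically orthogonal to all rotation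
  directions, so only the velocity of the profile has to be tested.\<close>

lemma orth_proj_tangent_zero:
  assumes "vec3 x1 x2 x3 \<bullet> vec3 (a 1 (n, z) (base z)) (b 1 (n, z) (base z)) (c 1 (n, z) (base z)) = 0"
  shows "orth_proj (tangent_space (surf n z) x) (vec3 x1 x2 x3) = 0"
  unfolding surf_tangent_space
proof (rule orth_proj_eqI[OF im.subspace_T])
  show "0 \<in> (\<lambda>u. sheet lam x n z [u] (base_point lam z)) ` Rn d"
    by (rule subspace_0[OF im.subspace_T])
  fix v assume v: "v \<in> (\<lambda>u. sheet lam x n z [u] (base_point lam z)) ` Rn d"
  have "vec3 x1 x2 x3 \<bullet> v = 0"
  proof (rule im.T_orthI[OF _ v])
    fix j assume j: "j < d"
    show "vec3 x1 x2 x3 \<bullet> sheet lam x n z [uvec j] (base_point lam z) = 0"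
    proof (cases "j = 0")
      case True
      then show ?thesis using assms by (simp only: sheet_axis)
    next
      case False
      have "lam *\<^sub>R base_point lam z = base z *\<^sub>R uvec 0" using lam by (simp add: base_point_def)
      then show ?thesis using torus_diff1_axis_orth[of j "(n, z)" "base z" x1 x2 x3] False j lam
        by (simp add: sheet_def scaled_torus_def inner_commute)
    qed
  qed
  then show "(vec3 x1 x2 x3 - 0) \<bullet> v = 0" by simp
qed

text \<open>An acceleration orthogonal to the velocity of the profile is already normal to the
  surface, so its tangential correction vanishes.\<close>

lemma second_fundamental_form_surf:
  assumes "vec3 (a 2 (n, z) (base z)) (b 2 (n, z) (base z)) (c 2 (n, z) (base z)) \<bullet>
    vec3 (a 1 (n, z) (base z)) (b 1 (n, z) (base z)) (c 1 (n, z) (base z)) = 0"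
    and "v = r *\<^sub>R vec3 (a 1 (n, z) (base z)) (b 1 (n, z) (base z)) (c 1 (n, z) (base z))"
  shows "second_fundamental_form (surf n z) x v v =
    (r\<^sup>2 * lam) *\<^sub>R vec3 (a 2 (n, z) (base z)) (b 2 (n, z) (base z)) (c 2 (n, z) (base z))"
proof -
  let ?V = "vec3 (a 2 (n, z) (base z)) (b 2 (n, z) (base z)) (c 2 (n, z) (base z))"
  let ?T = "(\<lambda>u. sheet lam x n z [u] (base_point lam z)) ` Rn d"
  let ?u = "r *\<^sub>R uvec 0"
  have u: "?u \<in> Rn d" using d_ge by (intro subspace_scale[OF subspace_Rn]) auto
  have v: "v = sheet lam x n z [?u] (base_point lam z)"
    unfolding assms(2) sheet_axis(1)[symmetric] linear_scale[OF bounded_linear.linear[OF im.lin1]] ..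
  have F2: "sheet lam x n z [?u, ?u] (base_point lam z) = (r\<^sup>2 * lam) *\<^sub>R ?V"
    unfolding im.F2_scale_left im.F2_scale_right sheet_axis by (simp add: power2_eq_square)
  have "finite ((\<lambda>j. sheet lam x n z [uvec j] (base_point lam z)) ` {..<d})" by simp
  note lin = bounded_linear.linear[OF bounded_linear_orth_proj[OF this]]
  have "orth_proj ?T ((r\<^sup>2 * lam) *\<^sub>R ?V) = (r\<^sup>2 * lam) *\<^sub>R orth_proj ?T ?V"
    unfolding im.T_eq_span by (rule linear_scale[OF lin])
  also have "orth_proj ?T ?V = 0"
    using orth_proj_tangent_zero[OF assms(1)] unfolding surf_tangent_space .
  finally show ?thesis
    using im.second_fundamental_form_eq[OF base_point_in_Rn[of lam z] u u, of n z]
    by (simp add: sheet_base F2 flip: v)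
qed

lemma tangent_space_surf_span: "\<exists>S. finite S \<and> tangent_space (surf n z) x = span S"
  unfolding surf_tangent_space im.T_eq_span by blast

end

end


section \<open>The two profile curves\<close>

text \<open>The \<open>i\<close>-th derivative of \<open>A * sin (w * t + f)\<close> in closed form:
  each differentiation is a factor \<open>w\<close> and a quarter turn.\<close>

definition trig :: "real \<Rightarrow> real \<Rightarrow> real \<Rightarrow> nat \<Rightarrow> real \<Rightarrow> real" where
  "trig A w f i t = A * w ^ i * sin (w * t + f + real i * (pi / 2))"

lemma trig_deriv [derivative_intros]: "(trig A w f i has_real_derivative trig A w f (Suc i) t) (at t)"
  unfolding trig_def[abs_def] sin_add_Suc_quarter by (auto intro!: derivative_eq_intros)

lemma trig_cont [continuous_intros]: "continuous_on S (trig A w f i)"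
  unfolding trig_def[abs_def] by (intro continuous_intros)

lemma trig_bound:
  assumes "\<bar>w\<bar> \<le> 1"
  shows "\<bar>trig A w f i t\<bar> \<le> \<bar>A\<bar>"
proof -
  have "\<bar>w\<bar> ^ i \<le> 1" using assms by (intro power_le_one) auto
  then have "\<bar>A\<bar> * \<bar>w\<bar> ^ i * \<bar>sin (w * t + f + real i * (pi / 2))\<bar> \<le> \<bar>A\<bar> * 1 * 1"
    by (intro mult_mono) auto
  then show ?thesis by (simp add: trig_def abs_mult power_abs)
qed

lemma trig_simps:
  "trig A w f 0 t = A * sin (w * t + f)" "trig A w f 1 t = A * w * cos (w * t + f)"
  "trig A w f 2 t = - A * w\<^sup>2 * sin (w * t + f)"
  using sin_add_Suc_quarter[of "w * t + f" 0] sin_add_Suc_quarter[of "w * t + f" 1]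
  by (simp_all add: trig_def numeral_2_eq_2 cos_add)

text \<open>In both profiles \<open>a\<close> is a multiple of a sine. Equal values of
  \<open>a\<close> then mean equal parameters modulo the period or mirror images with opposite
  cosines, and only the latter could be self-intersections.\<close>

lemma cos_eq_cases:
  fixes x y :: real
  assumes "sin x = sin y"
  obtains n :: int where "y = x + 2 * pi * n" | "cos y = - cos x" "cos x \<noteq> 0"
proof -
  have "(cos y)\<^sup>2 = (cos x)\<^sup>2" using assms by (simp add: cos_squared_eq)
  then have "cos y = cos x \<or> cos y = - cos x" by (simp add: power2_eq_iff)
  then consider "cos y = cos x" | "cos y = - cos x" "cos x \<noteq> 0" by fastforce
  then show thesis using that assms sin_cos_eq_iff[of y x] by cases auto
qed

text \<open>The radius is chosen last: with \<open>B\<close> and \<open>q < 1\<close> known,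
  \<open>R\<close> is taken so large that the rotations use at most the margin
  \<open>1 - q\<close>.\<close>

lemma two_sheets_exI:
  fixes a b c :: "nat \<Rightarrow> nat \<times> bool \<Rightarrow> real \<Rightarrow> real"
  assumes "1 \<le> d" "2 \<le> k"
    and deriv: "\<And>i p t. i < k \<Longrightarrow> (a i p has_real_derivative a (Suc i) p t) (at t)"
      "\<And>i p t. i < k \<Longrightarrow> (b i p has_real_derivative b (Suc i) p t) (at t)"
      "\<And>i p t. i < k \<Longrightarrow> (c i p has_real_derivative c (Suc i) p t) (at t)"
    and bounds: "\<And>i p t. i \<le> k \<Longrightarrow> \<bar>a i p t\<bar> \<le> A" "\<And>i p t. i \<le> k \<Longrightarrow> \<bar>b i p t\<bar> \<le> A"
      "\<And>i p t. i \<le> k \<Longrightarrow> \<bar>c i p t\<bar> \<le> A"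
    and cont: "\<And>p. continuous_on UNIV (a k p)" "\<And>p. continuous_on UNIV (b k p)" "\<And>p. continuous_on UNIV (c k p)"
    and speed: "\<And>p t. 1 \<le> (a 1 p t)\<^sup>2 + (b 1 p t)\<^sup>2 + (c 1 p t)\<^sup>2"
    and curv: "\<And>p t. (a 2 p t)\<^sup>2 + (b 2 p t)\<^sup>2 + (c 2 p t)\<^sup>2 \<le> q\<^sup>2" and q: "0 \<le> q" "q < 1"
    and al: "0 < al"
    and eq_iff: "\<And>p t t'. (a 0 p t = a 0 p t' \<and> b 0 p t = b 0 p t' \<and> c 0 p t = c 0 p t') \<longleftrightarrow>
       (\<exists>m::int. t' = t + m * (2 * pi * al))"
    and agree: "\<And>n t. cos (t / al) \<le> cos (1 / (real n + 1)) \<Longrightarrow> - cos (t / al) \<le> cos (1 / (real n + 1)) \<Longrightarrow>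
      a 0 (n, False) t = a 0 (n, True) t \<and> b 0 (n, False) t = b 0 (n, True) t \<and> c 0 (n, False) t = c 0 (n, True) t"
    and base: "\<And>n z. a 0 (n, z) (if z then pi * al else 0) = 0" "\<And>n z. b 0 (n, z) (if z then pi * al else 0) = 0"
      "\<And>n z. c 0 (n, z) (if z then pi * al else 0) = 0"
  shows "\<exists>R B. two_sheets d k R B q al a b c"
proof -
  define B where "B = max 3 A"
  define N where "N = real d * real d * (real d + 2)"
  define R where "R = max B (N * (6 * B) / (1 - q))"
  have B: "3 \<le> B" "A \<le> B" by (auto simp: B_def)
  have R: "B \<le> R" "0 < R" "N * (6 * B) / (1 - q) \<le> R" using B by (auto simp: R_def)
  have "N * (6 * B) \<le> (1 - q) * R" using R q by (simp add: field_simps)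
  then have "N * (6 * B / R) \<le> 1 - q" using R by (simp add: field_simps)
  then have large: "q + real d * real d * (real d + 2) * (6 * B / R) \<le> 1" by (simp add: N_def)
  have "two_sheets d k R B q al a b c"
  proof
    show "\<bar>a i p t\<bar> \<le> B" if "i \<le> k" for i p t using bounds(1)[OF that, of p t] B by linarith
    show "\<bar>b i p t\<bar> \<le> B" if "i \<le> k" for i p t using bounds(2)[OF that, of p t] B by linarith
    show "\<bar>c i p t\<bar> \<le> B" if "i \<le> k" for i p t using bounds(3)[OF that, of p t] B by linarith
  qed (fact assms B R large | use al in simp)+
  then show ?thesis by blast
qed

lemma cos_eps: "0 < cos (1 / (real n + 1))" "cos (1 / (real n + 1)) < 1"
proof -
  define e where "e = 1 / (real n + 1)"
  have e: "0 < e" "e \<le> 1" by (auto simp: e_def)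
  then have "e < pi / 2" using pi_gt3 by simp
  then show "0 < cos (1 / (real n + 1))" using e unfolding e_def by (intro cos_gt_zero) auto
  have "cos e < cos 0" using e pi_gt3 by (intro cos_monotone_0_pi) auto
  then show "cos (1 / (real n + 1)) < 1" by (simp add: e_def)
qed

text \<open>The Gerono lemniscate, lifted near one of its two branches at the origin.\<close>

lemma figure_eight:
  assumes "1 \<le> d" "2 \<le> k"
  shows "\<exists>R B q al a b c. two_sheets d k R B q al a b c \<and>
    (\<forall>n z. a 1 (n, z) (if z then pi * al else 0) = (if z then - 2 else 2) \<and>
      b 1 (n, z) (if z then pi * al else 0) = 2 \<and> c 1 (n, z) (if z then pi * al else 0) = 0)"
proof -
  obtain h where "is_bump k 1 h" using bump_exists[of 1 k] by auto
  note h = is_bumpD[OF this]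
  \<comment> \<open>The bump sits on the sheet opposite to the base point: for
    \<open>z = True\<close> the base parameter is half a period, so the bump is centred at 0, and
    conversely.\<close>
  define \<sigma> where "\<sigma> z = (if z then 0 else pi)" for z :: bool
  \<comment> \<open>With \<open>x = t / 10\<close> the planar curve is
    \<open>20 * (sin x, sin x * cos x)\<close>. It passes the origin with velocities
    \<open>(2, 2)\<close> and \<open>(- 2, 2)\<close>, and the scale 10 keeps second derivatives
    below \<open>1 / 2\<close>.\<close>
  define a where "a i p t = trig 20 (1 / 10) 0 i t" for i and p :: "nat \<times> bool" and t
  define b where "b i p t = trig 10 (2 / 10) 0 i t" for i and p :: "nat \<times> bool" and t
  define c where "c i p t = (1 / 10) ^ i * h i (1 / (real (fst p) + 1)) (1 / 10 * t - \<sigma> (snd p))" for i and p :: "nat \<times> bool" and t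
  have c_small: "\<bar>c i p t\<bar> \<le> (1 / 10) ^ i" if "i \<le> k" for i p t
    unfolding c_def abs_mult using h(2)[OF that, of "1 / (real (fst p) + 1)" "1 / 10 * t - \<sigma> (snd p)"]
      mult_left_mono[of _ 1 "(1 / 10 :: real) ^ i"] by simp
  have a0: "a 0 p t = 20 * sin (t / 10)" and b0: "b 0 p t = 20 * (sin (t / 10) * cos (t / 10))" for p t
    using sin_double[of "t / 10"] by (simp_all add: a_def b_def trig_simps)
  have "\<exists>R B. two_sheets d k R B (1 / 2) 10 a b c"
  proof (rule two_sheets_exI[where A = 20])
    fix i p t
    show "(a i p has_real_derivative a (Suc i) p t) (at t)"
      unfolding a_def by (rule trig_deriv)
    show "(b i p has_real_derivative b (Suc i) p t) (at t)"
      unfolding b_def by (rule trig_deriv)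
    show "(c i p has_real_derivative c (Suc i) p t) (at t)" if "i < k"
      unfolding c_def[abs_def]
      by (rule derivative_eq_intros DERIV_chain2[OF h(1)[OF that]] refl)+ simp
    show "\<bar>a i p t\<bar> \<le> 20" unfolding a_def by (rule order_trans[OF trig_bound]) auto
    show "\<bar>b i p t\<bar> \<le> 20" unfolding b_def by (rule order_trans[OF trig_bound]) auto
    show "\<bar>c i p t\<bar> \<le> 20" if "i \<le> k"
      using c_small[OF that, of p t] power_le_one[of "1 / 10 :: real" i] by linarith
    show "continuous_on UNIV (a k p)" "continuous_on UNIV (b k p)"
      unfolding a_def[abs_def] b_def[abs_def] by (intro continuous_intros)+
    show "continuous_on UNIV (c k p)"
      unfolding c_def[abs_def] by (intro continuous_intros continuous_on_compose2[OF h(3)]) auto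
    show "1 \<le> (a 1 p t)\<^sup>2 + (b 1 p t)\<^sup>2 + (c 1 p t)\<^sup>2"
    proof -
      define y where "y = (cos (t / 10))\<^sup>2"
      have "a 1 p t = 2 * cos (t / 10)" "b 1 p t = 2 * (2 * y - 1)"
        using cos_double_cos[of "t / 10"] by (simp_all add: a_def b_def trig_simps y_def del: One_nat_def)
      then have "(a 1 p t)\<^sup>2 + (b 1 p t)\<^sup>2 = 4 * y + 4 * (2 * y - 1)\<^sup>2"
        by (simp only: power_mult_distrib y_def[symmetric]) simp
      also have "\<dots> = (4 * y - 3 / 2)\<^sup>2 + 7 / 4" by (simp add: power2_eq_square algebra_simps)
      finally show ?thesis
        using zero_le_power2[of "4 * y - 3 / 2"] zero_le_power2[of "c 1 p t"] by linarith
    qed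
    show "(a 2 p t)\<^sup>2 + (b 2 p t)\<^sup>2 + (c 2 p t)\<^sup>2 \<le> (1 / 2)\<^sup>2"
    proof -
      have "\<bar>a 2 p t\<bar> \<le> 2 / 10" "\<bar>b 2 p t\<bar> \<le> 4 / 10" "\<bar>c 2 p t\<bar> \<le> 1 / 100"
        using abs_sin_le_one[of "t / 10"] abs_sin_le_one[of "t / 5"] c_small[of 2 p t] assms
        by (simp_all add: a_def b_def trig_simps abs_mult power2_eq_square)
      then have "(a 2 p t)\<^sup>2 \<le> (2 / 10)\<^sup>2" "(b 2 p t)\<^sup>2 \<le> (4 / 10)\<^sup>2" "(c 2 p t)\<^sup>2 \<le> (1 / 100)\<^sup>2"
        by (auto simp: abs_le_square_iff[symmetric])
      then show ?thesis by (simp add: power2_eq_square)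
    qed
    show "(a 0 p t = a 0 p t' \<and> b 0 p t = b 0 p t' \<and> c 0 p t = c 0 p t') \<longleftrightarrow>
       (\<exists>m::int. t' = t + m * (2 * pi * 10))" for t'
    proof
      assume eq: "a 0 p t = a 0 p t' \<and> b 0 p t = b 0 p t' \<and> c 0 p t = c 0 p t'"
      then have s: "sin (t / 10) = sin (t' / 10)" by (simp add: a0)
      then show "\<exists>m::int. t' = t + m * (2 * pi * 10)"
      proof (cases rule: cos_eq_cases)
        case (1 n)
        then show ?thesis by (intro exI[of _ n]) (simp add: field_simps)
      next
        case 2
        have "20 * (sin (t / 10) * cos (t / 10)) = 20 * (sin (t' / 10) * cos (t' / 10))"
          using eq by (simp only: b0)
        then have "sin (t / 10) * cos (t / 10) = 0"
          unfolding s[symmetric] 2(1) mult_minus_right by linarith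
        then have "sin (t / 10) = 0" using 2(2) by simp
        then have "\<bar>cos (t / 10)\<bar> = 1" using sin_cos_squared_add[of "t / 10"] by (simp add: abs_square_eq_1)
        \<comment> \<open>Of the two passages through the origin, one is at the centre of the bump,
          where it is positive, and the other is opposite to it, where the bump vanishes.\<close>
        then have "cos (t / 10 - \<sigma> (snd p)) = 1 \<and> cos (t' / 10 - \<sigma> (snd p)) = -1 \<or>
            cos (t / 10 - \<sigma> (snd p)) = -1 \<and> cos (t' / 10 - \<sigma> (snd p)) = 1"
          using 2 by (auto simp: \<sigma>_def cos_diff abs_if split: if_splits)
        then show ?thesis
          using eq h(4)[of "1 / (real (fst p) + 1)" "t / 10 - \<sigma> (snd p)"]
            h(4)[of "1 / (real (fst p) + 1)" "t' / 10 - \<sigma> (snd p)"]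
            h(5)[of "t / 10 - \<sigma> (snd p)" "1 / (real (fst p) + 1)"]
            h(5)[of "t' / 10 - \<sigma> (snd p)" "1 / (real (fst p) + 1)"] cos_eps[of "fst p"]
          by (auto simp: c_def)
      qed
    next
      assume "\<exists>m::int. t' = t + m * (2 * pi * 10)"
      then obtain m :: int where "t' / 10 = t / 10 + 2 * pi * m" by (auto simp: field_simps)
      then have sc: "sin (t' / 10) = sin (t / 10)" "cos (t' / 10) = cos (t / 10)"
        using sin_cos_eq_iff[of "t' / 10" "t / 10"] by auto
      then have "cos (t / 10 - \<sigma> (snd p)) = cos (t' / 10 - \<sigma> (snd p))" by (simp add: cos_diff)
      from h(7)[OF this] sc show "a 0 p t = a 0 p t' \<and> b 0 p t = b 0 p t' \<and> c 0 p t = c 0 p t'"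
        by (simp add: a0 b0 c_def)
    qed
    show "a 0 (n, False) t = a 0 (n, True) t \<and> b 0 (n, False) t = b 0 (n, True) t \<and> c 0 (n, False) t = c 0 (n, True) t"
      if "cos (t / 10) \<le> cos (1 / (real n + 1))" "- cos (t / 10) \<le> cos (1 / (real n + 1))" for n
      using that h(5) by (simp add: a0 b0 c_def \<sigma>_def cos_diff)
    show "a 0 (n, z) (if z then pi * 10 else 0) = 0" "b 0 (n, z) (if z then pi * 10 else 0) = 0"
      "c 0 (n, z) (if z then pi * 10 else 0) = 0" for n z
      using h(5)[of pi "1 / (real n + 1)"] h(5)[of "- pi" "1 / (real n + 1)"] cos_eps[of n]
      by (auto simp: a0 b0 c_def \<sigma>_def)
  qed (use assms in auto)
  then obtain R B where "two_sheets d k R B (1 / 2) 10 a b c" by blast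
  moreover have "a 1 (n, z) (if z then pi * 10 else 0) = (if z then - 2 else 2) \<and>
      b 1 (n, z) (if z then pi * 10 else 0) = 2 \<and> c 1 (n, z) (if z then pi * 10 else 0) = 0" for n z
    using h(6)[of 1 pi "1 / (real n + 1)"] h(6)[of 1 "- pi" "1 / (real n + 1)"] cos_eps[of n] assms
    by (auto simp: a_def b_def trig_simps c_def \<sigma>_def simp del: One_nat_def)
  ultimately show ?thesis by blast
qed

text \<open>Up to \<open>e\<close>, the vertical speed vanishes at \<open>s = 0\<close> and where
  \<open>s\<^sup>2 = 2 / 3\<close>, that is \<open>c\<^sup>2 = 1 / 3\<close>, just above the value
  \<open>16 / 49\<close> at which the horizontal speed is 1. For smaller \<open>c\<^sup>2\<close>
  the factor \<open>2 - 3 * s\<^sup>2\<close> has modulus at least \<open>1 / 49\<close>, and 490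
  lifts the vertical speed to at least 8, more than \<open>e\<close> can undo.\<close>

lemma biconcave_speed:
  fixes s c e :: real
  assumes "s\<^sup>2 + c\<^sup>2 = 1" "\<bar>e\<bar> \<le> 1"
  shows "1 \<le> (7 / 4 * c)\<^sup>2 + (490 * (s * (2 - 3 * s\<^sup>2)) + e)\<^sup>2"
proof (cases "16 / 49 \<le> c\<^sup>2")
  case True
  then have "1 \<le> (7 / 4 * c)\<^sup>2" by (simp add: power_mult_distrib power_divide)
  then show ?thesis by (simp add: add_increasing2)
next
  case False
  then have s2: "33 / 49 < s\<^sup>2" using assms by simp
  then have "(4 / 5)\<^sup>2 \<le> s\<^sup>2" by (simp add: power_divide)
  then have "4 / 5 \<le> \<bar>s\<bar>" using abs_le_square_iff[of "4 / 5" s] by simp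
  moreover have "1 / 49 \<le> \<bar>2 - 3 * s\<^sup>2\<bar>" using s2 by simp
  ultimately have "(4 / 5) * (1 / 49) \<le> \<bar>s\<bar> * \<bar>2 - 3 * s\<^sup>2\<bar>" by (intro mult_mono) auto
  then have "8 \<le> \<bar>490 * (s * (2 - 3 * s\<^sup>2))\<bar>" by (simp add: abs_mult)
  then have "\<bar>1\<bar> \<le> \<bar>490 * (s * (2 - 3 * s\<^sup>2)) + e\<bar>" using assms(2) by linarith
  then have "1 \<le> (490 * (s * (2 - 3 * s\<^sup>2)) + e)\<^sup>2" unfolding abs_le_square_iff by simp
  then show ?thesis by (simp add: add_increasing)
qed

text \<open>The profile of a biconcave disc pinched at its centre, where the two sheets touch with opposite
  curvatures; a bump pushes one of them away. The constants keep the speed at least \<open>1\<close> and the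
  second derivative below \<open>1\<close>, while the curvatures at the contact point are \<open>1 / 4\<close>.\<close>

lemma biconcave:
  assumes "1 \<le> d" "2 \<le> k"
  shows "\<exists>R B q al a b c. two_sheets d k R B q al a b c \<and> (\<forall>p t. c 0 p t = 0) \<and>
    (\<forall>n z. a 1 (n, z) (if z then pi * al else 0) = (if z then - 7 / 4 else 7 / 4) \<and>
      b 1 (n, z) (if z then pi * al else 0) = 0 \<and> c 1 (n, z) (if z then pi * al else 0) = 0 \<and>
      a 2 (n, z) (if z then pi * al else 0) = 0 \<and>
      b 2 (n, z) (if z then pi * al else 0) = (if z then - 49 / 64 else 49 / 64) \<and>
      c 2 (n, z) (if z then pi * al else 0) = 0)"
proof -
  obtain h where "is_bump k 1 h" using bump_exists[of 1 k] by auto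
  note h = is_bumpD[OF this]
  define \<sigma> where "\<sigma> z = (if z then 0 else pi)" for z :: bool
  define sg :: "bool \<Rightarrow> real" where "sg z = (if z then 1 else - 1)" for z
  \<comment> \<open>Origin of the constants: let \<open>v\<close> be the horizontal speed at the
    contact point. Curvature \<open>1 / 4\<close> there forces a vertical second derivative
    \<open>v\<^sup>2 / 4\<close>, and bounding the cosines by 1 gives
    \<open>5 * v\<^sup>2 / 16\<close> everywhere, up to the bump. This has to stay below 1, so
    \<open>v < 4 / sqrt 5\<close>; speed 1 at the extrema of \<open>b\<close> with
    \<open>cos\<^sup>2 = 1 / 3\<close> needs \<open>v \<ge> sqrt 3\<close>. The value
    \<open>7 / 4\<close> lies between. The scale 1280 makes the vertical speed large away from its
    zeros and the derivatives of the bump negligible.\<close>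
  define a where "a i p t = trig 2240 (1 / 1280) 0 i t" for i and p :: "nat \<times> bool" and t
  \<comment> \<open>The sign \<open>sg\<close> pushes outwards: upwards on the branch with positive
    cosine, downwards on the other.\<close>
  define bump where "bump i p t = sg (snd p) * ((1 / 1280) ^ i * h i (1 / (real (fst p) + 1)) (1 / 1280 * t - \<sigma> (snd p)))"
    for i and p :: "nat \<times> bool" and t
  define b where "b i p t = trig 156800 (1 / 1280) (pi / 2) i t - trig 156800 (3 / 1280) (pi / 2) i t + bump i p t"
    for i and p :: "nat \<times> bool" and t
  define c where "c i p t = (0 :: real)" for i :: nat and p :: "nat \<times> bool" and t :: real
  have bump_small: "\<bar>bump i p t\<bar> \<le> (1 / 1280) ^ i" if "i \<le> k" for i p t
    unfolding bump_def abs_mult using h(2)[OF that, of "1 / (real (fst p) + 1)" "1 / 1280 * t - \<sigma> (snd p)"]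
      mult_left_mono[of _ 1 "(1 / 1280 :: real) ^ i"] by (auto simp: sg_def)
  have a0: "a 0 p t = 2240 * sin (t / 1280)" for p t
    by (simp add: a_def trig_simps)
  have cos3: "cos (x * 3) = 4 * (cos x) ^ 3 - 3 * cos x" and sin3: "sin (x * 3) = 3 * sin x - 4 * (sin x) ^ 3" for x :: real
  proof -
    have x3: "x * 3 = 2 * x + x" by simp
    have sq: "(sin x)\<^sup>2 + (cos x)\<^sup>2 = 1" by simp
    show "cos (x * 3) = 4 * (cos x) ^ 3 - 3 * cos x"
      unfolding x3 cos_add sin_double cos_double_cos using sq by algebra
    show "sin (x * 3) = 3 * sin x - 4 * (sin x) ^ 3"
      unfolding x3 sin_add sin_double cos_double_cos using sq by algebra
  qed
  have b0: "b 0 p t = 627200 * ((sin (t / 1280))\<^sup>2 * cos (t / 1280)) + bump 0 p t" for p t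
  proof -
    have "(sin (t / 1280))\<^sup>2 * cos (t / 1280) = cos (t / 1280) - (cos (t / 1280)) ^ 3"
      by (simp only: sin_squared_eq) (simp add: algebra_simps power2_eq_square power3_eq_cube)
    then show ?thesis using cos3[of "t / 1280"] by (simp add: b_def trig_simps sin_add mult.commute)
  qed
  have b1: "b 1 p t = 490 * (sin (t / 1280) * (2 - 3 * (sin (t / 1280))\<^sup>2)) + bump 1 p t" for p t
    using sin3[of "t / 1280"]
    by (simp add: b_def trig_simps cos_add algebra_simps power2_eq_square power3_eq_cube del: One_nat_def)
  have b2: "b 2 p t = 49 / 512 * (9 * cos (3 * t / 1280) - cos (t / 1280)) + bump 2 p t" for p t
    by (simp add: b_def trig_simps sin_add algebra_simps power2_eq_square)
  have "\<exists>R B. two_sheets d k R B (97 / 100) 1280 a b c"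
  proof (rule two_sheets_exI[where A = 313601])
    fix i p t
    show "(a i p has_real_derivative a (Suc i) p t) (at t)"
      unfolding a_def by (rule trig_deriv)
    show "(b i p has_real_derivative b (Suc i) p t) (at t)" if "i < k"
      unfolding b_def[abs_def] bump_def
      by (rule derivative_eq_intros DERIV_chain2[OF h(1)[OF that]] refl)+ simp
    show "(c i p has_real_derivative c (Suc i) p t) (at t)"
      unfolding c_def by simp
    show "\<bar>a i p t\<bar> \<le> 313601" unfolding a_def by (rule order_trans[OF trig_bound]) auto
    show "\<bar>b i p t\<bar> \<le> 313601" if "i \<le> k"
      using trig_bound[of "1 / 1280" 156800 "pi / 2" i t] trig_bound[of "3 / 1280" 156800 "pi / 2" i t]
        bump_small[OF that, of p t] power_le_one[of "1 / 1280 :: real" i]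
      unfolding b_def by (simp add: abs_le_iff)
    show "\<bar>c i p t\<bar> \<le> 313601" by (simp add: c_def)
    show "continuous_on UNIV (a k p)" "continuous_on UNIV (c k p)"
      unfolding a_def[abs_def] c_def[abs_def] by (intro continuous_intros)+
    show "continuous_on UNIV (b k p)"
      unfolding b_def[abs_def] bump_def by (intro continuous_intros continuous_on_compose2[OF h(3)]) auto
    show "1 \<le> (a 1 p t)\<^sup>2 + (b 1 p t)\<^sup>2 + (c 1 p t)\<^sup>2"
    proof -
      have a1: "a 1 p t = 7 / 4 * cos (t / 1280)" by (simp add: a_def trig_simps del: One_nat_def)
      have "\<bar>bump 1 p t\<bar> \<le> 1" using bump_small[of 1 p t] assms by simp
      then show ?thesis
        using biconcave_speed[of "sin (t / 1280)" "cos (t / 1280)" "bump 1 p t"] unfolding a1 b1 c_def by simp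
    qed
    show "(a 2 p t)\<^sup>2 + (b 2 p t)\<^sup>2 + (c 2 p t)\<^sup>2 \<le> (97 / 100)\<^sup>2"
    proof -
      have "\<bar>a 2 p t\<bar> \<le> 1 / 500"
      proof -
        have "\<bar>a 2 p t\<bar> = 7 / 5120 * \<bar>sin (t / 1280)\<bar>"
          by (simp add: a_def trig_simps abs_mult power2_eq_square)
        then show ?thesis using abs_sin_le_one[of "t / 1280"] by linarith
      qed
      moreover have "\<bar>b 2 p t\<bar> \<le> 958 / 1000"
      proof -
        have "\<bar>9 * cos (3 * t / 1280) - cos (t / 1280)\<bar> \<le> 10"
          using abs_cos_le_one[of "3 * t / 1280"] abs_cos_le_one[of "t / 1280"] by linarith
        moreover have "\<bar>bump 2 p t\<bar> \<le> 1 / 1000000"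
          using bump_small[of 2 p t] assms by (simp add: power2_eq_square)
        ultimately show ?thesis unfolding b2 abs_le_iff by (auto simp: field_simps)
      qed
      ultimately have "(a 2 p t)\<^sup>2 \<le> (1 / 500)\<^sup>2" "(b 2 p t)\<^sup>2 \<le> (958 / 1000)\<^sup>2"
        by (auto simp: abs_le_square_iff[symmetric])
      then show ?thesis by (simp add: power2_eq_square c_def)
    qed
    \<comment> \<open>On the branch with positive cosine \<open>b\<close> is nonnegative, on the
      other one nonpositive. Equal heights at mirror parameters force both to the contact point,
      where the bump keeps them apart.\<close>
    have excl: False
      if "cos t1 = - cos t2" "sin t1 = sin t2" "0 < cos t1"
        "627200 * ((sin t1)\<^sup>2 * cos t1) + bump 0 p (t1 * 1280) = 627200 * ((sin t2)\<^sup>2 * cos t2) + bump 0 p (t2 * 1280)" for t1 t2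
    proof -
      let ?e = "1 / (real (fst p) + 1)"
      have nn: "0 \<le> h 0 ?e y" for y using h(4)[of ?e y] h(5)[of y ?e] by (cases "cos ?e < cos y") auto
      have "0 \<le> (sin t1)\<^sup>2 * cos t1"
        by (intro mult_nonneg_nonneg zero_le_power2 less_imp_le that)
      moreover have "2 * 627200 * ((sin t1)\<^sup>2 * cos t1) + (bump 0 p (t1 * 1280) - bump 0 p (t2 * 1280)) = 0"
        using that by simp
      moreover have "bump 0 p (t1 * 1280) - bump 0 p (t2 * 1280) = h 0 ?e (if snd p then t1 else t2 - pi)"
      proof -
        have "h 0 ?e t2 = 0" "h 0 ?e (t1 - pi) = 0"
          using that cos_eps[of "fst p"] by (auto intro!: h(5) simp: cos_diff)
        then show ?thesis by (simp add: bump_def \<sigma>_def sg_def)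
      qed
      ultimately have z: "(sin t1)\<^sup>2 * cos t1 = 0" "h 0 ?e (if snd p then t1 else t2 - pi) = 0"
        using nn[of "if snd p then t1 else t2 - pi"] by linarith+
      then have "sin t1 = 0" using that by simp
      then have "cos t1 = 1" using that sin_cos_squared_add[of t1] by (simp add: power2_eq_1_iff)
      then have "cos (if snd p then t1 else t2 - pi) = 1" using that by (simp add: cos_diff)
      then show False using h(4)[of ?e "if snd p then t1 else t2 - pi"] cos_eps[of "fst p"] z(2) by simp
    qed
    show "(a 0 p t = a 0 p t' \<and> b 0 p t = b 0 p t' \<and> c 0 p t = c 0 p t') \<longleftrightarrow>
       (\<exists>m::int. t' = t + m * (2 * pi * 1280))" for t'
    proof
      assume eq: "a 0 p t = a 0 p t' \<and> b 0 p t = b 0 p t' \<and> c 0 p t = c 0 p t'"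
      then have s: "sin (t / 1280) = sin (t' / 1280)" by (simp add: a0)
      then show "\<exists>m::int. t' = t + m * (2 * pi * 1280)"
      proof (cases rule: cos_eq_cases)
        case (1 n)
        then show ?thesis by (intro exI[of _ n]) (simp add: field_simps)
      next
        case 2
        then consider "0 < cos (t / 1280)" | "0 < cos (t' / 1280)" by linarith
        then have False
          using excl[of "t / 1280" "t' / 1280"] excl[of "t' / 1280" "t / 1280"] 2 s eq
          by cases (simp_all add: b0)
        then show ?thesis ..
      qed
    next
      assume "\<exists>m::int. t' = t + m * (2 * pi * 1280)"
      then obtain m :: int where "t' / 1280 = t / 1280 + 2 * pi * m" by (auto simp: field_simps)
      then have sc: "sin (t' / 1280) = sin (t / 1280)" "cos (t' / 1280) = cos (t / 1280)"
        using sin_cos_eq_iff[of "t' / 1280" "t / 1280"] by auto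
      then have "cos (t / 1280 - \<sigma> (snd p)) = cos (t' / 1280 - \<sigma> (snd p))" by (simp add: cos_diff)
      from h(7)[OF this] sc show "a 0 p t = a 0 p t' \<and> b 0 p t = b 0 p t' \<and> c 0 p t = c 0 p t'"
        by (simp add: a0 b0 c_def bump_def)
    qed
    show "a 0 (n, False) t = a 0 (n, True) t \<and> b 0 (n, False) t = b 0 (n, True) t \<and> c 0 (n, False) t = c 0 (n, True) t"
      if "cos (t / 1280) \<le> cos (1 / (real n + 1))" "- cos (t / 1280) \<le> cos (1 / (real n + 1))" for n
      using that h(5) by (simp add: a0 b0 c_def bump_def \<sigma>_def cos_diff)
    show "a 0 (n, z) (if z then pi * 1280 else 0) = 0" "b 0 (n, z) (if z then pi * 1280 else 0) = 0"
      "c 0 (n, z) (if z then pi * 1280 else 0) = 0" for n z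
      using h(5)[of pi "1 / (real n + 1)"] h(5)[of "- pi" "1 / (real n + 1)"] cos_eps[of n]
      by (auto simp: a0 b0 c_def bump_def \<sigma>_def)
  qed (use assms in auto)
  then obtain R B where "two_sheets d k R B (97 / 100) 1280 a b c" by blast
  moreover have "a 1 (n, z) (if z then pi * 1280 else 0) = (if z then - 7 / 4 else 7 / 4) \<and>
      b 1 (n, z) (if z then pi * 1280 else 0) = 0 \<and> c 1 (n, z) (if z then pi * 1280 else 0) = 0 \<and>
      a 2 (n, z) (if z then pi * 1280 else 0) = 0 \<and>
      b 2 (n, z) (if z then pi * 1280 else 0) = (if z then - 49 / 64 else 49 / 64) \<and>
      c 2 (n, z) (if z then pi * 1280 else 0) = 0" for n z
  proof -
    have "h i (1 / (real n + 1)) pi = 0" "h i (1 / (real n + 1)) (- pi) = 0" if "i \<le> 2" for i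
      using h(6)[of i pi "1 / (real n + 1)"] h(6)[of i "- pi" "1 / (real n + 1)"] cos_eps[of n] assms that by auto
    then have "bump i (n, z) (if z then pi * 1280 else 0) = 0" if "i \<le> 2" for i
      using that by (auto simp: bump_def \<sigma>_def)
    moreover have "cos (3 * pi) = - 1" using cos3[of pi] by (simp add: mult.commute)
    ultimately show ?thesis
      by (cases z) (simp_all add: a_def trig_simps b1 b2 c_def mult.assoc del: One_nat_def)
  qed
  moreover have "\<forall>p t. c 0 p t = 0" by (simp add: c_def)
  ultimately show ?thesis by blast
qed


section \<open>The two lower bounds\<close>

context two_sheets
begin

text \<open>The feature is the projection of the unit vector \<open>u\<close> along
  \<open>(2, 2, 0)\<close>. It is tangent to one sheet and, as \<open>(2, 2)\<close> and
  \<open>(- 2, 2)\<close> are orthogonal, normal to the other; the targets \<open>u\<close> and 0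
  are at distance 1.\<close>

lemma tangent_minimax:
  assumes ctx: "0 < lam" "x \<in> Rn D" "0 < fmin" "large_parameters d k threshold lam L fmin fmax" "d + 2 \<le> D"
    and frame: "\<And>n z. a 1 (n, z) (base z) = (if z then - 2 else 2) \<and> b 1 (n, z) (base z) = 2 \<and> c 1 (n, z) (base z) = 0"
    and That: "That \<in> tangent_estimators D d N"
  shows "ennreal (1 / 2) \<le>
    (SUP P\<in>model_at D d k 0 lam L fmin fmax x. \<integral>\<^sup>+ \<omega>. tangent_loss x (support P) (That \<omega>) \<partial>(sample_law P N))"
proof -
  have D: "d + 2 \<le> D \<or> (d + 1 \<le> D \<and> (\<forall>p t. c 0 p t = 0))" using ctx(5) by simp
  note ctx = ctx(1-4) D
  define r where "r = 1 / (2 * sqrt 2)"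
  define u where "u = r *\<^sub>R vec3 2 2 0"
  have u_eq: "u = vec3 (r * 2) (r * 2) 0"
    unfolding u_def vec3_def by (rule rvec_eqI) auto
  have norm_u: "norm u = 1"
  proof -
    have "vec3 2 2 0 \<bullet> vec3 2 2 0 = 8"
      using d_ge unfolding inner_vec3 by (simp add: vec3_def)
    then have "u \<bullet> u = 1" by (simp add: u_def r_def)
    then show ?thesis by (simp add: norm_eq_sqrt_inner)
  qed
  have u_Rn: "u \<in> Rn D"
    unfolding u_eq vec3_def using assms(5) by (rule subsetD[OF Rn_mono rvec_of_in_Rn])
  have proj: "orth_proj (tangent_space (torus_immersion.M d (sheet lam x n z)) x) u = (if z then 0 else u)" for n z
  proof (cases z)
    case True
    have "vec3 (r * 2) (r * 2) 0 \<bullet> vec3 (- 2) 2 0 = 0"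
      using d_ge unfolding inner_vec3 by (simp add: vec3_def)
    then show ?thesis
      using orth_proj_tangent_zero[OF ctx, of "r * 2" "r * 2" 0 n z] frame[of n z] True by (simp add: u_eq)
  next
    case False
    then show ?thesis using orth_proj_tangent_self[OF ctx, of n z r] frame[of n z] by (simp add: u_def)
  qed
  have "ennreal (norm ((if z then 0 else u) - orth_proj (That \<omega>) u)) \<le>
      tangent_loss x (torus_immersion.M d (sheet lam x n z)) (That \<omega>)"
    if \<omega>: "\<omega> \<in> space (sample_space D N)" for n z \<omega>
  proof -
    have "subspace (That \<omega>)" "0 < dim (That \<omega>)" using That \<omega> d_ge by (auto simp: tangent_estimators_def)
    then obtain S' where S': "finite S'" "That \<omega> = span S'" by (rule subspace_dim_pos_span)
    obtain S where S: "finite S" "tangent_space (torus_immersion.M d (sheet lam x n z)) x = span S"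
      using tangent_space_surf_span[OF ctx, of n z] by blast
    show ?thesis
      using norm_diff_le_angle[OF S S' norm_u] unfolding proj tangent_loss_def by (rule ennreal_leI)
  qed
  then show ?thesis
    using That u_Rn norm_u
    by (intro two_sheets_minimax[OF ctx, where y = "\<lambda>z. if z then 0 else u" and g = "\<lambda>\<omega>. orth_proj (That \<omega>) u"
          and loss = "\<lambda>S \<omega>. tangent_loss x S (That \<omega>)" and \<Delta> = 1])
      (auto simp: tangent_estimators_def)
qed

text \<open>As \<open>uvec 0\<close> is tangent to both sheets, the loss is bounded below by
  evaluating at \<open>[uvec 0, uvec 0]\<close>. Normalising the speed \<open>7 / 4\<close>
  multiplies the second derivative \<open>49 / 64\<close> by \<open>16 / 49\<close>, so the targets
  are plus and minus \<open>lam / 4\<close> times \<open>uvec 1\<close>.\<close>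

lemma curvature_minimax:
  assumes ctx: "0 < lam" "x \<in> Rn D" "0 < fmin" "large_parameters d k threshold lam L fmin fmax" "d + 1 \<le> D"
    and planar: "\<forall>p t. c 0 p t = 0"
    and frame: "\<And>n z. a 1 (n, z) (base z) = (if z then - 7 / 4 else 7 / 4) \<and> b 1 (n, z) (base z) = 0 \<and> c 1 (n, z) (base z) = 0 \<and>
      a 2 (n, z) (base z) = 0 \<and> b 2 (n, z) (base z) = (if z then - 49 / 64 else 49 / 64) \<and> c 2 (n, z) (base z) = 0"
    and Bhat: "Bhat \<in> bilinear_estimators D N"
  shows "ennreal (lam / 4) \<le>
    (SUP P\<in>model_at D d k 0 lam L fmin fmax x. \<integral>\<^sup>+ \<omega>. curvature_loss D x (support P) (Bhat \<omega>) \<partial>(sample_law P N))"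
proof -
  have D: "d + 2 \<le> D \<or> (d + 1 \<le> D \<and> (\<forall>p t. c 0 p t = 0))" using ctx(5) planar by simp
  note ctx = ctx(1-4) D
  define y where "y z = ((if z then - 1 else 1) * (lam / 4)) *\<^sub>R (uvec 1 :: rvec)" for z :: bool
  have u: "uvec 0 \<in> Rn D" using assms(5) by simp
  have vec3_uvec: "vec3 t 0 0 = t *\<^sub>R uvec 0" "vec3 0 t 0 = t *\<^sub>R uvec 1" for t
    using d_ge by (auto intro!: rvec_eqI simp: vec3_def)
  have u_eq: "uvec 0 = ((if z then - 1 else 1) * (4 / 7)) *\<^sub>R vec3 (a 1 (n, z) (base z)) (b 1 (n, z) (base z)) (c 1 (n, z) (base z))"
    for n z
    using frame[of n z] by (auto simp: vec3_uvec)
  have proj: "orth_proj (tangent_space (torus_immersion.M d (sheet lam x n z)) x) (uvec 0) = uvec 0" for n z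
    unfolding u_eq[of z n] by (rule orth_proj_tangent_self[OF ctx])
  have II: "second_fundamental_form (torus_immersion.M d (sheet lam x n z)) x (uvec 0) (uvec 0) = y z" for n z
    using second_fundamental_form_surf[OF ctx _ u_eq[of z n]] frame[of n z]
    by (auto simp: vec3_uvec y_def power2_eq_square)
  have "ennreal (norm (y z - Bhat \<omega> (uvec 0) (uvec 0))) \<le>
      curvature_loss D x (torus_immersion.M d (sheet lam x n z)) (Bhat \<omega>)" for n z \<omega>
    unfolding curvature_loss_def mult_onorm_def
    by (rule SUP_upper2[of "[uvec 0, uvec 0]"]) (use u in \<open>auto simp: proj II\<close>)
  moreover have "norm (y False - y True) = lam / 2"
  proof -
    have "y False - y True = (lam / 2) *\<^sub>R uvec 1" by (rule rvec_eqI) (simp add: y_def)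
    then show ?thesis using ctx(1) by simp
  qed
  moreover have "(\<lambda>\<omega>. Bhat \<omega> (uvec 0) (uvec 0)) \<in> sample_space D N \<rightarrow>\<^sub>M borel"
    using Bhat u by (simp add: bilinear_estimators_def)
  ultimately have "ennreal (lam / 2 / 2) \<le>
    (SUP P\<in>model_at D d k 0 lam L fmin fmax x. \<integral>\<^sup>+ \<omega>. curvature_loss D x (support P) (Bhat \<omega>) \<partial>(sample_law P N))"
    using ctx(1)
    by (intro two_sheets_minimax[OF ctx, where y = y and g = "\<lambda>\<omega>. Bhat \<omega> (uvec 0) (uvec 0)"
          and loss = "\<lambda>S \<omega>. curvature_loss D x S (Bhat \<omega>)" and \<Delta> = "lam / 2"]) auto
  then show ?thesis by simp
qed

end

theorem theorem1:
  fixes d k :: nat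
  assumes "1 \<le> d" and "3 \<le> k"
  shows "(\<exists>C::real. \<forall>(D::nat) (Lp::real) (L::nat \<Rightarrow> real) (fmin::real) (fmax::real) (x::rvec) (n::nat).
            d + 3 \<le> D \<and> 0 < Lp \<and> 0 < fmin \<and> fmin \<le> fmax \<and> x \<in> Rn D \<and>
            large_parameters d k C Lp L fmin fmax \<and> 1 \<le> n \<longrightarrow>
            (INF That \<in> tangent_estimators D d n.
               SUP P \<in> model_at D d k 0 Lp L fmin fmax x.
                 \<integral>\<^sup>+ \<omega>. tangent_loss x (support P) (That \<omega>) \<partial>(sample_law P n)) \<ge> ennreal (1 / 2))
       \<and> (\<exists>C::real. \<forall>(D::nat) (Lp::real) (L::nat \<Rightarrow> real) (fmin::real) (fmax::real) (x::rvec) (n::nat).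
            d + 1 \<le> D \<and> 0 < Lp \<and> 0 < fmin \<and> fmin \<le> fmax \<and> x \<in> Rn D \<and>
            large_parameters d k C Lp L fmin fmax \<and> 1 \<le> n \<longrightarrow>
            (INF IIhat \<in> bilinear_estimators D n.
               SUP P \<in> model_at D d k 0 Lp L fmin fmax x.
                 \<integral>\<^sup>+ \<omega>. curvature_loss D x (support P) (IIhat \<omega>) \<partial>(sample_law P n)) \<ge> ennreal (Lp / 4))"
proof (intro conjI)
  obtain R B q al a b c where "two_sheets d k R B q al a b c" and
    frame: "\<And>n z. a 1 (n, z) (if z then pi * al else 0) = (if z then - 2 else 2) \<and>
      b 1 (n, z) (if z then pi * al else 0) = 2 \<and> c 1 (n, z) (if z then pi * al else 0) = 0"
    using figure_eight[of d k] assms by auto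
  \<comment> \<open>The profile is fixed from \<open>d\<close> and \<open>k\<close> before the
    remaining parameters are introduced, so \<open>threshold\<close> depends on nothing
    else.\<close>
  then interpret two_sheets d k R B q al a b c by simp
  show "\<exists>C::real. \<forall>(D::nat) (Lp::real) (L::nat \<Rightarrow> real) (fmin::real) (fmax::real) (x::rvec) (n::nat).
      d + 3 \<le> D \<and> 0 < Lp \<and> 0 < fmin \<and> fmin \<le> fmax \<and> x \<in> Rn D \<and>
      large_parameters d k C Lp L fmin fmax \<and> 1 \<le> n \<longrightarrow>
      (INF That \<in> tangent_estimators D d n.
         SUP P \<in> model_at D d k 0 Lp L fmin fmax x.
           \<integral>\<^sup>+ \<omega>. tangent_loss x (support P) (That \<omega>) \<partial>(sample_law P n)) \<ge> ennreal (1 / 2)"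
    by (intro exI[of _ threshold] allI impI INF_greatest tangent_minimax[OF _ _ _ _ _ frame[folded base_def]]) auto
next
  obtain R B q al a b c where "two_sheets d k R B q al a b c" and planar: "\<forall>p t. c 0 p t = 0" and
    frame: "\<And>n z. a 1 (n, z) (if z then pi * al else 0) = (if z then - 7 / 4 else 7 / 4) \<and>
      b 1 (n, z) (if z then pi * al else 0) = 0 \<and> c 1 (n, z) (if z then pi * al else 0) = 0 \<and>
      a 2 (n, z) (if z then pi * al else 0) = 0 \<and>
      b 2 (n, z) (if z then pi * al else 0) = (if z then - 49 / 64 else 49 / 64) \<and>
      c 2 (n, z) (if z then pi * al else 0) = 0"
    using biconcave[of d k] assms by auto
  then interpret two_sheets d k R B q al a b c by simp
  show "\<exists>C::real. \<forall>(D::nat) (Lp::real) (L::nat \<Rightarrow> real) (fmin::real) (fmax::real) (x::rvec) (n::nat).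
      d + 1 \<le> D \<and> 0 < Lp \<and> 0 < fmin \<and> fmin \<le> fmax \<and> x \<in> Rn D \<and>
      large_parameters d k C Lp L fmin fmax \<and> 1 \<le> n \<longrightarrow>
      (INF IIhat \<in> bilinear_estimators D n.
         SUP P \<in> model_at D d k 0 Lp L fmin fmax x.
           \<integral>\<^sup>+ \<omega>. curvature_loss D x (support P) (IIhat \<omega>) \<partial>(sample_law P n)) \<ge> ennreal (Lp / 4)"
    by (intro exI[of _ threshold] allI impI INF_greatest
        curvature_minimax[OF _ _ _ _ _ planar frame[folded base_def]]) auto
qed

end
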